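(* Consider a regular singular, but not logarithmic, rank 2 $(TE)$-structure $(H\to\mathbb C,\nabla)$ over a point. Let $\lambda_1,\lambda_2$ be the eigenvalues of its monodromy $M^{\mathrm{mon}}$ ($\lambda_1=\lambda_2$ is allowed). (a) The case $N^{\mathrm{mon}}=0$: There exist unique (up to renumbering if $\lambda_1=\lambda_2$) numbers $\alpha_1,\alpha_2\in\mathbb C$ with $e^{-2\pi i\alpha_j}=\lambda_j$ and $\alpha_1\neq\alpha_2$ and the following property: there exist elementary sections $s_1\in C^{\alpha_1}\setminus\{0\}$ and $s_2\in C^{\alpha_2}\setminus\{0\}$ and a number $t_2\in\mathbb C^*$ such that $$\mathcal O(H)_0=\mathbb C\{z\}(s_1+t_2s_2)\oplus\mathbb C\{z\}(zs_2)=\mathbb C\{z\}(s_2+t_2^{-1}s_1)\oplus\mathbb C\{z\}(zs_1).$$ The isomorphism class of the $(TE)$-structure is uniquely determined by the information $N^{\mathrm{mon}}=0$ and the set $\{\alpha_1,\alpha_2\}$. The numbers $\alpha_1$ and $\alpha_2$ are called leading exponents. (b) The case $N^{\mathrm{mon}}\ne0$ (thus $\lambda_1=\lambda_2$): There exist unique numbers $\alpha_1,\alpha_2\in\mathbb C$ with $e^{-2\pi i\alpha_j}=\lambda_1$ and $\alpha_1-\alpha_2\in\mathbb N_0$ and the following properties: Choose any elementary section $s_1\in C^{\alpha_1}\setminus\ker(\nabla_{z\partial_z}-\alpha_1:C^{\alpha_1}\to C^{\alpha_1})$. The elementary section $s_2\in C^{\alpha_2}$ with $(\nabla_{z\partial_z}-\alpha_1)(s_1)=z^{\alpha_1-\alpha_2}s_2$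 is a generator of $\ker(\nabla_{z\partial_z}-\alpha_2:C^{\alpha_2}\to C^{\alpha_2})$. Then $$\mathcal O(H)_0=\mathbb C\{z\}(s_1+t_2s_2)\oplus\mathbb C\{z\}(zs_2)$$ for some $t_2\in\mathbb C$. If $\alpha_1>\alpha_2$ (i.e. $\alpha_1-\alpha_2\in\mathbb N$), then $t_2$ is in $\mathbb C^*$ and is independent of the choice of $s_1$. If $\alpha_1=\alpha_2$, then one can replace $s_1$ by $s_1^{[\mathrm{new}]}:=s_1+t_2s_2$, and then $t_2^{[\mathrm{new}]}=0$. The isomorphism class of the $(TE)$-structure is uniquely determined by the information $N^{\mathrm{mon}}\ne0$ and the pair $(\alpha_1,\alpha_2)$ if $\alpha_1=\alpha_2$, and the triple $(\alpha_1,\alpha_2,t_2)$ if $\alpha_1>\alpha_2$. The numbers $\alpha_1$ and $\alpha_2$ are called leading exponents.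
   Context: A $(TE)$-structure over a point is a holomorphic vector bundle $H\to\mathbb C$ ($z$ the coordinate) with a holomorphic connection $\nabla$ on $H':=H|_{\mathbb C^*}$ such that $z^2\nabla_{\partial_z}$ maps $\mathcal O(H)$ to $\mathcal O(H)$. $\mathcal O(H)_0$ is the germ at $z=0$ of the sheaf of sections. Isomorphisms are holomorphic bundle isomorphisms respecting the connections. It is logarithmic if $z\nabla_{\partial_z}\mathcal O(H)_0\subset\mathcal O(H)_0$, and regular singular if all sections in $\mathcal O(H)_0$ have moderate growth at $0$. $M^{\mathrm{mon}}$ is the monodromy ($z\mapsto ze^{2\pi i}$) on the space $H^\infty$ of global flat multivalued sections of $H'$, and $N^{\mathrm{mon}}$ is the logarithm of its unipotent part (so $N^{\mathrm{mon}}=0$ iff $M^{\mathrm{mon}}$ is semisimple). For $\alpha\in\mathbb C$, $C^\alpha:=\{\sigma\in\mathcal O(H')(\mathbb C^* )\mid(\nabla_{z\partial_z}-\alpha)^2\sigma=0\}$; its elements are called elementary sections; $C^\alpha\ne\{0\}$ iff $e^{-2\pi i\alpha}$ is an eigenvalue of $M^{\mathrm{mon}}$, and $z^kC^\alpha=C^{\alpha+k}$ for $k\in\mathbb Z$. $\mathbb N=\{1,2,\dots\}$, $\mathbb N_0=\mathbb N\cup\{0\}$. *)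

theory Defs
  imports "HOL-Analysis.Analysis" "HOL-Library.Function_Algebras"
begin

section \<open>Sections as functions\<close>

text \<open>Sections (of a bundle over a subset of the plane, and multivalued ones) are functions into
  \<open>complex ^ 2\<close>; sums are pointwise, scalar multiplication is the following.\<close>

definition fscale :: "complex \<Rightarrow> ('a \<Rightarrow> complex ^ 2) \<Rightarrow> ('a \<Rightarrow> complex ^ 2)" where
  "fscale c \<sigma> = (\<lambda>x. c *s \<sigma> x)"

global_interpretation sec: vector_space fscale
  by unfold_locales
    (auto simp: fscale_def fun_eq_iff vector_add_ldistrib vector_sadd_rdistrib)

definition zpow_mult :: "nat \<Rightarrow> (complex \<Rightarrow> complex ^ 2) \<Rightarrow> (complex \<Rightarrow> complex ^ 2)" where
  "zpow_mult n \<sigma> = (\<lambda>z. z ^ n *s \<sigma> z)"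


section \<open>Rank 2 (TE)-structures over a point\<close>

text \<open>A rank 2 holomorphic vector bundle \<open>H\<close> over the complex plane is given by its local
  trivialisations \<open>(V, g)\<close>, where \<open>g z : H\<^sub>z \<rightarrow> complex ^ 2\<close> is a linear isomorphism for
  \<open>z \<in> V\<close>. Each fibre \<open>H\<^sub>z\<close> is identified with \<open>complex ^ 2\<close> by an arbitrary linear isomorphism
  that need not depend continuously on \<open>z\<close>. Hence the total space is \<open>complex \<times> complex ^ 2\<close> only
  as a set, the functions \<open>g\<close> need not be continuous, the holomorphic structure is carried by the
  trivialisations alone, and no (global) triviality of the bundle is built in.

  The field \<open>nabla\<close> is the covariant derivative in direction \<open>d/dz\<close>. It is applied to functions
  that are holomorphic sections on some open set of nonzero numbers, and only its values on that
  set matter.\<close>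

record te =
  trivs :: "(complex set \<times> (complex \<Rightarrow> complex ^ 2 ^ 2)) set"
  nabla :: "(complex \<Rightarrow> complex ^ 2) \<Rightarrow> (complex \<Rightarrow> complex ^ 2)"

definition holo_bundle :: "te \<Rightarrow> bool" where
  "holo_bundle T \<longleftrightarrow>
     (\<forall>(V, g) \<in> trivs T. open V \<and> (\<forall>z\<in>V. invertible (g z))) \<and>
     (\<Union>(V, g) \<in> trivs T. V) = UNIV \<and>
     (\<forall>(V, g) \<in> trivs T. \<forall>(W, h) \<in> trivs T. \<forall>i j.
        (\<lambda>z. (h z ** matrix_inv (g z)) $ i $ j) holomorphic_on (V \<inter> W))"

definition hol_sections :: "te \<Rightarrow> complex set \<Rightarrow> (complex \<Rightarrow> complex ^ 2) set" where
  "hol_sections T U =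
     {\<sigma>. \<forall>(V, g) \<in> trivs T. \<forall>i. (\<lambda>z. (g z *v \<sigma> z) $ i) holomorphic_on (U \<inter> V)}"

text \<open>The fourth condition below makes \<open>nabla\<close> a morphism of sheaves.\<close>

definition holo_connection :: "te \<Rightarrow> bool" where
  "holo_connection T \<longleftrightarrow>
     (\<forall>U. open U \<and> 0 \<notin> U \<longrightarrow>
        (\<forall>\<sigma> \<in> hol_sections T U. nabla T \<sigma> \<in> hol_sections T U) \<and>
        (\<forall>\<sigma> \<in> hol_sections T U. \<forall>\<tau> \<in> hol_sections T U. \<forall>z\<in>U.
           nabla T (\<sigma> + \<tau>) z = nabla T \<sigma> z + nabla T \<tau> z) \<and>
        (\<forall>\<sigma> \<in> hol_sections T U. \<forall>f. f holomorphic_on U \<longrightarrow> (\<forall>z\<in>U.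
           nabla T (\<lambda>w. f w *s \<sigma> w) z = deriv f z *s \<sigma> z + f z *s nabla T \<sigma> z)) \<and>
        (\<forall>\<sigma> \<in> hol_sections T U. \<forall>\<tau> \<in> hol_sections T U. (\<forall>z\<in>U. \<sigma> z = \<tau> z) \<longrightarrow>
           (\<forall>z\<in>U. nabla T \<sigma> z = nabla T \<tau> z)))"

definition te_structure :: "te \<Rightarrow> bool" where
  "te_structure T \<longleftrightarrow> holo_bundle T \<and> holo_connection T \<and>
     (\<forall>U. open U \<longrightarrow> (\<forall>\<sigma> \<in> hol_sections T U. \<exists>\<tau> \<in> hol_sections T U.
        \<forall>z \<in> U - {0}. z\<^sup>2 *s nabla T \<sigma> z = \<tau> z))"

definition te_isomorphic :: "te \<Rightarrow> te \<Rightarrow> bool" where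
  "te_isomorphic T T' \<longleftrightarrow> (\<exists>\<Phi> :: complex \<Rightarrow> complex ^ 2 ^ 2.
     (\<forall>z. invertible (\<Phi> z)) \<and>
     (\<forall>(V, g) \<in> trivs T. \<forall>(W, h) \<in> trivs T'. \<forall>i j.
        (\<lambda>z. (h z ** \<Phi> z ** matrix_inv (g z)) $ i $ j) holomorphic_on (V \<inter> W)) \<and>
     (\<forall>U. open U \<and> 0 \<notin> U \<longrightarrow> (\<forall>\<sigma> \<in> hol_sections T U. \<forall>z\<in>U.
        nabla T' (\<lambda>w. \<Phi> w *v \<sigma> w) z = \<Phi> z *v nabla T \<sigma> z)))"


section \<open>Flat multivalued sections and monodromy\<close>

text \<open>Multivalued sections on the punctured plane are functions of \<open>\<zeta> = log z\<close> with value at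
  \<open>\<zeta>\<close> in the fibre over \<open>exp \<zeta>\<close>. All branches have to be holomorphic and flat.\<close>

definition H_infty :: "te \<Rightarrow> (complex \<Rightarrow> complex ^ 2) set" where
  "H_infty T = {\<sigma>. \<forall>W. open W \<and> inj_on exp W \<longrightarrow>
     (let br = (\<lambda>z. \<sigma> (inv_into W exp z))
      in br \<in> hol_sections T (exp ` W) \<and> (\<forall>z \<in> exp ` W. nabla T br z = 0))}"

definition M_mon :: "(complex \<Rightarrow> complex ^ 2) \<Rightarrow> (complex \<Rightarrow> complex ^ 2)" where
  "M_mon \<sigma> = (\<lambda>\<zeta>. \<sigma> (\<zeta> + 2 * of_real pi * \<i>))"

definition mon_eigenvalues :: "te \<Rightarrow> complex set" where
  "mon_eigenvalues T = {l. \<exists>\<sigma> \<in> H_infty T. \<sigma> \<noteq> 0 \<and> M_mon \<sigma> = fscale l \<sigma>}"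

text \<open>Multiplicative Jordan decomposition \<open>L = S U = U S\<close> of an automorphism of a
  finite-dimensional space \<open>V\<close>, with \<open>S\<close> semisimple (i.e. diagonalisable) and \<open>U\<close> unipotent.\<close>

definition lin_endo :: "('a \<Rightarrow> complex ^ 2) set \<Rightarrow>
    (('a \<Rightarrow> complex ^ 2) \<Rightarrow> ('a \<Rightarrow> complex ^ 2)) \<Rightarrow> bool" where
  "lin_endo V L \<longleftrightarrow> (\<forall>\<sigma>\<in>V. L \<sigma> \<in> V) \<and>
     (\<forall>\<sigma>\<in>V. \<forall>\<tau>\<in>V. L (\<sigma> + \<tau>) = L \<sigma> + L \<tau>) \<and>
     (\<forall>c. \<forall>\<sigma>\<in>V. L (fscale c \<sigma>) = fscale c (L \<sigma>))"

definition jordan_decomposition :: "('a \<Rightarrow> complex ^ 2) set \<Rightarrow>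
    (('a \<Rightarrow> complex ^ 2) \<Rightarrow> ('a \<Rightarrow> complex ^ 2)) \<Rightarrow>
    (('a \<Rightarrow> complex ^ 2) \<Rightarrow> ('a \<Rightarrow> complex ^ 2)) \<Rightarrow>
    (('a \<Rightarrow> complex ^ 2) \<Rightarrow> ('a \<Rightarrow> complex ^ 2)) \<Rightarrow> bool" where
  "jordan_decomposition V L S U \<longleftrightarrow> lin_endo V S \<and> lin_endo V U \<and>
     (\<forall>\<sigma>\<in>V. L \<sigma> = S (U \<sigma>) \<and> L \<sigma> = U (S \<sigma>)) \<and>
     sec.span {\<sigma>\<in>V. \<exists>c. S \<sigma> = fscale c \<sigma>} = V \<and>
     (\<exists>k. \<forall>\<sigma>\<in>V. ((\<lambda>\<tau>. U \<tau> - \<tau>) ^^ k) \<sigma> = 0)"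

text \<open>The logarithm series; summing over the nonzero terms makes it a finite sum.\<close>

definition unipotent_log :: "(('a \<Rightarrow> complex ^ 2) \<Rightarrow> ('a \<Rightarrow> complex ^ 2)) \<Rightarrow>
    ('a \<Rightarrow> complex ^ 2) \<Rightarrow> ('a \<Rightarrow> complex ^ 2)" where
  "unipotent_log U \<sigma> =
     (\<Sum>k | 1 \<le> k \<and> ((\<lambda>\<tau>. U \<tau> - \<tau>) ^^ k) \<sigma> \<noteq> 0.
        fscale ((- 1) ^ (k + 1) / of_nat k) (((\<lambda>\<tau>. U \<tau> - \<tau>) ^^ k) \<sigma>))"

text \<open>The value is meaningful for arguments in \<^term>\<open>H_infty T\<close>.\<close>

definition N_mon :: "te \<Rightarrow> (complex \<Rightarrow> complex ^ 2) \<Rightarrow> (complex \<Rightarrow> complex ^ 2)" where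
  "N_mon T \<sigma> = (THE \<tau>. \<exists>S U. jordan_decomposition (H_infty T) M_mon S U \<and>
                              \<tau> = unipotent_log U \<sigma>)"

definition N_mon_zero :: "te \<Rightarrow> bool" where
  "N_mon_zero T \<longleftrightarrow> (\<forall>\<sigma> \<in> H_infty T. N_mon T \<sigma> = 0)"


section \<open>Germs at 0, regular singular and logarithmic structures\<close>

text \<open>Germs at 0 of sections on punctured neighbourhoods of 0 are represented by functions; two
  functions have the same germ iff they agree on a punctured neighbourhood of 0. The following set
  consists of all functions representing an element of the stalk at 0 of the sheaf of sections
  of \<open>H\<close>; their values at 0 are irrelevant.\<close>

definition germs0 :: "te \<Rightarrow> (complex \<Rightarrow> complex ^ 2) set" where
  "germs0 T = {\<sigma>. \<exists>U \<tau>. open U \<and> 0 \<in> U \<and> \<tau> \<in> hol_sections T U \<and> (\<forall>\<^sub>F z in at 0. \<sigma> z = \<tau> z)}"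

text \<open>The stalk is the direct sum of the modules generated by \<open>a\<close> and by \<open>b\<close> over the ring of
  convergent power series, i.e. of germs at 0 of holomorphic functions, both free of rank 1.\<close>

definition germ_basis :: "te \<Rightarrow> (complex \<Rightarrow> complex ^ 2) \<Rightarrow> (complex \<Rightarrow> complex ^ 2) \<Rightarrow> bool" where
  "germ_basis T a b \<longleftrightarrow>
     germs0 T = {\<sigma>. \<exists>f g. f analytic_on {0} \<and> g analytic_on {0} \<and>
                    (\<forall>\<^sub>F z in at 0. \<sigma> z = f z *s a z + g z *s b z)} \<and>
     (\<forall>f g. f analytic_on {0} \<and> g analytic_on {0} \<and>
            (\<forall>\<^sub>F z in at 0. f z *s a z + g z *s b z = 0) \<longrightarrow>
            (\<forall>\<^sub>F z in nhds 0. f z = 0 \<and> g z = 0))"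

definition logarithmic :: "te \<Rightarrow> bool" where
  "logarithmic T \<longleftrightarrow> (\<forall>\<sigma> \<in> germs0 T. (\<lambda>z. z *s nabla T \<sigma> z) \<in> germs0 T)"

text \<open>Moderate growth: on every sector \<open>a < arg z < b\<close> the coefficients with respect to a basis of
  flat multivalued sections are bounded by \<open>C * |z| powr (- N)\<close> near 0.\<close>

definition moderate_growth :: "te \<Rightarrow> (complex \<Rightarrow> complex ^ 2) \<Rightarrow> bool" where
  "moderate_growth T \<sigma> \<longleftrightarrow>
     (\<exists>b1 b2. b1 \<noteq> b2 \<and> sec.independent {b1, b2} \<and> sec.span {b1, b2} = H_infty T \<and>
       (\<forall>a b :: real. \<exists>c1 c2. \<exists>C N R :: real. \<forall>\<zeta>. Re \<zeta> < R \<and> a < Im \<zeta> \<and> Im \<zeta> < b \<longrightarrow>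
          \<sigma> (exp \<zeta>) = c1 \<zeta> *s b1 \<zeta> + c2 \<zeta> *s b2 \<zeta> \<and>
          norm (c1 \<zeta> :: complex) \<le> C * norm (exp \<zeta>) powr (- N) \<and>
          norm (c2 \<zeta> :: complex) \<le> C * norm (exp \<zeta>) powr (- N)))"

definition regular_singular :: "te \<Rightarrow> bool" where
  "regular_singular T \<longleftrightarrow> (\<forall>\<sigma> \<in> germs0 T. moderate_growth T \<sigma>)"


section \<open>Elementary sections\<close>

text \<open>Sections on the punctured plane are represented by functions which vanish at 0, so that
  equality of sections is equality of functions.
  \<open>zdz_minus T \<alpha>\<close> is the covariant derivative along \<open>z d/dz\<close> minus \<open>\<alpha>\<close>.\<close>

definition zdz_minus :: "te \<Rightarrow> complex \<Rightarrow> (complex \<Rightarrow> complex ^ 2) \<Rightarrow> (complex \<Rightarrow> complex ^ 2)" where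
  "zdz_minus T \<alpha> \<sigma> = (\<lambda>z. if z = 0 then 0 else z *s nabla T \<sigma> z - \<alpha> *s \<sigma> z)"

definition elementary :: "te \<Rightarrow> complex \<Rightarrow> (complex \<Rightarrow> complex ^ 2) set" where
  "elementary T \<alpha> = {\<sigma> \<in> hol_sections T (- {0}). \<sigma> 0 = 0 \<and> zdz_minus T \<alpha> (zdz_minus T \<alpha> \<sigma>) = 0}"

definition elementary_ker :: "te \<Rightarrow> complex \<Rightarrow> (complex \<Rightarrow> complex ^ 2) set" where
  "elementary_ker T \<alpha> = {\<sigma> \<in> elementary T \<alpha>. zdz_minus T \<alpha> \<sigma> = 0}"


section \<open>Leading exponents\<close>

definition leading_exponents_ss ::
    "te \<Rightarrow> complex \<Rightarrow> complex \<Rightarrow> complex \<Rightarrow> complex \<Rightarrow> bool" where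
  "leading_exponents_ss T l1 l2 \<alpha>1 \<alpha>2 \<longleftrightarrow>
     exp (- 2 * of_real pi * \<i> * \<alpha>1) = l1 \<and> exp (- 2 * of_real pi * \<i> * \<alpha>2) = l2 \<and> \<alpha>1 \<noteq> \<alpha>2 \<and>
     (\<exists>s1 \<in> elementary T \<alpha>1 - {0}. \<exists>s2 \<in> elementary T \<alpha>2 - {0}. \<exists>t2. t2 \<noteq> 0 \<and>
        germ_basis T (s1 + fscale t2 s2) (zpow_mult 1 s2) \<and>
        germ_basis T (s2 + fscale (inverse t2) s1) (zpow_mult 1 s1))"

text \<open>The relation between \<open>s1\<close> and \<open>s2\<close> in the case of a non-semisimple monodromy.\<close>

definition companion ::
    "te \<Rightarrow> complex \<Rightarrow> complex \<Rightarrow> (complex \<Rightarrow> complex ^ 2) \<Rightarrow> (complex \<Rightarrow> complex ^ 2) \<Rightarrow> bool" where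
  "companion T \<alpha>1 \<alpha>2 s1 s2 \<longleftrightarrow> s2 \<in> elementary T \<alpha>2 \<and>
     (\<exists>n. \<alpha>1 - \<alpha>2 = of_nat n \<and> zdz_minus T \<alpha>1 s1 = zpow_mult n s2)"

definition leading_exponents_nss :: "te \<Rightarrow> complex \<Rightarrow> complex \<Rightarrow> complex \<Rightarrow> bool" where
  "leading_exponents_nss T l \<alpha>1 \<alpha>2 \<longleftrightarrow>
     exp (- 2 * of_real pi * \<i> * \<alpha>1) = l \<and> exp (- 2 * of_real pi * \<i> * \<alpha>2) = l \<and> \<alpha>1 - \<alpha>2 \<in> \<nat> \<and>
     (\<forall>s1 \<in> elementary T \<alpha>1 - elementary_ker T \<alpha>1.
        (\<exists>!s2. companion T \<alpha>1 \<alpha>2 s1 s2) \<and>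
        (\<forall>s2. companion T \<alpha>1 \<alpha>2 s1 s2 \<longrightarrow>
           s2 \<noteq> 0 \<and> elementary_ker T \<alpha>2 = sec.span {s2} \<and>
           (\<exists>t2. germ_basis T (s1 + fscale t2 s2) (zpow_mult 1 s2))))"

text \<open>\<open>t2\<close> is the parameter of \<open>T\<close> with respect to the choice of \<open>s1\<close>.\<close>

definition parameter_nss ::
    "te \<Rightarrow> complex \<Rightarrow> complex \<Rightarrow> (complex \<Rightarrow> complex ^ 2) \<Rightarrow> complex \<Rightarrow> bool" where
  "parameter_nss T \<alpha>1 \<alpha>2 s1 t2 \<longleftrightarrow>
     (\<exists>s2. companion T \<alpha>1 \<alpha>2 s1 s2 \<and> germ_basis T (s1 + fscale t2 s2) (zpow_mult 1 s2))"

end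

theory Submission
  imports Defs "HOL-Complex_Analysis.Complex_Analysis"
begin

text \<open>On the punctured plane the bundle has a global frame of elementary sections. In its coordinates the stalk
  \<open>L\<close> at 0 becomes a lattice of pairs of convergent Laurent series (regular singularity enters here), and the
  derivative along \<open>z d/dz\<close> becomes an explicit operator \<open>\<delta>\<close> with \<open>z\<delta>L \<subseteq> L\<close>. Since \<open>z\<delta>\<close> raises orders, its
  reduction on \<open>L/zL\<close> is nilpotent, and it is not 0 if the structure is not logarithmic. Hence \<open>L\<close> has a basis
  \<open>v, z\<delta>v\<close>. The leading terms of the coordinates of \<open>v\<close> define elementary sections \<open>s1, s2\<close> such that
  \<open>v\<close> and \<open>\<delta>v\<close> lie in the lattice \<open>\<Lambda>\<close> spanned by \<open>s1, s2\<close>, and the determinant shows that they span it. So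
  \<open>L\<close> is spanned by \<open>v\<close> and \<open>z\<Lambda>\<close>, that is by \<open>s1 + t s2\<close> and \<open>z s2\<close>. In the coordinates of this frame the
  uniqueness statements compare orders and determinants, and two structures with the same data are identified
  by mapping one such frame to the other.\<close>


section \<open>Convergent Laurent series\<close>

text \<open>The notions involved live in different places: growth and monodromy refer to flat
  multivalued sections, exponents to single-valued ones, the isomorphism type to the bundle across
  0. A frame of elementary sections links them. It arises by twisting two flat sections with powers
  of \<open>z\<close> and, if the monodromy is not semisimple, a logarithm; the growth condition
  then says that germs have meromorphic coordinates. Laurent series form a field, so Cramer's rule
  and orders can replace estimates, while convergence is merely carried along.

  Whether \<open>v\<close> and \<open>\<delta>v\<close> span \<open>\<Lambda>\<close> is decided by
  one number. With \<open>p0, q0\<close> the values at 0 of the coordinates of \<open>v\<close> in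
  the frame \<open>s1, s2\<close>, and \<open>c0\<close> the value of the nilpotent entry, the
  determinant of \<open>v, \<delta>v\<close> at 0 is
  \<open>p0 * (q0 * (\<alpha>2 - \<alpha>1) + c0 * p0)\<close>. So the exponents must differ in the
  semisimple case, whereas a nilpotent part with \<open>c0 \<noteq> 0\<close> permits equal ones. In
  the semisimple case the scale of \<open>s2\<close> is free and \<open>t\<close> can be made 1; a
  nonzero nilpotent part ties the scale of \<open>s2\<close> to that of \<open>s1\<close>, and
  \<open>t\<close> becomes an invariant unless the exponents agree.\<close>

text \<open>The predicates \<open>cvg\<close> and \<open>reg\<close> single out the germs of meromorphic and of holomorphic functions at 0
  inside the field of formal Laurent series.\<close>

definition cvg :: "complex fls \<Rightarrow> bool" where
  "cvg F \<longleftrightarrow> (\<exists>f. f has_laurent_expansion F)"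

definition reg :: "complex fls \<Rightarrow> bool" where
  "reg F \<longleftrightarrow> cvg F \<and> 0 \<le> fls_subdegree F"

lemma cvg_const [simp, intro]: "cvg (fls_const c)" "cvg 0" "cvg 1" "cvg fls_X" "cvg (fls_X_intpow m)"
  unfolding cvg_def by (auto intro: laurent_expansion_intros)

lemma cvg_add [intro]: "cvg F \<Longrightarrow> cvg G \<Longrightarrow> cvg (F + G)"
  and cvg_diff [intro]: "cvg F \<Longrightarrow> cvg G \<Longrightarrow> cvg (F - G)"
  and cvg_mult [intro]: "cvg F \<Longrightarrow> cvg G \<Longrightarrow> cvg (F * G)"
  and cvg_divide [intro]: "cvg F \<Longrightarrow> cvg G \<Longrightarrow> cvg (F / G)"
  and cvg_inverse [intro]: "cvg F \<Longrightarrow> cvg (inverse F)"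
  and cvg_minus [intro]: "cvg F \<Longrightarrow> cvg (- F)"
  and cvg_deriv [intro]: "cvg F \<Longrightarrow> cvg (fls_deriv F)"
  unfolding cvg_def by (blast intro: laurent_expansion_intros)+

lemma fls_nonneg_iff: "0 \<le> fls_subdegree F \<longleftrightarrow> (\<forall>k<0. fls_nth F k = 0)"
  by (auto intro: fls_subdegree_ge0I)

lemma fls_ge_iff: "F = 0 \<or> n \<le> fls_subdegree F \<longleftrightarrow> (\<forall>k<n. fls_nth F k = 0)"
proof (cases "F = 0")
  case False
  thus ?thesis
    using fls_eq0_below_subdegree[of _ F] fls_subdegree_geI[of F n] by auto
qed simp

lemma reg_const [simp, intro]: "reg (fls_const c)" "reg 0" "reg 1" "reg fls_X"
  by (auto simp: reg_def)

lemma reg_add [intro]: "reg F \<Longrightarrow> reg G \<Longrightarrow> reg (F + G)"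
  and reg_diff [intro]: "reg F \<Longrightarrow> reg G \<Longrightarrow> reg (F - G)"
  and reg_minus [intro]: "reg F \<Longrightarrow> reg (- F)"
  by (auto simp: reg_def fls_nonneg_iff)

lemma reg_mult [intro]: "reg F \<Longrightarrow> reg G \<Longrightarrow> reg (F * G)"
  by (auto simp: reg_def fls_mult_subdegree_ge_0)

lemma reg_power [intro]: "reg F \<Longrightarrow> reg (F ^ n)"
  by (induction n) auto

text \<open>The Euler operator \<open>z d/dz\<close>. It is diagonal on monomials and never lowers
  orders, so \<open>fls_X\<close> times it raises them.\<close>

definition theta :: "complex fls \<Rightarrow> complex fls" where
  "theta F = fls_X * fls_deriv F"

lemma theta_nth [simp]: "fls_nth (theta F) n = of_int n * fls_nth F n"
  by (simp add: theta_def fls_X_times_conv_shift)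

lemma theta_add: "theta (F + G) = theta F + theta G"
  and theta_mult: "theta (F * G) = theta F * G + F * theta G"
  and theta_const [simp]: "theta (fls_const c) = 0"
  and theta_X [simp]: "theta fls_X = fls_X"
  by (auto simp: theta_def algebra_simps)

lemma cvg_theta [intro]: "cvg F \<Longrightarrow> cvg (theta F)"
  by (auto simp: theta_def)

lemma reg_theta [intro]: "reg F \<Longrightarrow> reg (theta F)"
  by (auto simp: reg_def fls_nonneg_iff)

text \<open>For regular series the coefficient 0 is the value at 0, hence multiplicative. This is
  the reduction modulo \<open>fls_X\<close> by which determinants are tested below for being
  units.\<close>

lemma reg_nth0_mult:
  assumes "reg F" "reg G"
  shows "fls_nth (F * G) 0 = fls_nth F 0 * fls_nth G 0"
proof -
  have "F = fps_to_fls (fls_regpart F)" "G = fps_to_fls (fls_regpart G)"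
    using assms by (simp_all add: reg_def fls_regpart_to_fls_trivial)
  hence "F * G = fps_to_fls (fls_regpart F * fls_regpart G)"
    by (metis fls_times_fps_to_fls)
  thus ?thesis by simp
qed

lemma reg_inverse:
  assumes "reg F" "fls_nth F 0 \<noteq> 0"
  shows "reg (1 / F)"
proof -
  have "fls_subdegree F = 0"
    using assms fls_subdegree_leI[of F 0] by (auto simp: reg_def)
  thus ?thesis using assms(1) by (auto simp: reg_def inverse_eq_divide[symmetric] cvg_inverse)
qed

lemma reg_X_factor:
  assumes "reg F" "fls_nth F 0 = 0"
  obtains r where "reg r" "F = fls_X * r"
proof
  have "fls_nth F (k + 1) = 0" if "k < 0" for k
  proof (cases "k = -1")
    case False
    hence "k + 1 < 0" using that by simp
    thus ?thesis using assms(1) by (auto simp: reg_def fls_nonneg_iff)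
  qed (use assms in simp)
  moreover have "cvg (fls_shift 1 F)"
    unfolding fls_divide_X[symmetric] using assms(1) by (intro cvg_divide) (auto simp: reg_def)
  ultimately show "reg (fls_shift 1 F)" unfolding reg_def fls_nonneg_iff by simp
  show "F = fls_X * fls_shift 1 F" by (simp add: fls_X_times_conv_shift)
qed

lemma reg_X_intpow_iff: "reg (fls_X_intpow m) \<longleftrightarrow> 0 \<le> m"
  by (auto simp: reg_def)

section \<open>Lattices of pairs of Laurent series\<close>

definition pdet :: "complex fls \<times> complex fls \<Rightarrow> complex fls \<times> complex fls \<Rightarrow> complex fls" where
  "pdet v w = fst v * snd w - snd v * fst w"

definition psmul :: "complex fls \<Rightarrow> complex fls \<times> complex fls \<Rightarrow> complex fls \<times> complex fls" where
  "psmul p v = (p * fst v, p * snd v)"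

text \<open>Independence of the generators is not built in; it is the separate condition
  \<open>pdet v w \<noteq> 0\<close>.\<close>

definition lat :: "complex fls \<times> complex fls \<Rightarrow> complex fls \<times> complex fls
    \<Rightarrow> (complex fls \<times> complex fls) set" where
  "lat v w = {psmul p v + psmul q w | p q. reg p \<and> reg q}"

lemma fst_psmul [simp]: "fst (psmul p v) = p * fst v"
  and snd_psmul [simp]: "snd (psmul p v) = p * snd v"
  by (simp_all add: psmul_def)

lemma psmul_add: "psmul p (v + w) = psmul p v + psmul p w"
  and psmul_add_left: "psmul (p + q) v = psmul p v + psmul q v"
  and psmul_psmul [simp]: "psmul p (psmul q v) = psmul (p * q) v"
  and psmul_one [simp]: "psmul 1 v = v"
  and psmul_zero [simp]: "psmul 0 v = 0"
  by (simp_all add: prod_eq_iff algebra_simps)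

lemma psmul_cancel: "p \<noteq> 0 \<Longrightarrow> psmul p v = psmul p w \<longleftrightarrow> v = w"
  by (simp add: prod_eq_iff)

lemma pdet_simps [simp]:
  "pdet (psmul p v) w = p * pdet v w" "pdet v (psmul p w) = p * pdet v w"
  "pdet v v = 0" 
  by (simp_all add: pdet_def algebra_simps)

lemma pdet_add: "pdet (u + v) w = pdet u w + pdet v w" "pdet v (u + w) = pdet v u + pdet v w"
  by (simp_all add: pdet_def algebra_simps)

lemma pdet_swap: "pdet v w = - pdet w v"
  by (simp add: pdet_def algebra_simps)

lemma latI: "reg p \<Longrightarrow> reg q \<Longrightarrow> u = psmul p v + psmul q w \<Longrightarrow> u \<in> lat v w"
  by (auto simp: lat_def)

lemma latE:
  assumes "u \<in> lat v w"
  obtains p q where "reg p" "reg q" "u = psmul p v + psmul q w"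
  using assms by (auto simp: lat_def)

lemma lat_gens: "v \<in> lat v w" "w \<in> lat v w"
  by (auto intro: latI[of 1 0] latI[of 0 1])

lemma lat_add:
  assumes "u \<in> lat v w" "u' \<in> lat v w"
  shows "u + u' \<in> lat v w"
proof -
  obtain p q p' q' where "reg p" "reg q" "u = psmul p v + psmul q w"
    "reg p'" "reg q'" "u' = psmul p' v + psmul q' w"
    using assms by (auto elim!: latE)
  thus ?thesis by (intro latI[of "p + p'" "q + q'"]) (auto simp: psmul_add_left)
qed

lemma lat_psmul:
  assumes "u \<in> lat v w" "reg r"
  shows "psmul r u \<in> lat v w"
proof -
  obtain p q where "reg p" "reg q" "u = psmul p v + psmul q w"
    using assms by (auto elim!: latE)
  thus ?thesis using assms by (intro latI[of "r * p" "r * q"]) (auto simp: psmul_add)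
qed

lemma lat_subset:
  assumes "v' \<in> lat v w" "w' \<in> lat v w"
  shows "lat v' w' \<subseteq> lat v w"
  using assms by (auto elim!: latE[of _ v' w'] intro!: lat_add lat_psmul)

lemma cramer:
  assumes "pdet v w \<noteq> 0"
  shows "u = psmul (pdet u w / pdet v w) v + psmul (pdet v u / pdet v w) w"
proof -
  have "pdet v w * fst u = pdet u w * fst v + pdet v u * fst w"
       "pdet v w * snd u = pdet u w * snd v + pdet v u * snd w"
    by (simp_all add: pdet_def algebra_simps)
  hence "fst u = (pdet u w * fst v + pdet v u * fst w) / pdet v w"
        "snd u = (pdet u w * snd v + pdet v u * snd w) / pdet v w"
    using assms by (simp_all add: nonzero_eq_divide_eq mult.commute)
  thus ?thesis by (simp add: prod_eq_iff add_divide_distrib)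
qed

lemma cramer_unique:
  assumes "pdet v w \<noteq> 0" "u = psmul p v + psmul q w"
  shows "p = pdet u w / pdet v w" "q = pdet v u / pdet v w"
  using assms by (simp_all add: pdet_add)

lemma lat_iff:
  assumes "pdet v w \<noteq> 0"
  shows "u \<in> lat v w \<longleftrightarrow> reg (pdet u w / pdet v w) \<and> reg (pdet v u / pdet v w)"
proof
  assume "u \<in> lat v w"
  then obtain p q where "reg p" "reg q" "u = psmul p v + psmul q w" by (rule latE)
  with cramer_unique[OF assms this(3)] show "reg (pdet u w / pdet v w) \<and> reg (pdet v u / pdet v w)"
    by metis
qed (metis latI cramer[OF assms])

text \<open>The determinant is bilinear and alternating; \<open>d\<close> is the determinant of the
  transition matrix, whose entries are regular.\<close>

lemma lat_det:
  assumes "v' \<in> lat v w" "w' \<in> lat v w"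
  obtains d where "reg d" "pdet v' w' = d * pdet v w"
proof -
  obtain p q p' q' where *: "reg p" "reg q" "v' = psmul p v + psmul q w"
    "reg p'" "reg q'" "w' = psmul p' v + psmul q' w"
    using assms by (auto elim!: latE)
  have "pdet v' w' = (p * q' - q * p') * pdet v w"
    by (simp add: * pdet_def algebra_simps)
  thus ?thesis by (rule that[rotated]) (intro reg_diff reg_mult *)
qed

text \<open>A transition matrix with unit determinant is invertible over the regular series. By
  Cramer's rule the coordinates of \<open>u\<close> in the new generators are determinants of
  lattice vectors divided by \<open>d * pdet v w\<close>; \<open>lat_det\<close> cancels
  \<open>pdet v w\<close>, and \<open>1 / d\<close> is regular.\<close>

lemma lat_eqI:
  assumes "v' \<in> lat v w" "w' \<in> lat v w" "pdet v w \<noteq> 0"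
    and "pdet v' w' = d * pdet v w" "reg d" "fls_nth d 0 \<noteq> 0"
  shows "lat v' w' = lat v w"
proof
  have d: "d \<noteq> 0" "reg (1 / d)" using assms reg_inverse by auto
  hence nz: "pdet v' w' \<noteq> 0" using assms by simp
  have "u \<in> lat v' w'" if u: "u \<in> lat v w" for u
  proof -
    obtain p where p: "reg p" "pdet u w' = p * pdet v w" using lat_det[OF u assms(2)] .
    obtain q where q: "reg q" "pdet v' u = q * pdet v w" using lat_det[OF assms(1) u] .
    have eq: "pdet u w' / pdet v' w' = p * (1 / d)" "pdet v' u / pdet v' w' = q * (1 / d)"
      using assms(3,4) d by (simp_all add: p q)
    thus ?thesis unfolding lat_iff[OF nz] eq using p(1) q(1) d(2) by blast
  qed
  thus "lat v w \<subseteq> lat v' w'" by (rule subsetI)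
qed (rule lat_subset[OF assms(1,2)])

section \<open>The operator \<open>\<delta>\<close>, orders and cyclic vectors\<close>

definition pcvg :: "complex fls \<times> complex fls \<Rightarrow> bool" where
  "pcvg v \<longleftrightarrow> cvg (fst v) \<and> cvg (snd v)"

lemma cvg_pdet [intro]: "pcvg v \<Longrightarrow> pcvg w \<Longrightarrow> cvg (pdet v w)"
  by (auto simp: pdet_def pcvg_def)

text \<open>The action of \<open>\<nabla>\<close> along \<open>z d/dz\<close> on the coordinates with respect to a frame \<open>s1, s2\<close> that is mapped to
  \<open>a1 s1 + c s2, a2 s2\<close>.\<close>

definition delta :: "complex \<Rightarrow> complex \<Rightarrow> complex fls \<Rightarrow> complex fls \<times> complex fls \<Rightarrow> complex fls \<times> complex fls"
  where "delta a1 a2 c v = (theta (fst v) + fls_const a1 * fst v,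
     theta (snd v) + c * fst v + fls_const a2 * snd v)"

lemma delta_add: "delta a1 a2 c (v + w) = delta a1 a2 c v + delta a1 a2 c w"
  and delta_psmul: "delta a1 a2 c (psmul p v) = psmul (theta p) v + psmul p (delta a1 a2 c v)"
  by (simp_all add: delta_def prod_eq_iff algebra_simps theta_add theta_mult)

text \<open>This is the induced operator on the determinant line. Only the trace
  \<open>a1 + a2\<close> of the connection matrix enters; the contributions of the off-diagonal
  entry \<open>c\<close> cancel.\<close>

lemma theta_pdet:
  "theta (pdet v w) + fls_const (a1 + a2) * pdet v w =
     pdet (delta a1 a2 c v) w + pdet v (delta a1 a2 c w)"
proof -
  have diff: "theta (F - G) = theta F - theta G" for F G by (simp add: theta_def algebra_simps)
  show ?thesis
    unfolding pdet_def diff theta_mult by (simp add: delta_def algebra_simps flip: fls_plus_const)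
qed

text \<open>The zero series has infinite order here, whereas its \<open>fls_subdegree\<close> is 0;
  this keeps sums and products free of case distinctions.\<close>

definition ordge :: "int \<Rightarrow> complex fls \<Rightarrow> bool" where
  "ordge n F \<longleftrightarrow> (\<forall>k<n. fls_nth F k = 0)"

lemma ordge_iff: "ordge n F \<longleftrightarrow> F = 0 \<or> n \<le> fls_subdegree F"
  unfolding ordge_def fls_ge_iff ..

lemma ordge_mult: "ordge m F \<Longrightarrow> ordge n G \<Longrightarrow> ordge (m + n) (F * G)"
  by (cases "F = 0 \<or> G = 0") (auto simp: ordge_iff)

lemma ordge_add: "ordge m F \<Longrightarrow> ordge m G \<Longrightarrow> ordge m (F + G)"
  and ordge_diff: "ordge m F \<Longrightarrow> ordge m G \<Longrightarrow> ordge m (F - G)"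
  and ordge_theta: "ordge m F \<Longrightarrow> ordge m (theta F)"
  and ordge_mono: "ordge m F \<Longrightarrow> n \<le> m \<Longrightarrow> ordge n F"
  by (auto simp: ordge_def)

lemma reg_iff_ordge: "reg F \<longleftrightarrow> cvg F \<and> ordge 0 F"
  by (auto simp: reg_def ordge_iff)

definition pordge :: "int \<Rightarrow> complex fls \<times> complex fls \<Rightarrow> bool" where
  "pordge n v \<longleftrightarrow> ordge n (fst v) \<and> ordge n (snd v)"

lemma pordge_delta:
  assumes "pordge n v" "reg c"
  shows "pordge n (delta a1 a2 c v)"
proof -
  have *: "ordge n (r * F)" if "reg r" "ordge n F" for r F
    using ordge_mult[of 0 r n F] that by (simp add: reg_iff_ordge)
  show ?thesis using assms
    by (auto simp: pordge_def delta_def intro!: ordge_add ordge_theta *)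
qed

lemma pordge_X: "pordge n v \<Longrightarrow> pordge (n + 1) (psmul fls_X v)"
  using ordge_mult[of 1 fls_X n] by (auto simp: pordge_def add.commute ordge_iff)

lemma pordge_exists:
  obtains n where "pordge n v" "pordge n w"
proof
  let ?n = "min (min (fls_subdegree (fst v)) (fls_subdegree (snd v)))
                (min (fls_subdegree (fst w)) (fls_subdegree (snd w)))"
  show "pordge ?n v" "pordge ?n w" by (auto simp: pordge_def ordge_iff)
qed

lemma pordge_pdet: "pordge m v \<Longrightarrow> pordge n w \<Longrightarrow> ordge (m + n) (pdet v w)"
  unfolding pdet_def pordge_def by (blast intro: ordge_diff ordge_mult)

text \<open>The operator \<open>z\<delta>\<close> raises orders, so its iterates map a lattice \<open>L\<close> into \<open>zL\<close>.\<close>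

lemma X_delta_not_surj:
  assumes "pdet v w \<noteq> 0" "pcvg v" "pcvg w" "reg c"
    and stab: "\<And>u. u \<in> lat v w \<Longrightarrow> psmul fls_X (delta a1 a2 c u) \<in> lat v w"
    and surj: "\<And>u. u \<in> lat v w \<Longrightarrow>
      \<exists>x \<in> lat v w. \<exists>y \<in> lat v w. u = psmul fls_X (delta a1 a2 c x) + psmul fls_X y"
  shows False
proof -
  let ?L = "lat v w" and ?D = "\<lambda>u. psmul fls_X (delta a1 a2 c u)"
  obtain n where n: "pordge n v" "pordge n w" using pordge_exists .
  have reg_ord: "ordge n (r * F)" if "reg r" "ordge n F" for r F
    using ordge_mult[of 0 r n F] that by (simp add: reg_iff_ordge)
  have L_ord: "pordge n u" if "u \<in> ?L" for u
    using that n by (auto elim!: latE simp: pordge_def intro!: ordge_add reg_ord)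
  have deep: "\<exists>x \<in> ?L. \<exists>y \<in> ?L. u = x + psmul fls_X y \<and> pordge (n + int k) x" if "u \<in> ?L" for u k
    using that
  proof (induction k arbitrary: u)
    case 0
    have "0 \<in> ?L" using latI[of 0 0 0 v w] by simp
    thus ?case using 0 L_ord by (intro bexI[of _ u] bexI[of _ 0]) (auto simp: psmul_def prod_eq_iff)
  next
    case (Suc k)
    obtain x y where xy: "x \<in> ?L" "y \<in> ?L" "u = ?D x + psmul fls_X y" using surj Suc.prems by blast
    obtain x' y' where x': "x' \<in> ?L" "y' \<in> ?L" "x = x' + psmul fls_X y'" "pordge (n + int k) x'"
      using Suc.IH xy(1) by blast
    \<comment> \<open>By the Leibniz rule \<open>?D (psmul fls_X y')\<close> is again divisible by
      \<open>fls_X\<close>, so what lies in \<open>zL\<close> stays there, while the order of the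
      remaining term grows by 1.\<close>
    have "u = ?D x' + psmul fls_X (psmul fls_X y' + ?D y' + y)"
      by (simp add: xy(3) x'(3) delta_add delta_psmul psmul_add ac_simps)
    moreover have "psmul fls_X y' + ?D y' + y \<in> ?L"
      by (intro lat_add stab[OF x'(2)] lat_psmul[OF x'(2)] xy(2)) simp
    moreover have "pordge (n + int (Suc k)) (?D x')"
      using pordge_X[OF pordge_delta[OF x'(4) assms(4)]] by (simp add: ac_simps)
    ultimately show ?case using stab x'(1) by blast
  qed
  \<comment> \<open>The orders of \<open>x\<close> and \<open>w\<close> are at least
    \<open>n + M\<close> and \<open>n\<close>, so this \<open>M\<close> pushes
    \<open>pdet x w\<close> beyond the order of \<open>pdet v w\<close>.\<close>
  define M where "M = nat (fls_subdegree (pdet v w) + 1 - 2 * n)"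
  obtain x y where xy: "x \<in> ?L" "y \<in> ?L" "v = x + psmul fls_X y" "pordge (n + int M) x"
    using deep[OF lat_gens(1)] by blast
  obtain p q where pq: "reg p" "reg q" "y = psmul p v + psmul q w" using xy(2) by (rule latE)
  have "pdet v w = pdet x w + fls_X * (p * pdet v w)"
    by (subst xy(3)) (simp add: pdet_add pq(3) algebra_simps)
  moreover have "ordge (fls_subdegree (pdet v w) + 1) (pdet x w)"
    using ordge_mono[OF pordge_pdet[OF xy(4) n(2)]] by (simp add: M_def)
  moreover have "ordge (fls_subdegree (pdet v w) + 1) (fls_X * (p * pdet v w))"
    using ordge_mult[of 1 fls_X "fls_subdegree (pdet v w)" "p * pdet v w"]
      ordge_mult[of 0 p "fls_subdegree (pdet v w)" "pdet v w"] pq(1)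
    by (simp add: ordge_iff[of _ fls_X] ordge_iff[of _ "pdet v w"] reg_iff_ordge add.commute)
  ultimately have "ordge (fls_subdegree (pdet v w) + 1) (pdet v w)"
    using ordge_add by metis
  thus False using assms(1) by (simp add: ordge_iff)
qed

text \<open>Let \<open>U\<close> be the reduction of \<open>z\<delta>\<close> modulo \<open>z\<close>. Its trace vanishes because \<open>z\<delta>\<close> raises the order of the
  determinant of a basis, and its determinant vanishes by the previous lemma. So \<open>U\<close> is nilpotent, and it is
  not 0, as the lattice is not stable under \<open>\<delta>\<close>. A basis vector outside the kernel of \<open>U\<close> is cyclic.\<close>

lemma cyclic_vector:
  assumes nz: "pdet v w \<noteq> 0" and cvg: "pcvg v" "pcvg w" and c: "reg c"
    and stab: "\<And>u. u \<in> lat v w \<Longrightarrow> psmul fls_X (delta a1 a2 c u) \<in> lat v w"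
    and nlog: "\<exists>u \<in> lat v w. delta a1 a2 c u \<notin> lat v w"
  shows "\<exists>u \<in> lat v w. lat u (psmul fls_X (delta a1 a2 c u)) = lat v w"
proof -
  let ?L = "lat v w" and ?d = "delta a1 a2 c" and ?D = "\<lambda>u. psmul fls_X (delta a1 a2 c u)"
  let ?det = "pdet v w"
  obtain A C where Dv: "reg A" "reg C" "?D v = psmul A v + psmul C w"
    using stab[OF lat_gens(1)] by (rule latE)
  obtain B E where Dw: "reg B" "reg E" "?D w = psmul B v + psmul E w"
    using stab[OF lat_gens(2)] by (rule latE)
  have detv: "pdet v (?D v) = C * ?det" and detw: "pdet w (?D w) = (- B) * ?det"
    using pdet_swap[of w v] by (simp_all only: Dv Dw pdet_add pdet_simps mult_zero_right) simp_all
  have trace: "fls_nth A 0 + fls_nth E 0 = 0"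
  proof -
    define r where "r = theta ?det / ?det + fls_const (a1 + a2)"
    have "reg (theta ?det / ?det)"
    proof -
      have "ordge (fls_subdegree ?det + - fls_subdegree ?det) (theta ?det * inverse ?det)"
        by (intro ordge_mult ordge_theta) (auto simp: ordge_iff)
      moreover have "cvg (theta ?det / ?det)" using cvg by auto
      ultimately show ?thesis by (simp add: reg_iff_ordge field_class.field_divide_inverse)
    qed
    hence r: "reg r" by (auto simp: r_def)
    have "fls_X * r * ?det = fls_X * (theta ?det + fls_const (a1 + a2) * ?det)"
      using nz by (simp add: r_def field_simps)
    also have "\<dots> = pdet (?D v) w + pdet v (?D w)"
      unfolding theta_pdet[of v w a1 a2 c] by (simp add: distrib_left)
    also have "\<dots> = (A + E) * ?det"
      by (simp only: Dv Dw pdet_add pdet_simps) (simp add: algebra_simps)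
    finally have "A + E = fls_X * r" using nz by simp
    hence "fls_nth (A + E) 0 = 0" using reg_nth0_mult[of fls_X r] r by simp
    thus ?thesis by simp
  qed
  have det: "fls_nth A 0 * fls_nth E 0 = fls_nth B 0 * fls_nth C 0"
  proof (rule ccontr)
    assume neq: "\<not> ?thesis"
    define d where "d = A * E - B * C"
    have d: "reg d" "d \<noteq> 0" "reg (1 / d)"
    proof -
      show "reg d" unfolding d_def using Dv Dw by auto
      have "fls_nth d 0 \<noteq> 0" using neq Dv Dw by (simp add: d_def reg_nth0_mult)
      thus "d \<noteq> 0" "reg (1 / d)" using reg_inverse \<open>reg d\<close> by auto
    qed
    define S where "S = {?D x + psmul fls_X y | x y. x \<in> ?L \<and> y \<in> ?L}"
    have S_add: "u + u' \<in> S" if S: "u \<in> S" "u' \<in> S" for u u'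
    proof -
      obtain x y x' y' where "x \<in> ?L" "y \<in> ?L" "x' \<in> ?L" "y' \<in> ?L"
        "u = ?D x + psmul fls_X y" "u' = ?D x' + psmul fls_X y'"
        using S unfolding S_def by blast
      moreover from this have "u + u' = ?D (x + x') + psmul fls_X (y + y')"
        by (simp add: delta_add psmul_add)
      ultimately show ?thesis unfolding S_def using lat_add by blast
    qed
    have S_smul: "psmul p (?D x) \<in> S" if "x \<in> ?L" "reg p" for p x
    proof -
      \<comment> \<open>The operator is not linear over the series, but the defect
        \<open>theta p\<close> carries a factor \<open>fls_X\<close> and is absorbed by
        \<open>zL\<close>.\<close>
      have "psmul p (?D x) = ?D (psmul p x) + psmul fls_X (psmul (- theta p) x)"
        by (simp add: delta_psmul psmul_add prod_eq_iff algebra_simps)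
      moreover have "psmul p x \<in> ?L" "psmul (- theta p) x \<in> ?L"
        by (intro lat_psmul that reg_minus reg_theta)+
      ultimately show ?thesis unfolding S_def by blast
    qed
    \<comment> \<open>The coefficients are the adjugate of the matrix of \<open>?D\<close>; dividing
      by the unit \<open>d\<close> recovers \<open>v\<close> and \<open>w\<close> from their
      images.\<close>
    have "psmul d v = psmul E (?D v) + psmul (- C) (?D w)"
         "psmul d w = psmul (- B) (?D v) + psmul A (?D w)"
      unfolding Dv(3) Dw(3) by (simp_all add: d_def prod_eq_iff algebra_simps)
    hence "psmul (1 / d) (psmul d v) = psmul (1 / d * E) (?D v) + psmul (1 / d * - C) (?D w)"
          "psmul (1 / d) (psmul d w) = psmul (1 / d * - B) (?D v) + psmul (1 / d * A) (?D w)"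
      by (simp_all only: psmul_add psmul_psmul mult.assoc)
    hence vw: "v = psmul (1 / d * E) (?D v) + psmul (1 / d * - C) (?D w)"
          "w = psmul (1 / d * - B) (?D v) + psmul (1 / d * A) (?D w)"
      using d(2) by simp_all
    have "u \<in> S" if uL: "u \<in> ?L" for u
    proof -
      obtain p q where pq: "reg p" "reg q" "u = psmul p v + psmul q w" using uL by (rule latE)
      have "u = psmul (p * (1 / d * E)) (?D v) + psmul (p * (1 / d * - C)) (?D w)
              + (psmul (q * (1 / d * - B)) (?D v) + psmul (q * (1 / d * A)) (?D w))"
        using arg_cong[OF vw(1), of "psmul p"] arg_cong[OF vw(2), of "psmul q"] pq(3)
        by (simp only: psmul_add psmul_psmul mult.assoc)
      also have "\<dots> \<in> S"
        using pq d Dv Dw by (intro S_add S_smul lat_gens reg_mult reg_minus)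
      finally show ?thesis .
    qed
    thus False
      using X_delta_not_surj[OF nz cvg c stab] unfolding S_def by blast
  qed
  show ?thesis
  \<comment> \<open>By \<open>detv\<close> and \<open>detw\<close>, \<open>C\<close> and
    \<open>- B\<close> are the transition determinants of \<open>v, ?D v\<close> and
    \<open>w, ?D w\<close>; a nonzero value at 0 makes the respective pair a basis.\<close>
  proof (cases "fls_nth C 0 = 0")
    case False
    have "lat v (?D v) = ?L"
      by (rule lat_eqI[OF lat_gens(1) stab[OF lat_gens(1)] nz detv Dv(2) False])
    thus ?thesis using lat_gens(1) by blast
  next
    case C0: True
    show ?thesis
    proof (cases "fls_nth B 0 = 0")
      case False
      hence "fls_nth (- B) 0 \<noteq> 0" by simp
      hence "lat w (?D w) = ?L"
        using lat_eqI[OF lat_gens(2) stab[OF lat_gens(2)] nz detw] Dw(1) by blast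
      thus ?thesis using lat_gens(2) by blast
    next
      case True
      \<comment> \<open>At 0, \<open>A\<close> and \<open>E\<close> have sum 0 and, as
        \<open>B\<close> and \<open>C\<close> vanish there, product 0. So the whole reduced matrix
        is 0, and cancelling \<open>fls_X\<close> shows stability under \<open>\<delta>\<close>,
        contrary to \<open>nlog\<close>.\<close>
      hence z: "fls_nth A 0 = 0" "fls_nth E 0 = 0" using C0 det trace by auto
      have *: "?d x \<in> ?L"
        if h: "?D x = psmul p v + psmul q w" "reg p" "reg q" "fls_nth p 0 = 0" "fls_nth q 0 = 0" for x p q
      proof -
        obtain p' where p': "reg p'" "p = fls_X * p'" using h(2,4) by (rule reg_X_factor)
        obtain q' where q': "reg q'" "q = fls_X * q'" using h(3,5) by (rule reg_X_factor)
        have "?D x = psmul fls_X (psmul p' v + psmul q' w)"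
          unfolding h(1) p' q' by (simp add: psmul_add)
        hence "?d x = psmul p' v + psmul q' w" by (simp add: psmul_cancel)
        thus ?thesis using p'(1) q'(1) by (intro latI)
      qed
      have dv: "?d v \<in> ?L" "?d w \<in> ?L"
        using *[OF Dv(3,1,2) z(1) C0] *[OF Dw(3,1,2) True z(2)] .
      have "?d u \<in> ?L" if uL: "u \<in> ?L" for u
      proof -
        obtain p q where pq: "reg p" "reg q" "u = psmul p v + psmul q w" using uL by (rule latE)
        show ?thesis unfolding pq(3) delta_add delta_psmul
          using pq(1,2) dv by (intro lat_add lat_psmul lat_gens) auto
      qed
      thus ?thesis using nlog by blast
    qed
  qed
qed

text \<open>Modulo \<open>fls_X\<close> a pair \<open>(p, q)\<close> with \<open>p\<close> a unit is
  proportional to \<open>(1, t)\<close>, where \<open>t\<close> is the quotient of the values at 0.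
  Both vectors therefore lie in the right-hand lattice, and their transition determinant has the
  value \<open>p0 * (q0 * (a2 - a1) + c0 * p0)\<close> at 0, which \<open>nz\<close> keeps away from
  0.\<close>

lemma normal_lattice:
  assumes "reg p" "reg q" "fls_nth p 0 \<noteq> 0" "reg c"
    and nz: "fls_nth q 0 * (a2 - a1) + fls_nth c 0 * fls_nth p 0 \<noteq> 0"
  shows "lat (p, q) (psmul fls_X (delta a1 a2 c (p, q))) =
         lat (1, fls_const (fls_nth q 0 / fls_nth p 0)) (0, fls_X)"
proof -
  define t where "t = fls_const (fls_nth q 0 / fls_nth p 0)"
  define P Q where "P = theta p + fls_const a1 * p" and "Q = theta q + c * p + fls_const a2 * q"
  have PQ: "reg P" "reg Q" "reg t" using assms by (auto simp: P_def Q_def t_def)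
  have delta: "psmul fls_X (delta a1 a2 c (p, q)) = (fls_X * P, fls_X * Q)"
    by (simp add: delta_def P_def Q_def psmul_def)
  have "reg (q - p * t)" "fls_nth (q - p * t) 0 = 0"
    using assms PQ by (auto simp: reg_nth0_mult) (simp add: t_def)
  then obtain r where r: "reg r" "q - p * t = fls_X * r" by (rule reg_X_factor)
  hence "(p, q) \<in> lat (1, t) (0, fls_X)"
    using assms(1) r(1) by (intro latI[of p r]) (auto simp: psmul_def algebra_simps)
  moreover have "(fls_X * P, fls_X * Q) \<in> lat (1, t) (0, fls_X)"
    using PQ by (intro latI[of "fls_X * P" "Q - P * t"]) (auto simp: psmul_def algebra_simps)
  moreover have "pdet (1, t) (0, fls_X) \<noteq> 0" by (simp add: pdet_def)
  moreover have "pdet (p, q) (fls_X * P, fls_X * Q) = (p * Q - q * P) * pdet (1, t) (0, fls_X)"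
    by (simp add: pdet_def algebra_simps)
  moreover have "reg (p * Q - q * P)" using PQ assms by auto
  moreover have "fls_nth (p * Q - q * P) 0 \<noteq> 0"
  proof -
    have "fls_nth (p * Q - q * P) 0 =
        fls_nth p 0 * (fls_nth q 0 * (a2 - a1) + fls_nth c 0 * fls_nth p 0)"
      using assms(1,2,4) PQ by (simp add: reg_nth0_mult) (simp add: P_def Q_def reg_nth0_mult algebra_simps)
    thus ?thesis using assms(3) nz by simp
  qed
  ultimately show ?thesis unfolding delta t_def[symmetric] by (intro lat_eqI) auto
qed

section \<open>Sections, frames and elementary sections\<close>

definition cdet :: "complex ^ 2 \<Rightarrow> complex ^ 2 \<Rightarrow> complex" where
  "cdet x y = x $ 1 * y $ 2 - x $ 2 * y $ 1"

lemma cdet_mult: "cdet (A *v x) (A *v y) = det A * cdet x y"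
  by (simp add: cdet_def det_2 matrix_vector_mult_def sum_2 algebra_simps)

lemma cdet_add: "cdet (x + y) w = cdet x w + cdet y w" "cdet w (x + y) = cdet w x + cdet w y"
  and cdet_smul: "cdet (a *s x) w = a * cdet x w" "cdet w (a *s x) = a * cdet w x"
  and cdet_self: "cdet x x = 0"
  by (simp_all add: cdet_def algebra_simps)

lemma vec_cramer:
  assumes "cdet x y \<noteq> 0"
  shows "w = (cdet w y / cdet x y) *s x + (cdet x w / cdet x y) *s y"
proof -
  have "cdet x y * w $ 1 = cdet w y * x $ 1 + cdet x w * y $ 1"
       "cdet x y * w $ 2 = cdet w y * x $ 2 + cdet x w * y $ 2"
    by (simp_all add: cdet_def algebra_simps)
  hence "w $ 1 = (cdet w y * x $ 1 + cdet x w * y $ 1) / cdet x y"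
        "w $ 2 = (cdet w y * x $ 2 + cdet x w * y $ 2) / cdet x y"
    using assms by (simp_all add: nonzero_eq_divide_eq mult.commute)
  thus ?thesis by (simp add: vec_eq_iff forall_2 add_divide_distrib)
qed

lemma vec_cramer_unique:
  assumes "cdet x y \<noteq> 0" "w = a *s x + b *s y"
  shows "a = cdet w y / cdet x y" "b = cdet x w / cdet x y"
  using assms by (simp_all add: cdet_add cdet_smul cdet_self)

lemma vec_comb_eq_iff:
  assumes "cdet x y \<noteq> 0"
  shows "a *s x + b *s y = a' *s x + b' *s y \<longleftrightarrow> a = a' \<and> b = b'"
  using vec_cramer_unique[OF assms] by metis

lemma cdet_eq_0_imp:
  assumes "cdet x y = 0"
  obtains a b where "a \<noteq> 0 \<or> b \<noteq> 0" "a *s x + b *s y = 0"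
proof (cases "x = 0 \<and> y = 0")
  case True
  thus ?thesis using that[of 1 0] by simp
next
  case False
  then consider "x $ 1 \<noteq> 0 \<or> y $ 1 \<noteq> 0" | "x $ 2 \<noteq> 0 \<or> y $ 2 \<noteq> 0"
    by (auto simp: vec_eq_iff forall_2)
  thus ?thesis
  proof cases
    case 1
    thus ?thesis using that[of "y $ 1" "- x $ 1"] assms
      by (auto simp: vec_eq_iff forall_2 cdet_def algebra_simps)
  next
    case 2
    thus ?thesis using that[of "y $ 2" "- x $ 2"] assms
      by (auto simp: vec_eq_iff forall_2 cdet_def algebra_simps)
  qed
qed

section \<open>Holomorphic sections and the covariant derivative\<close>

lemma hs_mono: "\<sigma> \<in> hol_sections T U \<Longrightarrow> U' \<subseteq> U \<Longrightarrow> \<sigma> \<in> hol_sections T U'"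
  unfolding hol_sections_def by (fastforce elim: holomorphic_on_subset)

lemma hs_triv:
  assumes "\<sigma> \<in> hol_sections T U" "(V, g) \<in> trivs T"
  shows "(\<lambda>z. (g z *v \<sigma> z) $ i) holomorphic_on (U \<inter> V)"
  using assms unfolding hol_sections_def by blast

lemma hsI:
  assumes "\<And>V g i. (V, g) \<in> trivs T \<Longrightarrow> (\<lambda>z. (g z *v \<sigma> z) $ i) holomorphic_on (U \<inter> V)"
  shows "\<sigma> \<in> hol_sections T U"
  using assms unfolding hol_sections_def by blast

lemma hs_cong:
  assumes "\<sigma> \<in> hol_sections T U" "\<And>z. z \<in> U \<Longrightarrow> \<sigma> z = \<tau> z"
  shows "\<tau> \<in> hol_sections T U"
proof (rule hsI)
  fix V g i
  assume "(V, g) \<in> trivs T"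
  from hs_triv[OF assms(1) this, of i] show "(\<lambda>z. (g z *v \<tau> z) $ i) holomorphic_on (U \<inter> V)"
    by (rule holomorphic_transform) (use assms in auto)
qed

lemma hs_comb:
  assumes "\<sigma> \<in> hol_sections T U" "\<tau> \<in> hol_sections T U" "f holomorphic_on U" "h holomorphic_on U"
  shows "(\<lambda>z. f z *s \<sigma> z + h z *s \<tau> z) \<in> hol_sections T U"
proof (rule hsI)
  fix V g i
  assume V: "(V, g) \<in> trivs T"
  have "(\<lambda>z. f z * (g z *v \<sigma> z) $ i + h z * (g z *v \<tau> z) $ i) holomorphic_on (U \<inter> V)"
    using assms(3,4) hs_triv[OF assms(1) V] hs_triv[OF assms(2) V]
    by (intro holomorphic_intros) (auto elim: holomorphic_on_subset)
  thus "(\<lambda>z. (g z *v (f z *s \<sigma> z + h z *s \<tau> z)) $ i) holomorphic_on (U \<inter> V)"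
    by (simp add: matrix_vector_right_distrib vector_scalar_commute)
qed

lemma hs_smul:
  assumes "\<sigma> \<in> hol_sections T U" "f holomorphic_on U"
  shows "(\<lambda>z. f z *s \<sigma> z) \<in> hol_sections T U"
  using hs_comb[OF assms(1,1,2) holomorphic_on_const[of 0]] by simp

lemma hs_local:
  assumes "holo_bundle T" "\<And>z. z \<in> U \<Longrightarrow> \<exists>N. open N \<and> z \<in> N \<and> \<sigma> \<in> hol_sections T N"
  shows "\<sigma> \<in> hol_sections T U"
proof (rule hsI)
  fix V g i
  assume V: "(V, g) \<in> trivs T"
  hence "open V" using assms(1) unfolding holo_bundle_def by blast
  show "(\<lambda>z. (g z *v \<sigma> z) $ i) holomorphic_on (U \<inter> V)"
    unfolding holomorphic_on_def
  proof
    fix z assume z: "z \<in> U \<inter> V"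
    then obtain N where N: "open N" "z \<in> N" "\<sigma> \<in> hol_sections T N" using assms(2) by blast
    have "(\<lambda>z. (g z *v \<sigma> z) $ i) field_differentiable (at z)"
      using hs_triv[OF N(3) V, of i] z N \<open>open V\<close>
      by (meson IntD2 IntI holomorphic_on_imp_differentiable_at open_Int)
    thus "(\<lambda>z. (g z *v \<sigma> z) $ i) field_differentiable at z within U \<inter> V"
      by (rule field_differentiable_at_within)
  qed
qed

lemma triv_cover:
  assumes "holo_bundle T"
  obtains V g where "(V, g) \<in> trivs T" "open V" "z \<in> V" "\<And>w. w \<in> V \<Longrightarrow> invertible (g w)"
proof -
  have "z \<in> (\<Union>(V, g) \<in> trivs T. V)" using assms unfolding holo_bundle_def by blast
  then obtain V g where V: "(V, g) \<in> trivs T" "z \<in> V" by blast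
  show ?thesis
  proof (rule that[OF V(1) _ V(2)])
    show "open V" "\<And>w. w \<in> V \<Longrightarrow> invertible (g w)"
      using assms V(1) unfolding holo_bundle_def by blast+
  qed
qed

lemma holo_cover:
  assumes "holo_bundle T" "open U"
    and "\<And>V g. (V, g) \<in> trivs T \<Longrightarrow> f holomorphic_on (U \<inter> V)"
  shows "f holomorphic_on U"
  unfolding holomorphic_on_open[OF assms(2)]
proof
  fix z assume z: "z \<in> U"
  obtain V g where V: "(V, g) \<in> trivs T" "open V" "z \<in> V"
    by (rule triv_cover[OF assms(1), of z])
  show "\<exists>f'. (f has_field_derivative f') (at z)"
    using assms(3)[OF V(1)] z V(3) holomorphic_on_open[OF open_Int[OF assms(2) V(2)]] by blast
qed

lemma det_triv:
  assumes "holo_bundle T" "(V, g) \<in> trivs T" "z \<in> V"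
  shows "det (g z) \<noteq> 0"
proof -
  have "invertible (g z)" using assms unfolding holo_bundle_def by blast
  thus ?thesis by (simp add: invertible_det_nz)
qed

text \<open>Sections are holomorphic only after a trivialisation \<open>g\<close> is applied. In a
  quotient of two determinants the factor \<open>det (g z)\<close> cancels, so the coordinates are
  honest holomorphic functions.\<close>

lemma hs_coords:
  assumes T: "holo_bundle T" and U: "open U"
    and s: "s1 \<in> hol_sections T U" "s2 \<in> hol_sections T U" "\<sigma> \<in> hol_sections T U"
    and nz: "\<And>z. z \<in> U \<Longrightarrow> cdet (s1 z) (s2 z) \<noteq> 0"
  shows "(\<lambda>z. cdet (\<sigma> z) (s2 z) / cdet (s1 z) (s2 z)) holomorphic_on U"
    and "(\<lambda>z. cdet (s1 z) (\<sigma> z) / cdet (s1 z) (s2 z)) holomorphic_on U"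
proof -
  have *: "(\<lambda>z. cdet (\<sigma>1 z) (\<sigma>2 z) / cdet (s1 z) (s2 z)) holomorphic_on U"
    if \<sigma>: "\<sigma>1 \<in> hol_sections T U" "\<sigma>2 \<in> hol_sections T U" for \<sigma>1 \<sigma>2
  proof (rule holo_cover[OF T U])
    fix V g assume V: "(V, g) \<in> trivs T"
    have d: "det (g z) \<noteq> 0" if "z \<in> U \<inter> V" for z using det_triv[OF T V] that by blast
    have "(\<lambda>z. cdet (g z *v \<sigma>1 z) (g z *v \<sigma>2 z) / cdet (g z *v s1 z) (g z *v s2 z))
       holomorphic_on U \<inter> V"
      unfolding cdet_def
      using s(1,2) \<sigma> V nz d by (intro holomorphic_intros hs_triv)
        (auto simp flip: cdet_def simp: cdet_mult)
    thus "(\<lambda>z. cdet (\<sigma>1 z) (\<sigma>2 z) / cdet (s1 z) (s2 z)) holomorphic_on U \<inter> V"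
      by (rule holomorphic_transform) (use d in \<open>simp add: cdet_mult\<close>)
  qed
  show "(\<lambda>z. cdet (\<sigma> z) (s2 z) / cdet (s1 z) (s2 z)) holomorphic_on U"
       "(\<lambda>z. cdet (s1 z) (\<sigma> z) / cdet (s1 z) (s2 z)) holomorphic_on U"
    by (intro * s)+
qed

lemmas holo_connectionD = mp[OF spec[OF iffD1[OF holo_connection_def]] conjI]

lemma nabla_hs:
  "holo_connection T \<Longrightarrow> open U \<Longrightarrow> 0 \<notin> U \<Longrightarrow> \<sigma> \<in> hol_sections T U \<Longrightarrow> nabla T \<sigma> \<in> hol_sections T U"
  by (drule (2) holo_connectionD, drule conjunct1, erule (1) bspec)

lemma nabla_cong:
  assumes "holo_connection T" "open U" "0 \<notin> U" "\<sigma> \<in> hol_sections T U"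
    "\<And>z. z \<in> U \<Longrightarrow> \<sigma> z = \<tau> z" "z \<in> U"
  shows "nabla T \<sigma> z = nabla T \<tau> z"
proof -
  note c = holo_connectionD[OF assms(1-3), THEN conjunct2, THEN conjunct2, THEN conjunct2]
  show ?thesis
    using bspec[OF bspec[OF c assms(4)] hs_cong[OF assms(4,5)]] assms(5,6) by simp
qed

lemma nabla_comb:
  assumes T: "holo_connection T" "open U" "0 \<notin> U"
    and s: "\<sigma> \<in> hol_sections T U" "\<tau> \<in> hol_sections T U" "f holomorphic_on U" "h holomorphic_on U"
    and z: "z \<in> U"
  shows "nabla T (\<lambda>w. f w *s \<sigma> w + h w *s \<tau> w) z =
           deriv f z *s \<sigma> z + f z *s nabla T \<sigma> z + (deriv h z *s \<tau> z + h z *s nabla T \<tau> z)"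
proof -
  note c = holo_connectionD[OF T, THEN conjunct2]
  have leib: "nabla T (\<lambda>w. f w *s \<sigma> w) z = deriv f z *s \<sigma> z + f z *s nabla T \<sigma> z"
    if "\<sigma> \<in> hol_sections T U" "f holomorphic_on U" for f \<sigma>
    using bspec[OF c[THEN conjunct2, THEN conjunct1] that(1)] that(2) z by simp
  have "nabla T ((\<lambda>w. f w *s \<sigma> w) + (\<lambda>w. h w *s \<tau> w)) z =
        nabla T (\<lambda>w. f w *s \<sigma> w) z + nabla T (\<lambda>w. h w *s \<tau> w) z"
    using bspec[OF bspec[OF bspec[OF c[THEN conjunct1] hs_smul[OF s(1,3)]] hs_smul[OF s(2,4)]] z] .
  thus ?thesis by (simp add: leib s plus_fun_def)
qed

text \<open>The value is \<open>z\<^sup>c\<close> for integers \<open>c\<close> and 0 otherwise, so that nonintegral exponents drop out of formulas.\<close>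

definition zp :: "complex \<Rightarrow> complex \<Rightarrow> complex" where
  "zp c z = (if c \<in> \<int> then z powi \<lfloor>Re c\<rfloor> else 0)"

lemma zp_of_int [simp]: "zp (of_int n) z = z powi n"
  by (simp add: zp_def)

lemma zp_0 [simp]: "zp 0 z = 1"
  by (simp add: zp_def)

lemma zp_nonzero: "c \<in> \<int> \<Longrightarrow> z \<noteq> 0 \<Longrightarrow> zp c z \<noteq> 0"
  and zp_not_int: "c \<notin> \<int> \<Longrightarrow> zp c z = 0"
  by (auto simp: zp_def)

lemma zp_add_nat:
  assumes "z \<noteq> 0"
  shows "zp (c + of_nat n) z = z ^ n * zp c z"
proof (cases "c \<in> \<int>")
  case True
  then obtain m where "c = of_int m" by (elim Ints_cases)
  moreover have "of_int m + of_nat n = (of_int (m + int n) :: complex)" by simp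
  ultimately show ?thesis using assms
    by (metis (no_types, lifting) zp_of_int power_int_add power_int_of_nat mult.commute)
next
  case False
  hence "c + of_nat n \<notin> \<int>" by (metis Ints_diff Ints_of_nat add_diff_cancel_right')
  thus ?thesis using False by (simp add: zp_not_int)
qed

lemma zp_deriv: "z \<noteq> 0 \<Longrightarrow> (zp c has_field_derivative c * zp c z / z) (at z)"
proof (cases "c \<in> \<int>")
  case True
  assume z: "z \<noteq> 0"
  obtain n where c: "c = of_int n" using True by (elim Ints_cases)
  have eq: "zp c = (\<lambda>z. z powi n)" by (simp add: c fun_eq_iff)
  have "((\<lambda>z. z powi n) has_field_derivative of_int n * z powi (n - 1)) (at z)"
    using z by (auto intro!: derivative_eq_intros)
  moreover have "z powi (n - 1) = z powi n / z" using z by (simp add: power_int_diff)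
  ultimately show ?thesis unfolding eq by (simp add: c)
next
  case False
  hence "zp c = (\<lambda>_. 0)" by (simp add: fun_eq_iff zp_not_int)
  thus ?thesis by simp
qed

lemma zp_holo [holomorphic_intros]: "0 \<notin> U \<Longrightarrow> zp c holomorphic_on U"
  unfolding holomorphic_on_def field_differentiable_def
  using zp_deriv has_field_derivative_at_within by metis

lemma zp_exp: "c \<in> \<int> \<Longrightarrow> zp c (exp \<zeta>) = exp (c * \<zeta>)"
  by (elim Ints_cases) (simp add: exp_power_int)

lemma exp_2pi_eq_1_iff: "exp (2 * of_real pi * \<i> * c) = 1 \<longleftrightarrow> c \<in> \<int>"
proof
  assume "exp (2 * of_real pi * \<i> * c) = 1"
  then obtain n :: int where "Im c = 0" "Re c = of_int n"
    by (auto simp: exp_eq_1)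
  hence "c = of_int n" by (simp add: complex_eq_iff)
  thus "c \<in> \<int>" by simp
qed (auto elim!: Ints_cases simp: exp_eq_1)

text \<open>Pulled back along \<open>exp\<close> and divided by \<open>z\<^sup>c\<close>, a solution is affine in \<open>\<zeta>\<close>; being single-valued, it is constant.\<close>

lemma zp_ode:
  assumes hol: "f holomorphic_on (- {0})"
    and ode: "\<And>z. z \<noteq> 0 \<Longrightarrow> z * deriv f z - c * f z = C * zp c z"
  shows "(\<forall>z. C * zp c z = 0) \<and> (\<exists>D. \<forall>z. z \<noteq> 0 \<longrightarrow> f z = D * zp c z)"
proof -
  define F where "F \<zeta> = f (exp \<zeta>) * exp (- c * \<zeta>)" for \<zeta>
  \<comment> \<open>For nonintegral \<open>c\<close> the function \<open>zp c\<close> is 0, so the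
    equation contributes no slope.\<close>
  define K where "K = (if c \<in> \<int> then C else 0)"
  have F': "(F has_field_derivative K) (at \<zeta>)" for \<zeta>
  proof -
    have "(f has_field_derivative deriv f (exp \<zeta>)) (at (exp \<zeta>))"
      using hol by (intro holomorphic_derivI[of _ "- {0}"]) auto
    hence "(F has_field_derivative deriv f (exp \<zeta>) * exp \<zeta> * exp (- c * \<zeta>)
             + f (exp \<zeta>) * (exp (- c * \<zeta>) * (- c))) (at \<zeta>)"
      unfolding F_def by (auto intro!: derivative_eq_intros DERIV_chain2[of f])
    also have "deriv f (exp \<zeta>) * exp \<zeta> * exp (- c * \<zeta>) + f (exp \<zeta>) * (exp (- c * \<zeta>) * (- c))
         = (exp \<zeta> * deriv f (exp \<zeta>) - c * f (exp \<zeta>)) * exp (- c * \<zeta>)"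
      by (simp add: algebra_simps)
    also have "\<dots> = K"
      unfolding ode[OF exp_not_eq_zero]
      by (auto simp: K_def zp_exp zp_not_int simp flip: exp_add)
    finally show ?thesis .
  qed
  have "((\<lambda>\<zeta>. F \<zeta> - K * \<zeta>) has_field_derivative 0) (at \<zeta>)" for \<zeta>
    using F' by (auto intro!: derivative_eq_intros)
  then obtain D where D: "\<And>\<zeta>. F \<zeta> - K * \<zeta> = D"
    using has_field_derivative_zero_constant[of UNIV "\<lambda>\<zeta>. F \<zeta> - K * \<zeta>"]
    by auto
  hence F: "F \<zeta> = K * \<zeta> + D" for \<zeta> by (metis diff_add_cancel add.commute)
  have per: "F (2 * of_real pi * \<i>) = F 0 * exp (2 * of_real pi * \<i> * (- c))"
    by (simp add: F_def mult_ac)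
  have f: "f z = F (Ln z) * exp (c * Ln z)" if "z \<noteq> 0" for z
    using that by (simp add: F_def mult.assoc flip: exp_add)
  show ?thesis
  proof (cases "c \<in> \<int>")
    case True
    hence "exp (2 * of_real pi * \<i> * (- c)) = 1" unfolding exp_2pi_eq_1_iff by simp
    \<comment> \<open>A nonzero slope would be a logarithm, which is not single-valued.\<close>
    with per have "K = 0" by (simp add: F)
    hence "C = 0" using True by (simp add: K_def)
    moreover have "f z = D * zp c z" if "z \<noteq> 0" for z
      using f[OF that] zp_exp[OF True, of "Ln z"] that by (simp add: F \<open>K = 0\<close>)
    ultimately show ?thesis by auto
  next
    case False
    hence "exp (2 * of_real pi * \<i> * (- c)) \<noteq> 1" unfolding exp_2pi_eq_1_iff by simp
    moreover have "K = 0" using False by (simp add: K_def)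
    ultimately have "D = 0" using per by (simp add: F)
    thus ?thesis using False f by (simp add: F \<open>K = 0\<close> zp_not_int)
  qed
qed

text \<open>The monodromy is semisimple if \<open>\<kappa> = 0\<close>; otherwise \<open>\<kappa>\<close> is normalised to 1 below.\<close>

locale te_frame =
  fixes T :: te and s1 s2 :: "complex \<Rightarrow> complex ^ 2" and \<alpha>1 \<alpha>2 \<kappa> :: complex and k :: nat
  assumes te: "te_structure T"
    and s1: "s1 \<in> hol_sections T (- {0})" "s1 0 = 0"
    and s2: "s2 \<in> hol_sections T (- {0})" "s2 0 = 0"
    and indep: "z \<noteq> 0 \<Longrightarrow> cdet (s1 z) (s2 z) \<noteq> 0"
    and nab1: "z \<noteq> 0 \<Longrightarrow> z *s nabla T s1 z = \<alpha>1 *s s1 z + (\<kappa> * z ^ k) *s s2 z"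
    and nab2: "z \<noteq> 0 \<Longrightarrow> z *s nabla T s2 z = \<alpha>2 *s s2 z"
    and deg: "\<kappa> \<noteq> 0 \<Longrightarrow> \<alpha>1 = \<alpha>2 + of_nat k"
begin

lemma holo_bundle: "holo_bundle T" and holo_connection: "holo_connection T"
  using te by (auto simp: te_structure_def)

lemma coords:
  assumes "open U" "0 \<notin> U" "\<sigma> \<in> hol_sections T U"
  obtains f g where "f holomorphic_on U" "g holomorphic_on U"
    "\<And>z. z \<in> U \<Longrightarrow> \<sigma> z = f z *s s1 z + g z *s s2 z"
proof
  have U: "U \<subseteq> - {0}" using assms(2) by auto
  have nz: "cdet (s1 z) (s2 z) \<noteq> 0" if "z \<in> U" for z
    using subsetD[OF U that] by (intro indep) simp
  show "(\<lambda>z. cdet (\<sigma> z) (s2 z) / cdet (s1 z) (s2 z)) holomorphic_on U"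
    by (rule hs_coords(1)[OF holo_bundle assms(1) hs_mono[OF s1(1) U] hs_mono[OF s2(1) U] assms(3)])
      (rule nz)
  show "(\<lambda>z. cdet (s1 z) (\<sigma> z) / cdet (s1 z) (s2 z)) holomorphic_on U"
    by (rule hs_coords(2)[OF holo_bundle assms(1) hs_mono[OF s1(1) U] hs_mono[OF s2(1) U] assms(3)])
      (rule nz)
  show "\<sigma> z = (cdet (\<sigma> z) (s2 z) / cdet (s1 z) (s2 z)) *s s1 z +
        (cdet (s1 z) (\<sigma> z) / cdet (s1 z) (s2 z)) *s s2 z" if "z \<in> U" for z
    by (rule vec_cramer[OF nz[OF that]])
qed

text \<open>The Leibniz rule turns \<open>nabla\<close> into an explicit operator on coordinates.
  That \<open>\<sigma>\<close> is a section is part of the conclusion, so the rule also applies to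
  functions given only by their coordinates.\<close>

lemma nabla_coords:
  assumes U: "open U" "0 \<notin> U" and fg: "f holomorphic_on U" "g holomorphic_on U"
    and eq: "\<And>z. z \<in> U \<Longrightarrow> \<sigma> z = f z *s s1 z + g z *s s2 z"
  shows "\<sigma> \<in> hol_sections T U"
    and "z \<in> U \<Longrightarrow> z *s nabla T \<sigma> z = (z * deriv f z + \<alpha>1 * f z) *s s1 z +
           (z * deriv g z + \<kappa> * z ^ k * f z + \<alpha>2 * g z) *s s2 z"
proof -
  have U0: "U \<subseteq> - {0}" using U by auto
  note s = hs_mono[OF s1(1) U0] hs_mono[OF s2(1) U0]
  show \<sigma>: "\<sigma> \<in> hol_sections T U"
    using hs_cong[OF hs_comb[OF s fg]] eq by simp
  assume z: "z \<in> U"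
  hence nz: "z \<noteq> 0" using U by auto
  have "nabla T \<sigma> z = nabla T (\<lambda>w. f w *s s1 w + g w *s s2 w) z"
    by (rule nabla_cong[OF holo_connection U \<sigma> eq z])
  also have "\<dots> = deriv f z *s s1 z + f z *s nabla T s1 z + (deriv g z *s s2 z + g z *s nabla T s2 z)"
    by (rule nabla_comb[OF holo_connection U s fg z])
  finally have "z *s nabla T \<sigma> z = (z * deriv f z) *s s1 z + f z *s (z *s nabla T s1 z)
      + ((z * deriv g z) *s s2 z + g z *s (z *s nabla T s2 z))"
    by (simp add: vec_eq_iff algebra_simps)
  thus "z *s nabla T \<sigma> z = (z * deriv f z + \<alpha>1 * f z) *s s1 z +
           (z * deriv g z + \<kappa> * z ^ k * f z + \<alpha>2 * g z) *s s2 z"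
    unfolding nab1[OF nz] nab2[OF nz] by (simp add: vec_eq_iff algebra_simps)
qed

text \<open>As \<open>s1\<close> and \<open>s2\<close> have exponents \<open>\<alpha>1\<close> and
  \<open>\<alpha>2\<close>, only \<open>z\<close> to the powers \<open>\<alpha> - \<alpha>1\<close>
  and \<open>\<alpha> - \<alpha>2\<close> can occur as coefficients in exponent
  \<open>\<alpha>\<close>. Since \<open>zp\<close> deletes nonintegral powers, one formula serves
  all \<open>\<alpha>\<close>, at the price that \<open>C\<close> and \<open>D\<close> are
  determined only where the power is integral.\<close>

definition el :: "complex \<Rightarrow> complex \<Rightarrow> complex \<Rightarrow> complex \<Rightarrow> complex ^ 2" where
  "el \<alpha> C D = (\<lambda>z. (C * zp (\<alpha> - \<alpha>1) z) *s s1 z + (D * zp (\<alpha> - \<alpha>2) z) *s s2 z)"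

lemma el_hs: "el \<alpha> C D \<in> hol_sections T (- {0})" "el \<alpha> C D 0 = 0"
  unfolding el_def by (intro hs_comb s1 s2 holomorphic_intros; simp) (simp add: s1 s2)

text \<open>By \<open>deg\<close>, the nilpotent entry takes the monomial allowed for
  \<open>s1\<close> to the one allowed for \<open>s2\<close>.\<close>

lemma zp_shift: "\<kappa> \<noteq> 0 \<Longrightarrow> z \<noteq> 0 \<Longrightarrow> z ^ k * zp (\<alpha> - \<alpha>1) z = zp (\<alpha> - \<alpha>2) z"
  using deg zp_add_nat[of z "\<alpha> - \<alpha>1" k] by simp

lemma zdz_el: "zdz_minus T \<alpha> (el \<alpha> C D) = el \<alpha> 0 (\<kappa> * C)"
proof
  fix z
  show "zdz_minus T \<alpha> (el \<alpha> C D) z = el \<alpha> 0 (\<kappa> * C) z"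
  proof (cases "z = 0")
    case False
    define f g where "f = (\<lambda>z. C * zp (\<alpha> - \<alpha>1) z)" and "g = (\<lambda>z. D * zp (\<alpha> - \<alpha>2) z)"
    have "f holomorphic_on - {0}" "g holomorphic_on - {0}"
      unfolding f_def g_def by (auto intro!: holomorphic_intros)
    hence *: "z *s nabla T (el \<alpha> C D) z = (z * deriv f z + \<alpha>1 * f z) *s s1 z +
           (z * deriv g z + \<kappa> * z ^ k * f z + \<alpha>2 * g z) *s s2 z"
      by (rule nabla_coords(2)[rotated 2]) (use False in \<open>auto simp: el_def f_def g_def\<close>)
    have "(f has_field_derivative C * ((\<alpha> - \<alpha>1) * zp (\<alpha> - \<alpha>1) z / z)) (at z)"
         "(g has_field_derivative D * ((\<alpha> - \<alpha>2) * zp (\<alpha> - \<alpha>2) z / z)) (at z)"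
      unfolding f_def g_def using zp_deriv[OF False] DERIV_cmult by blast+
    hence d: "z * deriv f z = (\<alpha> - \<alpha>1) * f z" "z * deriv g z = (\<alpha> - \<alpha>2) * g z"
      using False by (auto simp: DERIV_imp_deriv f_def g_def)
    have e: "\<kappa> * z ^ k * f z = \<kappa> * C * zp (\<alpha> - \<alpha>2) z"
      using zp_shift[of z \<alpha>] False by (cases "\<kappa> = 0") (auto simp: f_def)
    thus ?thesis using False
      unfolding zdz_minus_def * d e by (simp add: el_def f_def g_def vec_eq_iff algebra_simps)
  qed (simp add: zdz_minus_def el_hs)
qed

lemma el_eq_iff:
  "el \<alpha> C D = el \<alpha> C' D' \<longleftrightarrow> (C = C' \<or> \<alpha> - \<alpha>1 \<notin> \<int>) \<and> (D = D' \<or> \<alpha> - \<alpha>2 \<notin> \<int>)"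
proof
  assume "el \<alpha> C D = el \<alpha> C' D'"
  from fun_cong[OF this, of 1] show "(C = C' \<or> \<alpha> - \<alpha>1 \<notin> \<int>) \<and> (D = D' \<or> \<alpha> - \<alpha>2 \<notin> \<int>)"
    unfolding el_def vec_comb_eq_iff[OF indep[OF one_neq_zero]] using zp_nonzero[of _ 1] by auto
qed (auto simp: el_def fun_eq_iff zp_not_int)

lemma el_0: "el \<alpha> 0 0 = 0"
  by (simp add: el_def fun_eq_iff)

text \<open>In coordinates the second-order equation is a triangular system of equations of the type
  of \<open>zp_ode\<close>. They are solved from the outer operator inwards and from the first
  coordinate to the second; resonant right-hand sides would produce logarithms and are excluded
  because the coordinates are single-valued.\<close>

lemma elementary_eq: "elementary T \<alpha> = {el \<alpha> C D | C D. True}"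
proof (intro equalityI subsetI)
  fix \<sigma> assume "\<sigma> \<in> {el \<alpha> C D | C D. True}"
  thus "\<sigma> \<in> elementary T \<alpha>"
    by (auto simp: elementary_def el_hs zdz_el el_0)
next
  fix \<sigma> assume "\<sigma> \<in> elementary T \<alpha>"
  hence \<sigma>: "\<sigma> \<in> hol_sections T (- {0})" "\<sigma> 0 = 0" "zdz_minus T \<alpha> (zdz_minus T \<alpha> \<sigma>) = 0"
    by (auto simp: elementary_def)
  have o: "open (- {0 :: complex})" "0 \<notin> - {0 :: complex}" by auto
  obtain f g where fg: "f holomorphic_on - {0}" "g holomorphic_on - {0}"
    "\<And>z. z \<in> - {0} \<Longrightarrow> \<sigma> z = f z *s s1 z + g z *s s2 z"
    using coords[OF o \<sigma>(1)] that by blast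
  \<comment> \<open>These are the coordinates of
    \<open>zdz_minus T \<alpha> \<sigma>\<close>.\<close>
  define f' g' where "f' = (\<lambda>z. z * deriv f z - (\<alpha> - \<alpha>1) * f z)"
    and "g' = (\<lambda>z. z * deriv g z + \<kappa> * z ^ k * f z - (\<alpha> - \<alpha>2) * g z)"
  have fg': "f' holomorphic_on - {0}" "g' holomorphic_on - {0}"
    unfolding f'_def g'_def using fg(1,2)
    by (intro holomorphic_intros holomorphic_deriv; auto)+
  have z1: "zdz_minus T \<alpha> \<sigma> z = f' z *s s1 z + g' z *s s2 z" if "z \<in> - {0}" for z
    using that nabla_coords(2)[OF o fg that] fg(3)[OF that]
    by (simp add: zdz_minus_def f'_def g'_def vec_eq_iff algebra_simps)
  have z2: "z * deriv f' z - (\<alpha> - \<alpha>1) * f' z = 0 \<and>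
        z * deriv g' z + \<kappa> * z ^ k * f' z - (\<alpha> - \<alpha>2) * g' z = 0" if "z \<noteq> 0" for z
  proof -
    have zU: "z \<in> - {0}" using that by simp
    have n: "z *s nabla T (zdz_minus T \<alpha> \<sigma>) z = (z * deriv f' z + \<alpha>1 * f' z) *s s1 z +
           (z * deriv g' z + \<kappa> * z ^ k * f' z + \<alpha>2 * g' z) *s s2 z"
      by (rule nabla_coords(2)[OF o fg' _ zU]) (rule z1)
    have "0 = zdz_minus T \<alpha> (zdz_minus T \<alpha> \<sigma>) z" using \<sigma>(3) by simp
    also have "\<dots> = z *s nabla T (zdz_minus T \<alpha> \<sigma>) z - \<alpha> *s zdz_minus T \<alpha> \<sigma> z"
      using that unfolding zdz_minus_def[of T \<alpha> "zdz_minus T \<alpha> \<sigma>"] by simp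
    also have "\<dots> = (z * deriv f' z - (\<alpha> - \<alpha>1) * f' z) *s s1 z +
        (z * deriv g' z + \<kappa> * z ^ k * f' z - (\<alpha> - \<alpha>2) * g' z) *s s2 z"
      unfolding n z1[OF zU] by (simp add: vec_eq_iff algebra_simps)
    finally have "0 *s s1 z + 0 *s s2 z = \<dots>" by simp
    thus ?thesis unfolding vec_comb_eq_iff[OF indep[OF that]] by simp
  qed
  obtain C1 where C1: "\<And>z. z \<noteq> 0 \<Longrightarrow> f' z = C1 * zp (\<alpha> - \<alpha>1) z"
    using zp_ode[OF fg'(1), of "\<alpha> - \<alpha>1" 0] z2 by auto
  \<comment> \<open>The right-hand side for \<open>f\<close> is resonant, so it must vanish. Hence
    \<open>f'\<close> is 0 and the equation for \<open>g'\<close> decouples.\<close>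
  obtain C where C: "\<And>z. z \<noteq> 0 \<Longrightarrow> f z = C * zp (\<alpha> - \<alpha>1) z" "\<And>z. C1 * zp (\<alpha> - \<alpha>1) z = 0"
    using zp_ode[OF fg(1), of "\<alpha> - \<alpha>1" C1] C1 by (auto simp: f'_def)
  have f'0: "f' z = 0" if "z \<noteq> 0" for z using C1[OF that] C(2) by simp
  obtain D1 where D1: "\<And>z. z \<noteq> 0 \<Longrightarrow> g' z = D1 * zp (\<alpha> - \<alpha>2) z"
    using zp_ode[OF fg'(2), of "\<alpha> - \<alpha>2" 0] z2 f'0 by auto
  \<comment> \<open>By \<open>zp_shift\<close> the coupling term is a multiple of the same monomial
    and joins the right-hand side.\<close>
  have "z * deriv g z - (\<alpha> - \<alpha>2) * g z = (D1 - \<kappa> * C) * zp (\<alpha> - \<alpha>2) z" if "z \<noteq> 0" for z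
    using D1[OF that] C(1)[OF that] zp_shift[OF _ that, of \<alpha>]
    by (cases "\<kappa> = 0") (auto simp: g'_def algebra_simps)
  from zp_ode[OF fg(2) this] obtain D where "\<And>z. z \<noteq> 0 \<Longrightarrow> g z = D * zp (\<alpha> - \<alpha>2) z"
    by auto
  note D = this
  have "\<sigma> z = el \<alpha> C D z" for z
  proof (cases "z = 0")
    case True
    show ?thesis unfolding True \<sigma>(2) el_hs ..
  next
    case False
    show ?thesis
      using fg(3)[of z] False unfolding C(1)[OF False] D[OF False] el_def by simp
  qed
  hence "\<sigma> = el \<alpha> C D" by (rule ext)
  thus "\<sigma> \<in> {el \<alpha> C D | C D. True}" by blast
qed

text \<open>The second disjunct belongs to exponents for which \<open>s2\<close> has no admissible
  monomial: the image \<open>el \<alpha> 0 (\<kappa> * C)\<close> is then 0 for every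
  \<open>C\<close>.\<close>

lemma elementary_ker_eq:
  "elementary_ker T \<alpha> = {el \<alpha> C D | C D. \<kappa> * C = 0 \<or> \<alpha> - \<alpha>2 \<notin> \<int>}"
proof -
  have "zdz_minus T \<alpha> (el \<alpha> C D) = 0 \<longleftrightarrow> \<kappa> * C = 0 \<or> \<alpha> - \<alpha>2 \<notin> \<int>" for C D
    using el_eq_iff[of \<alpha> 0 "\<kappa> * C" 0 0] unfolding zdz_el el_0 by simp
  note * = this
  show ?thesis
  proof (intro set_eqI iffI)
    fix \<sigma> assume "\<sigma> \<in> elementary_ker T \<alpha>"
    then obtain C D where "\<sigma> = el \<alpha> C D" "zdz_minus T \<alpha> \<sigma> = 0"
      unfolding elementary_ker_def elementary_eq by auto
    thus "\<sigma> \<in> {el \<alpha> C D | C D. \<kappa> * C = 0 \<or> \<alpha> - \<alpha>2 \<notin> \<int>}" using * by auto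
  next
    fix \<sigma> assume "\<sigma> \<in> {el \<alpha> C D | C D. \<kappa> * C = 0 \<or> \<alpha> - \<alpha>2 \<notin> \<int>}"
    then obtain C D where "\<sigma> = el \<alpha> C D" "\<kappa> * C = 0 \<or> \<alpha> - \<alpha>2 \<notin> \<int>" by auto
    thus "\<sigma> \<in> elementary_ker T \<alpha>"
      unfolding elementary_ker_def elementary_eq using * by auto
  qed
qed

end

section \<open>The stalk at 0 in Laurent coordinates\<close>

lemma analytic_imp_reg:
  assumes "f analytic_on {0}"
  obtains P where "reg P" "f has_laurent_expansion P"
proof
  have "f has_fps_expansion fps_expansion f 0"
    by (rule analytic_at_imp_has_fps_expansion_0[OF assms])
  thus e: "f has_laurent_expansion fps_to_fls (fps_expansion f 0)" by (rule has_laurent_expansion_fps)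
  show "reg (fps_to_fls (fps_expansion f 0))"
    unfolding reg_def cvg_def using e fls_subdegree_fls_to_fps_gt0 by blast
qed

lemma reg_imp_analytic:
  assumes "reg P"
  obtains p where "p analytic_on {0}" "p has_laurent_expansion P"
proof -
  obtain f where "f has_laurent_expansion P" using assms unfolding reg_def cvg_def by blast
  hence "f has_laurent_expansion fps_to_fls (fls_regpart P)" using assms by (simp add: reg_def)
  from has_fps_expansion_fps_to_fls[OF this]
  obtain h where h: "h has_fps_expansion fls_regpart P" by blast
  show ?thesis
  proof
    show "h analytic_on {0}" using h by (rule has_fps_expansion_imp_analytic_0)
    show "h has_laurent_expansion P"
      using has_laurent_expansion_fps[OF h] assms by (simp add: reg_def)
  qed
qed

lemma analytic_expansion_0:
  assumes "f analytic_on {0}" "f has_laurent_expansion 0"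
  shows "eventually (\<lambda>z. f z = 0) (nhds 0)"
proof -
  have f: "f has_fps_expansion fps_expansion f 0"
    by (rule analytic_at_imp_has_fps_expansion_0[OF assms(1)])
  have "fps_to_fls (fps_expansion f 0) = 0"
    using has_laurent_expansion_unique[OF has_laurent_expansion_fps[OF f] assms(2)] .
  hence "fps_expansion f 0 = 0" by simp
  with f have "f has_fps_expansion 0" by (simp only:)
  thus ?thesis by (rule iffD1[OF has_fps_expansion_0_iff])
qed

lemma expansion_eventually_eq:
  assumes "f has_laurent_expansion F" "g has_laurent_expansion F"
  shows "eventually (\<lambda>z. f z = g z) (at 0)"
proof -
  have "eventually (\<lambda>z. eval_fls F z = f z) (at 0)" "eventually (\<lambda>z. eval_fls F z = g z) (at 0)"
    using assms by (simp_all add: has_laurent_expansion_def)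
  thus ?thesis by eventually_elim simp
qed

lemma expansion_cong:
  assumes "eventually (\<lambda>z. f z = g z) (at 0)" "f has_laurent_expansion F"
  shows "g has_laurent_expansion F"
  using has_laurent_expansion_cong[OF assms(1) refl] assms(2) by simp

lemma expansion_punctured_holo:
  assumes "f has_laurent_expansion F"
  shows "eventually (\<lambda>r. f holomorphic_on ball 0 r - {0}) (at_right 0)"
proof -
  obtain r where r: "r > 0" "f analytic_on ball 0 r - {0}"
    using has_laurent_expansion_isolated_0[OF assms] unfolding isolated_singularity_at_def by blast
  have "f holomorphic_on ball 0 r - {0}" using r(2) by (rule analytic_imp_holomorphic)
  hence "f holomorphic_on ball 0 r' - {0}" if "r' \<in> {0<..<r}" for r'
    by (rule holomorphic_on_subset) (use that in auto)
  thus ?thesis using eventually_at_right_real[OF r(1)] by (rule eventually_mono[rotated])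
qed

text \<open>The operator \<open>nabla\<close> compares sections on open sets, so an identity near 0
  must be available on a whole punctured ball before it can be differentiated.\<close>

lemma eventually_at0_ball:
  "eventually P (at (0 :: complex)) \<longleftrightarrow> eventually (\<lambda>r. \<forall>z \<in> ball 0 r - {0}. P z) (at_right (0 :: real))"
proof
  assume "eventually P (at 0)"
  then obtain d where d: "d > 0" "\<And>z. z \<noteq> 0 \<Longrightarrow> dist z 0 < d \<Longrightarrow> P z"
    unfolding eventually_at by auto
  have "\<forall>z \<in> ball 0 r - {0}. P z" if "r \<in> {0<..<d}" for r
    using d(2) that by (auto simp: dist_commute)
  thus "eventually (\<lambda>r. \<forall>z \<in> ball 0 r - {0}. P z) (at_right 0)"
    using eventually_at_right_real[OF d(1)] by (rule eventually_mono[rotated])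
next
  assume "eventually (\<lambda>r. \<forall>z \<in> ball 0 r - {0}. P z) (at_right (0 :: real))"
  then obtain b where b: "b > 0" "\<And>r. r > 0 \<Longrightarrow> r < b \<Longrightarrow> \<forall>z \<in> ball 0 r - {0}. P z"
    unfolding eventually_at_right_field by auto
  have "\<forall>z \<in> ball 0 (b / 2) - {0}. P z" by (rule b(2)) (use b(1) in auto)
  thus "eventually P (at 0)" unfolding eventually_at
    by (intro exI[of _ "b / 2"]) (use b(1) in \<open>auto simp: dist_commute\<close>)
qed

section \<open>Germs of sections at 0\<close>

lemma germs0I:
  assumes "open U" "0 \<in> U" "\<tau> \<in> hol_sections T U" "eventually (\<lambda>z. \<sigma> z = \<tau> z) (at 0)"
  shows "\<sigma> \<in> germs0 T"
  using assms unfolding germs0_def by blast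

lemma germs0E:
  assumes "\<sigma> \<in> germs0 T"
  obtains U \<tau> where "open U" "0 \<in> U" "\<tau> \<in> hol_sections T U" "eventually (\<lambda>z. \<sigma> z = \<tau> z) (at 0)"
  using assms unfolding germs0_def by blast

lemma germs0_cong:
  assumes \<sigma>: "\<sigma> \<in> germs0 T" and eq: "eventually (\<lambda>z. \<sigma> z = \<tau> z) (at 0)"
  shows "\<tau> \<in> germs0 T"
proof -
  obtain U \<rho> where U: "open U" "0 \<in> U" "\<rho> \<in> hol_sections T U" "eventually (\<lambda>z. \<sigma> z = \<rho> z) (at 0)"
    using \<sigma> by (rule germs0E)
  have "eventually (\<lambda>z. \<tau> z = \<rho> z) (at 0)" using U(4) eq by eventually_elim simp
  thus ?thesis by (rule germs0I[OF U(1-3)])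
qed

lemma germs0_comb:
  assumes "\<sigma> \<in> germs0 T" "\<tau> \<in> germs0 T" "f analytic_on {0}" "g analytic_on {0}"
  shows "(\<lambda>z. f z *s \<sigma> z + g z *s \<tau> z) \<in> germs0 T"
proof -
  obtain U \<rho> where U: "open U" "0 \<in> U" "\<rho> \<in> hol_sections T U" "eventually (\<lambda>z. \<sigma> z = \<rho> z) (at 0)"
    using assms(1) by (rule germs0E)
  obtain U' \<rho>' where U': "open U'" "0 \<in> U'" "\<rho>' \<in> hol_sections T U'"
    "eventually (\<lambda>z. \<tau> z = \<rho>' z) (at 0)"
    using assms(2) by (rule germs0E)
  obtain S where S: "open S" "0 \<in> S" "f holomorphic_on S" "g holomorphic_on S"
    using assms(3,4) analytic_at_two by blast
  let ?W = "U \<inter> U' \<inter> S"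
  have "eventually (\<lambda>z. f z *s \<sigma> z + g z *s \<tau> z = f z *s \<rho> z + g z *s \<rho>' z) (at 0)"
    using U(4) U'(4) by eventually_elim simp
  moreover have "(\<lambda>z. f z *s \<rho> z + g z *s \<rho>' z) \<in> hol_sections T ?W"
    by (intro hs_comb hs_mono[OF U(3)] hs_mono[OF U'(3)] holomorphic_on_subset[OF S(3)]
          holomorphic_on_subset[OF S(4)]) auto
  moreover have "open ?W" "0 \<in> ?W" using U U' S by auto
  ultimately show ?thesis by (intro germs0I[of ?W])
qed

lemma matrix_vector_mult_axis:
  fixes A :: "complex ^ 2 ^ 2"
  shows "(A *v axis j 1) $ i = A $ i $ j"
  by (simp add: matrix_vector_mult_def axis_def if_distrib[of "\<lambda>x. _ * x"] cong: if_cong)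

text \<open>The inverse of a trivialisation carries the standard basis to a local frame; its
  holomorphy in another trivialisation is that of the transition matrix.\<close>

lemma triv_frame:
  assumes T: "holo_bundle T" and V: "(V, g) \<in> trivs T"
  shows "(\<lambda>z. matrix_inv (g z) *v axis j 1) \<in> hol_sections T V"
proof (rule hsI)
  fix W h i assume W: "(W, h) \<in> trivs T"
  have "(\<lambda>z. (h z ** matrix_inv (g z)) $ i $ j) holomorphic_on V \<inter> W"
    using T V W unfolding holo_bundle_def by blast
  thus "(\<lambda>z. (h z *v (matrix_inv (g z) *v axis j 1)) $ i) holomorphic_on V \<inter> W"
    by (simp only: matrix_vector_mul_assoc matrix_vector_mult_axis)
qed

lemma matrix_inv_cancel:
  fixes A :: "complex ^ 2 ^ 2"
  assumes "invertible A"
  shows "A *v (matrix_inv A *v x) = x" "matrix_inv A *v (A *v x) = x"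
    "A ** matrix_inv A = mat 1" "matrix_inv A ** A = mat 1" "det (matrix_inv A) \<noteq> 0"
proof -
  show *: "A ** matrix_inv A = mat 1" "matrix_inv A ** A = mat 1"
    using someI_ex[OF assms[unfolded invertible_def]] unfolding matrix_inv_def by blast+
  show "A *v (matrix_inv A *v x) = x" "matrix_inv A *v (A *v x) = x"
    by (simp_all add: matrix_vector_mul_assoc *)
  show "det (matrix_inv A) \<noteq> 0"
    using arg_cong[OF *(1), of det] by (auto simp: det_mul)
qed

definition germ_comb ::
    "(complex \<Rightarrow> complex ^ 2) \<Rightarrow> (complex \<Rightarrow> complex ^ 2) \<Rightarrow> (complex \<Rightarrow> complex ^ 2) \<Rightarrow> bool" where
  "germ_comb a b \<sigma> \<longleftrightarrow> (\<exists>f g. f analytic_on {0} \<and> g analytic_on {0} \<and>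
     eventually (\<lambda>z. \<sigma> z = f z *s a z + g z *s b z) (at 0))"

lemma germ_combE:
  assumes "germ_comb a b \<sigma>"
  obtains f g where "f analytic_on {0}" "g analytic_on {0}"
    "eventually (\<lambda>z. \<sigma> z = f z *s a z + g z *s b z) (at 0)"
  using assms unfolding germ_comb_def by blast

lemma germ_basis_mem:
  assumes "germ_basis T a b"
  shows "a \<in> germs0 T" "b \<in> germs0 T" "\<sigma> \<in> germs0 T \<Longrightarrow> germ_comb a b \<sigma>"
proof -
  have mem: "\<sigma> \<in> germs0 T \<longleftrightarrow> germ_comb a b \<sigma>" for \<sigma>
    using conjunct1[OF assms[unfolded germ_basis_def]] by (simp add: set_eq_iff germ_comb_def)
  show "a \<in> germs0 T" unfolding mem germ_comb_def
    by (intro exI[of _ "\<lambda>_. 1"] exI[of _ "\<lambda>_. 0"]) (simp add: analytic_on_const)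
  show "b \<in> germs0 T" unfolding mem germ_comb_def
    by (intro exI[of _ "\<lambda>_. 0"] exI[of _ "\<lambda>_. 1"]) (simp add: analytic_on_const)
  show "\<sigma> \<in> germs0 T \<Longrightarrow> germ_comb a b \<sigma>" unfolding mem .
qed

text \<open>The frame of a trivialisation around 0, with Cramer's rule for the coefficients. The
  nonvanishing determinant later gives the lattice its rank.\<close>

lemma germs0_basis:
  assumes T: "holo_bundle T"
  obtains e1 e2 where "e1 \<in> germs0 T" "e2 \<in> germs0 T"
    "eventually (\<lambda>z. cdet (e1 z) (e2 z) \<noteq> 0) (at 0)"
    "\<And>\<sigma>. \<sigma> \<in> germs0 T \<Longrightarrow> germ_comb e1 e2 \<sigma>"
proof -
  obtain V g where V: "(V, g) \<in> trivs T" "open V" "0 \<in> V" "\<And>w. w \<in> V \<Longrightarrow> invertible (g w)"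
    using triv_cover[OF T, of 0] by blast
  define e where "e j = (\<lambda>z. matrix_inv (g z) *v axis j 1)" for j :: 2
  have e: "e j \<in> hol_sections T V" for j unfolding e_def by (rule triv_frame[OF T V(1)])
  have nz: "cdet (e 1 z) (e 2 z) \<noteq> 0" if "z \<in> V" for z
    using matrix_inv_cancel(5)[OF V(4)[OF that]]
    unfolding e_def cdet_mult by (simp add: cdet_def axis_def)
  show ?thesis
  proof (rule that[of "e 1" "e 2"])
    show "e 1 \<in> germs0 T" by (rule germs0I[OF V(2,3) e[of 1]]) simp
    show "e 2 \<in> germs0 T" by (rule germs0I[OF V(2,3) e[of 2]]) simp
    have "eventually (\<lambda>z. z \<in> V) (at 0)" using V(2,3) by (rule eventually_at_in_open')
    thus "eventually (\<lambda>z. cdet (e 1 z) (e 2 z) \<noteq> 0) (at 0)"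
      by (rule eventually_mono) (rule nz)
  next
    fix \<sigma> assume "\<sigma> \<in> germs0 T"
    then obtain U \<tau> where U: "open U" "0 \<in> U" "\<tau> \<in> hol_sections T U"
      "eventually (\<lambda>z. \<sigma> z = \<tau> z) (at 0)"
      by (rule germs0E)
    let ?W = "U \<inter> V"
    have W: "open ?W" "0 \<in> ?W" using U V by auto
    have nz': "cdet (e 1 z) (e 2 z) \<noteq> 0" if "z \<in> ?W" for z using nz that by blast
    have hs: "e 1 \<in> hol_sections T ?W" "e 2 \<in> hol_sections T ?W" "\<tau> \<in> hol_sections T ?W"
      by (rule hs_mono[OF e] hs_mono[OF U(3)]; blast)+
    let ?f = "\<lambda>z. cdet (\<tau> z) (e 2 z) / cdet (e 1 z) (e 2 z)"
    let ?g = "\<lambda>z. cdet (e 1 z) (\<tau> z) / cdet (e 1 z) (e 2 z)"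
    have "?f holomorphic_on ?W" by (rule hs_coords(1)[OF T W(1) hs]) (rule nz')
    hence f: "?f analytic_on {0}" using W by (rule holomorphic_on_imp_analytic_at)
    have "?g holomorphic_on ?W" by (rule hs_coords(2)[OF T W(1) hs]) (rule nz')
    hence g: "?g analytic_on {0}" using W by (rule holomorphic_on_imp_analytic_at)
    have "eventually (\<lambda>z. z \<in> ?W) (at 0)" using W by (rule eventually_at_in_open')
    hence "eventually (\<lambda>z. \<sigma> z = ?f z *s e 1 z + ?g z *s e 2 z) (at 0)"
      using U(4)
    proof eventually_elim
      case (elim z)
      show ?case unfolding elim(2) by (rule vec_cramer[OF nz'[OF elim(1)]])
    qed
    with f g show "germ_comb (e 1) (e 2) \<sigma>"
      unfolding germ_comb_def by (intro exI[of _ ?f] exI[of _ ?g] conjI)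
  qed
qed

section \<open>Coordinate series of germs in an elementary frame\<close>

definition zpF :: "complex \<Rightarrow> complex fls" where
  "zpF c = (if c \<in> \<int> then fls_X_intpow \<lfloor>Re c\<rfloor> else 0)"

lemma zp_expansion: "zp c has_laurent_expansion zpF c"
proof (cases "c \<in> \<int>")
  case True
  hence "zp c = (\<lambda>z. z powi \<lfloor>Re c\<rfloor>)" by (simp add: zp_def fun_eq_iff)
  thus ?thesis using True by (simp add: zpF_def has_laurent_expansion_fps_X_power_int)
next
  case False
  hence "zp c = (\<lambda>_. 0)" by (simp add: zp_def fun_eq_iff)
  thus ?thesis using False by (simp add: zpF_def)
qed

lemma cvg_zpF [intro]: "cvg (zpF c)"
  using zp_expansion cvg_def by blast

context te_frame
begin

text \<open>A relation, because coordinates in an elementary frame may have an essential singularity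
  at 0; where they are meromorphic, the pair of series is unique.\<close>

definition crd :: "(complex \<Rightarrow> complex ^ 2) \<Rightarrow> complex fls \<times> complex fls \<Rightarrow> bool" where
  "crd \<sigma> v \<longleftrightarrow> (\<exists>f g. f has_laurent_expansion fst v \<and> g has_laurent_expansion snd v \<and>
     eventually (\<lambda>z. \<sigma> z = f z *s s1 z + g z *s s2 z) (at 0))"

lemma crdE:
  assumes "crd \<sigma> v"
  obtains f g where "f has_laurent_expansion fst v" "g has_laurent_expansion snd v"
    "eventually (\<lambda>z. \<sigma> z = f z *s s1 z + g z *s s2 z) (at 0)"
  using assms unfolding crd_def by blast

lemma crdI:
  assumes "f has_laurent_expansion fst v" "g has_laurent_expansion snd v"
    "eventually (\<lambda>z. \<sigma> z = f z *s s1 z + g z *s s2 z) (at 0)"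
  shows "crd \<sigma> v"
  using assms unfolding crd_def by blast

lemma eventually_nz: "eventually (\<lambda>z :: complex. z \<noteq> 0) (at 0)"
  by (auto simp: eventually_at_filter)

lemma crd_unique_cong:
  assumes "crd \<sigma> v" "crd \<tau> w" "eventually (\<lambda>z. \<sigma> z = \<tau> z) (at 0)"
  shows "v = w"
proof -
  obtain f g where fg: "f has_laurent_expansion fst v" "g has_laurent_expansion snd v"
    "eventually (\<lambda>z. \<sigma> z = f z *s s1 z + g z *s s2 z) (at 0)" using assms(1) by (rule crdE)
  obtain f' g' where fg': "f' has_laurent_expansion fst w" "g' has_laurent_expansion snd w"
    "eventually (\<lambda>z. \<tau> z = f' z *s s1 z + g' z *s s2 z) (at 0)" using assms(2) by (rule crdE)
  have ev: "eventually (\<lambda>z. f z = f' z \<and> g z = g' z) (at 0)"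
    using fg(3) fg'(3) assms(3) eventually_nz
  proof eventually_elim
    case (elim z)
    hence "f z *s s1 z + g z *s s2 z = f' z *s s1 z + g' z *s s2 z" by simp
    thus ?case using vec_comb_eq_iff[OF indep[OF elim(4)]] by simp
  qed
  hence "eventually (\<lambda>z. f z = f' z) (at 0)" "eventually (\<lambda>z. g z = g' z) (at 0)"
    by (auto elim: eventually_mono)
  hence "f' has_laurent_expansion fst v" "g' has_laurent_expansion snd v"
    using expansion_cong fg by blast+
  hence "fst v = fst w" "snd v = snd w"
    using fg'(1,2) has_laurent_expansion_unique by blast+
  thus ?thesis by (rule prod_eqI)
qed

lemma crd_unique: "crd \<sigma> v \<Longrightarrow> crd \<sigma> w \<Longrightarrow> v = w"
  by (rule crd_unique_cong) auto

lemma crd_cong: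
  assumes "crd \<sigma> v" "eventually (\<lambda>z. \<sigma> z = \<tau> z) (at 0)"
  shows "crd \<tau> v"
proof -
  obtain f g where fg: "f has_laurent_expansion fst v" "g has_laurent_expansion snd v"
    "eventually (\<lambda>z. \<sigma> z = f z *s s1 z + g z *s s2 z) (at 0)" using assms(1) by (rule crdE)
  have "eventually (\<lambda>z. \<tau> z = f z *s s1 z + g z *s s2 z) (at 0)"
    using fg(3) assms(2) by eventually_elim simp
  thus ?thesis by (rule crdI[OF fg(1,2)])
qed

lemma crd_eventually_eq:
  assumes "crd \<sigma> v" "crd \<tau> v"
  shows "eventually (\<lambda>z. \<sigma> z = \<tau> z) (at 0)"
proof -
  obtain f g where fg: "f has_laurent_expansion fst v" "g has_laurent_expansion snd v"
    "eventually (\<lambda>z. \<sigma> z = f z *s s1 z + g z *s s2 z) (at 0)" using assms(1) by (rule crdE)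
  obtain f' g' where fg': "f' has_laurent_expansion fst v" "g' has_laurent_expansion snd v"
    "eventually (\<lambda>z. \<tau> z = f' z *s s1 z + g' z *s s2 z) (at 0)" using assms(2) by (rule crdE)
  show ?thesis
    using fg(3) fg'(3) expansion_eventually_eq[OF fg(1) fg'(1)] expansion_eventually_eq[OF fg(2) fg'(2)]
    by eventually_elim simp
qed

lemma crd_comb:
  assumes "p has_laurent_expansion P" "q has_laurent_expansion Q" "crd \<sigma> v" "crd \<tau> w"
  shows "crd (\<lambda>z. p z *s \<sigma> z + q z *s \<tau> z) (psmul P v + psmul Q w)"
proof -
  obtain f g where fg: "f has_laurent_expansion fst v" "g has_laurent_expansion snd v"
    "eventually (\<lambda>z. \<sigma> z = f z *s s1 z + g z *s s2 z) (at 0)" using assms(3) by (rule crdE)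
  obtain f' g' where fg': "f' has_laurent_expansion fst w" "g' has_laurent_expansion snd w"
    "eventually (\<lambda>z. \<tau> z = f' z *s s1 z + g' z *s s2 z) (at 0)" using assms(4) by (rule crdE)
  show ?thesis
  proof (rule crdI)
    show "(\<lambda>z. p z * f z + q z * f' z) has_laurent_expansion fst (psmul P v + psmul Q w)"
         "(\<lambda>z. p z * g z + q z * g' z) has_laurent_expansion snd (psmul P v + psmul Q w)"
      by (simp_all, (intro laurent_expansion_intros assms fg fg')+)
    show "eventually (\<lambda>z. p z *s \<sigma> z + q z *s \<tau> z =
            (p z * f z + q z * f' z) *s s1 z + (p z * g z + q z * g' z) *s s2 z) (at 0)"
      using fg(3) fg'(3) by eventually_elim (simp add: vec_eq_iff algebra_simps)
  qed
qed

lemma crd_smul: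
  assumes "p has_laurent_expansion P" "crd \<sigma> v"
  shows "crd (\<lambda>z. p z *s \<sigma> z) (psmul P v)"
  using crd_comb[OF assms(1) has_laurent_expansion_0 assms(2,2)] by simp

lemma crd_add:
  assumes "crd \<sigma> v" "crd \<tau> w"
  shows "crd (\<sigma> + \<tau>) (v + w)"
  using crd_comb[OF has_laurent_expansion_1 has_laurent_expansion_1 assms] by (simp add: plus_fun_def)

lemma crd_fscale: "crd \<sigma> v \<Longrightarrow> crd (fscale c \<sigma>) (psmul (fls_const c) v)"
  unfolding fscale_def by (intro crd_smul laurent_expansion_intros)

lemma crd_zpow: "crd \<sigma> v \<Longrightarrow> crd (zpow_mult n \<sigma>) (psmul (fls_X ^ n) v)"
  unfolding zpow_mult_def by (intro crd_smul laurent_expansion_intros)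

lemma crd_pcvg: "crd \<sigma> v \<Longrightarrow> pcvg v"
  unfolding crd_def pcvg_def cvg_def by blast

lemma crd_el: "crd (el \<alpha> C D) (fls_const C * zpF (\<alpha> - \<alpha>1), fls_const D * zpF (\<alpha> - \<alpha>2))"
proof (rule crdI)
  show "(\<lambda>z. C * zp (\<alpha> - \<alpha>1) z) has_laurent_expansion
          fst (fls_const C * zpF (\<alpha> - \<alpha>1), fls_const D * zpF (\<alpha> - \<alpha>2))"
       "(\<lambda>z. D * zp (\<alpha> - \<alpha>2) z) has_laurent_expansion
          snd (fls_const C * zpF (\<alpha> - \<alpha>1), fls_const D * zpF (\<alpha> - \<alpha>2))"
    unfolding fst_conv snd_conv by (intro laurent_expansion_intros zp_expansion)+
qed (simp add: el_def)

abbreviation D where "D \<equiv> delta \<alpha>1 \<alpha>2 (fls_const \<kappa> * fls_X ^ k)"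

lemma crd_nabla:
  assumes "crd \<sigma> v"
  shows "crd (\<lambda>z. z *s nabla T \<sigma> z) (D v)"
proof -
  obtain f g where fg: "f has_laurent_expansion fst v" "g has_laurent_expansion snd v"
    "eventually (\<lambda>z. \<sigma> z = f z *s s1 z + g z *s s2 z) (at 0)" using assms by (rule crdE)
  show ?thesis
  proof (rule crdI)
    show "(\<lambda>z. z * deriv f z + \<alpha>1 * f z) has_laurent_expansion fst (D v)"
         "(\<lambda>z. z * deriv g z + \<kappa> * z ^ k * f z + \<alpha>2 * g z) has_laurent_expansion snd (D v)"
      unfolding delta_def theta_def fst_conv snd_conv by (intro laurent_expansion_intros fg)+
    have "eventually (\<lambda>r. \<forall>z \<in> ball 0 r - {0}. z *s nabla T \<sigma> z =
        (z * deriv f z + \<alpha>1 * f z) *s s1 z +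
        (z * deriv g z + \<kappa> * z ^ k * f z + \<alpha>2 * g z) *s s2 z) (at_right 0)"
      using expansion_punctured_holo[OF fg(1)] expansion_punctured_holo[OF fg(2)]
        fg(3)[unfolded eventually_at0_ball]
    proof eventually_elim
      case (elim r)
      have N: "open (ball 0 r - {0 :: complex})" "0 \<notin> ball 0 r - {0 :: complex}" by auto
      show ?case
      proof
        fix z :: complex assume z: "z \<in> ball 0 r - {0}"
        show "z *s nabla T \<sigma> z = (z * deriv f z + \<alpha>1 * f z) *s s1 z +
            (z * deriv g z + \<kappa> * z ^ k * f z + \<alpha>2 * g z) *s s2 z"
          by (rule nabla_coords(2)[OF N elim(1,2) _ z]) (rule bspec[OF elim(3)])
      qed
    qed
    thus "eventually (\<lambda>z. z *s nabla T \<sigma> z = (z * deriv f z + \<alpha>1 * f z) *s s1 z +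
        (z * deriv g z + \<kappa> * z ^ k * f z + \<alpha>2 * g z) *s s2 z) (at 0)"
      unfolding eventually_at0_ball .
  qed
qed

definition Lat :: "(complex fls \<times> complex fls) set" where
  "Lat = {v. \<exists>\<sigma> \<in> germs0 T. crd \<sigma> v}"

lemma Lat_iff:
  assumes "crd \<sigma> v"
  shows "v \<in> Lat \<longleftrightarrow> \<sigma> \<in> germs0 T"
proof
  assume "v \<in> Lat"
  then obtain \<tau> where \<tau>: "\<tau> \<in> germs0 T" "crd \<tau> v" unfolding Lat_def by blast
  show "\<sigma> \<in> germs0 T" by (rule germs0_cong[OF \<tau>(1) crd_eventually_eq[OF \<tau>(2) assms]])
qed (use assms Lat_def in blast)

lemma Lat_span:
  assumes ab: "a \<in> germs0 T" "b \<in> germs0 T" "crd a v" "crd b w"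
    and span: "\<And>\<sigma>. \<sigma> \<in> germs0 T \<Longrightarrow> germ_comb a b \<sigma>"
  shows "Lat = lat v w"
proof (intro equalityI subsetI)
  fix u assume "u \<in> Lat"
  then obtain \<sigma> where \<sigma>: "\<sigma> \<in> germs0 T" "crd \<sigma> u" unfolding Lat_def by blast
  obtain f g where fg: "f analytic_on {0}" "g analytic_on {0}"
    "eventually (\<lambda>z. \<sigma> z = f z *s a z + g z *s b z) (at 0)" using span[OF \<sigma>(1)] by (rule germ_combE)
  obtain P where P: "reg P" "f has_laurent_expansion P" using fg(1) by (rule analytic_imp_reg)
  obtain Q where Q: "reg Q" "g has_laurent_expansion Q" using fg(2) by (rule analytic_imp_reg)
  have "u = psmul P v + psmul Q w"
    by (rule crd_unique_cong[OF \<sigma>(2) crd_comb[OF P(2) Q(2) ab(3,4)] fg(3)])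
  thus "u \<in> lat v w" by (rule latI[OF P(1) Q(1)])
next
  fix u assume "u \<in> lat v w"
  then obtain P Q where PQ: "reg P" "reg Q" "u = psmul P v + psmul Q w" by (rule latE)
  obtain p where p: "p analytic_on {0}" "p has_laurent_expansion P" using PQ(1) by (rule reg_imp_analytic)
  obtain q where q: "q analytic_on {0}" "q has_laurent_expansion Q" using PQ(2) by (rule reg_imp_analytic)
  show "u \<in> Lat" unfolding PQ(3) Lat_iff[OF crd_comb[OF p(2) q(2) ab(3,4)]]
    by (rule germs0_comb[OF ab(1,2) p(1) q(1)])
qed

end

text \<open>The assumption is the form in which regular singularity is used: no germ of the stalk
  has an essential singularity in its coordinates.\<close>

locale mero_frame = te_frame +
  assumes mero: "\<sigma> \<in> germs0 T \<Longrightarrow> \<exists>v. crd \<sigma> v"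
begin

text \<open>Up to the factor \<open>cdet (s1 z) (s2 z)\<close>, the determinant of the coordinate
  functions is that of a local frame, which has no zeros near 0. So its Laurent series is not
  0.\<close>

lemma Lat_lattice:
  obtains v w where "pcvg v" "pcvg w" "pdet v w \<noteq> 0" "Lat = lat v w"
proof -
  obtain e1 e2 where e: "e1 \<in> germs0 T" "e2 \<in> germs0 T"
    and nz: "eventually (\<lambda>z. cdet (e1 z) (e2 z) \<noteq> 0) (at 0)"
    and span: "\<And>\<sigma>. \<sigma> \<in> germs0 T \<Longrightarrow> germ_comb e1 e2 \<sigma>"
    using germs0_basis[OF holo_bundle] by blast
  obtain v w where vw: "crd e1 v" "crd e2 w" using mero e by blast
  obtain f g where fg: "f has_laurent_expansion fst v" "g has_laurent_expansion snd v"
    "eventually (\<lambda>z. e1 z = f z *s s1 z + g z *s s2 z) (at 0)" using vw(1) by (rule crdE)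
  obtain f' g' where fg': "f' has_laurent_expansion fst w" "g' has_laurent_expansion snd w"
    "eventually (\<lambda>z. e2 z = f' z *s s1 z + g' z *s s2 z) (at 0)" using vw(2) by (rule crdE)
  have exp: "(\<lambda>z. f z * g' z - g z * f' z) has_laurent_expansion pdet v w"
    unfolding pdet_def by (intro laurent_expansion_intros fg fg')
  have "pdet v w \<noteq> 0"
  proof
    assume "pdet v w = 0"
    hence "(\<lambda>z. f z * g' z - g z * f' z) has_laurent_expansion 0" using exp by simp
    from expansion_eventually_eq[OF this has_laurent_expansion_0] nz fg(3) fg'(3)
    have "eventually (\<lambda>z :: complex. False) (at 0)"
    proof eventually_elim
      case (elim z)
      have "cdet (e1 z) (e2 z) = (f z * g' z - g z * f' z) * cdet (s1 z) (s2 z)"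
        unfolding elim(3,4) by (simp add: cdet_def algebra_simps)
      thus ?case using elim(1,2) by simp
    qed
    thus False by (simp add: eventually_False)
  qed
  moreover have "Lat = lat v w" by (rule Lat_span[OF e vw span])
  ultimately show ?thesis using that crd_pcvg[OF vw(1)] crd_pcvg[OF vw(2)] by blast
qed

lemma Lat_eq_imp_det:
  assumes "Lat = lat v w"
  shows "pdet v w \<noteq> 0"
proof -
  obtain v' w' where vw: "pdet v' w' \<noteq> 0" "Lat = lat v' w'" by (rule Lat_lattice)
  have "v' \<in> lat v w" "w' \<in> lat v w" using lat_gens(1)[of v' w'] lat_gens(2)[of w' v'] vw(2) assms by auto
  then obtain d where "pdet v' w' = d * pdet v w" using lat_det by blast
  thus ?thesis using vw(1) by auto
qed

text \<open>Both halves of \<open>germ_basis\<close> become one equation of lattices. Freeness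
  follows from it, since \<open>Lat\<close> has rank two and so any two generators have nonzero
  determinant.\<close>

lemma germ_basis_iff:
  assumes ab: "crd a v" "crd b w"
  shows "germ_basis T a b \<longleftrightarrow> Lat = lat v w"
proof
  assume basis: "germ_basis T a b"
  show "Lat = lat v w"
    by (rule Lat_span[OF germ_basis_mem(1,2)[OF basis] ab germ_basis_mem(3)[OF basis]])
next
  assume Lat: "Lat = lat v w"
  note nz = Lat_eq_imp_det[OF Lat]
  have ab': "a \<in> germs0 T" "b \<in> germs0 T"
    using Lat_iff[OF ab(1)] Lat_iff[OF ab(2)] lat_gens(1)[of v w] lat_gens(2)[of w v] Lat by simp_all
  have "germ_comb a b \<sigma>" if \<sigma>: "\<sigma> \<in> germs0 T" for \<sigma>
  proof -
    obtain u where u: "crd \<sigma> u" using mero[OF \<sigma>] by blast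
    hence "u \<in> lat v w" using Lat_iff \<sigma> Lat by blast
    then obtain P Q where PQ: "reg P" "reg Q" "u = psmul P v + psmul Q w" by (rule latE)
    obtain p where p: "p analytic_on {0}" "p has_laurent_expansion P" using PQ(1) by (rule reg_imp_analytic)
    obtain q where q: "q analytic_on {0}" "q has_laurent_expansion Q" using PQ(2) by (rule reg_imp_analytic)
    have "eventually (\<lambda>z. \<sigma> z = p z *s a z + q z *s b z) (at 0)"
      by (rule crd_eventually_eq[OF u[unfolded PQ(3)] crd_comb[OF p(2) q(2) ab]])
    thus ?thesis unfolding germ_comb_def using p(1) q(1) by blast
  qed
  moreover have "\<sigma> \<in> germs0 T" if "f analytic_on {0}" "g analytic_on {0}"
     "eventually (\<lambda>z. \<sigma> z = f z *s a z + g z *s b z) (at 0)" for \<sigma> f g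
  proof (rule germs0_cong[OF germs0_comb[OF ab' that(1,2)]])
    show "eventually (\<lambda>z. f z *s a z + g z *s b z = \<sigma> z) (at 0)"
      using that(3) by eventually_elim simp
  qed
  ultimately have "germs0 T = {\<sigma>. germ_comb a b \<sigma>}" by (auto elim: germ_combE)
  moreover have "eventually (\<lambda>z. f z = 0 \<and> g z = 0) (nhds 0)"
    if fg: "f analytic_on {0}" "g analytic_on {0}"
      "eventually (\<lambda>z. f z *s a z + g z *s b z = 0) (at 0)" for f g
  proof -
    obtain P where P: "reg P" "f has_laurent_expansion P" using fg(1) by (rule analytic_imp_reg)
    obtain Q where Q: "reg Q" "g has_laurent_expansion Q" using fg(2) by (rule analytic_imp_reg)
    have "crd (\<lambda>z. 0) 0" by (rule crdI[of "\<lambda>_. 0" _ "\<lambda>_. 0"]) simp_all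
    moreover have "eventually (\<lambda>z. 0 = f z *s a z + g z *s b z) (at 0)"
      using fg(3) by eventually_elim (rule sym)
    ultimately have "0 = psmul P v + psmul Q w"
      by (rule crd_unique_cong[OF _ crd_comb[OF P(2) Q(2) ab]])
    from cramer_unique[OF nz this] have PQ: "P = 0" "Q = 0" by (simp_all add: pdet_def)
    have "eventually (\<lambda>z. f z = 0) (nhds 0)"
      by (rule analytic_expansion_0[OF fg(1) P(2)[unfolded PQ]])
    moreover have "eventually (\<lambda>z. g z = 0) (nhds 0)"
      by (rule analytic_expansion_0[OF fg(2) Q(2)[unfolded PQ]])
    ultimately show ?thesis by eventually_elim simp
  qed
  ultimately show "germ_basis T a b" unfolding germ_basis_def germ_comb_def by blast
qed

text \<open>Here the bound on the pole of the connection enters: multiplication by \<open>z\<close>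
  turns \<open>z * nabla\<close> into the operator that preserves germs.\<close>

lemma Lat_stable:
  assumes "v \<in> Lat"
  shows "psmul fls_X (D v) \<in> Lat"
proof -
  obtain \<sigma> where \<sigma>: "\<sigma> \<in> germs0 T" "crd \<sigma> v" using assms unfolding Lat_def by blast
  obtain U \<tau> where U: "open U" "0 \<in> U" "\<tau> \<in> hol_sections T U" "eventually (\<lambda>z. \<sigma> z = \<tau> z) (at 0)"
    using \<sigma>(1) by (rule germs0E)
  obtain \<rho> where \<rho>: "\<rho> \<in> hol_sections T U" "\<And>z. z \<in> U - {0} \<Longrightarrow> z\<^sup>2 *s nabla T \<tau> z = \<rho> z"
    using bspec[OF mp[OF spec[OF te[unfolded te_structure_def, THEN conjunct2, THEN conjunct2]] U(1)] U(3)]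
    by (elim bexE) blast
  have crd: "crd (\<lambda>z. z *s (z *s nabla T \<tau> z)) (psmul fls_X (D v))"
    by (intro crd_smul laurent_expansion_intros crd_nabla crd_cong[OF \<sigma>(2) U(4)])
  have "eventually (\<lambda>z. z \<in> U) (at 0)" using U(1,2) by (rule eventually_at_in_open')
  hence "eventually (\<lambda>z. z *s (z *s nabla T \<tau> z) = \<rho> z) (at 0)"
    using eventually_nz
  proof eventually_elim
    case (elim z)
    thus ?case using \<rho>(2)[of z] by (simp add: power2_eq_square)
  qed
  hence "(\<lambda>z. z *s (z *s nabla T \<tau> z)) \<in> germs0 T" by (rule germs0I[OF U(1,2) \<rho>(1)])
  thus ?thesis using Lat_iff[OF crd] by simp
qed

lemma Lat_not_log:
  assumes "\<not> logarithmic T"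
  shows "\<exists>v \<in> Lat. D v \<notin> Lat"
proof -
  obtain \<sigma> where \<sigma>: "\<sigma> \<in> germs0 T" "(\<lambda>z. z *s nabla T \<sigma> z) \<notin> germs0 T"
    using assms unfolding logarithmic_def by blast
  obtain v where v: "crd \<sigma> v" using mero[OF \<sigma>(1)] by blast
  show ?thesis using Lat_iff[OF v] Lat_iff[OF crd_nabla[OF v]] \<sigma> by blast
qed

lemma crd_z2_nabla:
  assumes "crd \<sigma> v"
  shows "crd (\<lambda>z. z\<^sup>2 *s nabla T \<sigma> z) (psmul fls_X (D v))"
proof -
  have "crd (\<lambda>z. z *s (z *s nabla T \<sigma> z)) (psmul fls_X (D v))"
    by (intro crd_smul laurent_expansion_intros crd_nabla assms)
  thus ?thesis by (simp add: power2_eq_square)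
qed

lemma reg_c: "reg (fls_const \<kappa> * fls_X ^ k)"
  by (intro reg_mult reg_power reg_const)

lemma cyclic_germ:
  assumes "\<not> logarithmic T"
  obtains \<sigma> where "\<sigma> \<in> germs0 T" "germ_basis T \<sigma> (\<lambda>z. z\<^sup>2 *s nabla T \<sigma> z)"
proof -
  obtain v w where vw: "pcvg v" "pcvg w" "pdet v w \<noteq> 0" "Lat = lat v w" by (rule Lat_lattice)
  have "\<exists>u \<in> lat v w. lat u (psmul fls_X (D u)) = lat v w"
    by (rule cyclic_vector[OF vw(3,1,2) reg_c])
      (use Lat_stable Lat_not_log[OF assms] in \<open>simp_all flip: vw(4)\<close>)
  then obtain u where u: "u \<in> Lat" "Lat = lat u (psmul fls_X (D u))" using vw(4) by auto
  obtain \<sigma> where \<sigma>: "\<sigma> \<in> germs0 T" "crd \<sigma> u" using u(1) unfolding Lat_def by blast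
  show ?thesis using that[OF \<sigma>(1)] germ_basis_iff[OF \<sigma>(2) crd_z2_nabla[OF \<sigma>(2)]] u(2) by simp
qed

text \<open>The nilpotent entry \<open>\<kappa> * z ^ k\<close> has a nonzero value at 0 only for
  \<open>k = 0\<close>; for \<open>k > 0\<close> the difference of the exponents must provide the
  nonzero determinant.\<close>

lemma normal_Lat:
  assumes "germ_basis T \<sigma> (\<lambda>z. z\<^sup>2 *s nabla T \<sigma> z)" "crd \<sigma> (p, q)" "reg p" "reg q" "fls_nth p 0 \<noteq> 0"
    and "fls_nth q 0 * (\<alpha>2 - \<alpha>1) + (if k = 0 then \<kappa> else 0) * fls_nth p 0 \<noteq> 0"
  shows "Lat = lat (1, fls_const (fls_nth q 0 / fls_nth p 0)) (0, fls_X)"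
proof -
  have "fls_nth (fls_const \<kappa> * fls_X ^ k) 0 = (if k = 0 then \<kappa> else 0)"
    by (simp add: reg_nth0_mult[OF reg_const(1) reg_power[OF reg_const(4)]])
  hence "lat (p, q) (psmul fls_X (D (p, q))) = lat (1, fls_const (fls_nth q 0 / fls_nth p 0)) (0, fls_X)"
    using assms by (intro normal_lattice reg_c) simp_all
  thus ?thesis using assms(1) germ_basis_iff[OF assms(2) crd_z2_nabla[OF assms(2)]] by simp
qed

end

section \<open>Change of frame and isomorphisms\<close>

context mero_frame
begin

context
  fixes m n :: int and x1 y1 x2 y2 :: complex and k' :: nat
  assumes k0: "k = 0"
    and d: "x1 * y2 - y1 * x2 \<noteq> 0"
    and c1: "x2 = 0 \<or> \<kappa> = 0 \<and> \<alpha>1 = \<alpha>2"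
    and c2: "y1 = 0 \<or> \<alpha>1 = \<alpha>2"
    and c3: "\<kappa> \<noteq> 0 \<Longrightarrow> x1 = y2 \<and> m = n + int k'"
begin

definition t1 :: "complex \<Rightarrow> complex ^ 2" where
  "t1 = (\<lambda>z. (x1 * z powi m) *s s1 z + (y1 * z powi m) *s s2 z)"

definition t2 :: "complex \<Rightarrow> complex ^ 2" where
  "t2 = (\<lambda>z. (x2 * z powi n) *s s1 z + (y2 * z powi n) *s s2 z)"

lemma deriv_powi: "z \<noteq> 0 \<Longrightarrow> z * deriv (\<lambda>z. c * z powi l) z = of_int l * (c * z powi l)" for c z :: complex
proof -
  assume z: "z \<noteq> 0"
  have "((\<lambda>z. c * z powi l) has_field_derivative c * (of_int l * zp (of_int l) z / z)) (at z)"
    using DERIV_cmult[OF zp_deriv[OF z, of "of_int l"], of c] by simp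
  thus ?thesis using z by (simp add: DERIV_imp_deriv)
qed

text \<open>The side conditions keep the shape of the connection. Mixing \<open>s1\<close> into
  \<open>t2\<close> requires a connection that is scalar in the frame, mixing \<open>s2\<close> into
  \<open>t1\<close> equal exponents. For \<open>\<kappa> \<noteq> 0\<close> equal scale factors
  preserve \<open>\<kappa>\<close>, and the difference of the two shifts becomes the new power
  \<open>k'\<close>.\<close>

lemma reframe_te: "te_frame T t1 t2 (\<alpha>1 + of_int m) (\<alpha>2 + of_int n) \<kappa> k'"
proof
  have o: "open (- {0 :: complex})" "0 \<notin> - {0 :: complex}" by auto
  have h: "(\<lambda>z. c * z powi l) holomorphic_on - {0 :: complex}" for c l
    by (intro holomorphic_intros) auto
  show "te_structure T" by (rule te)
  show "t1 \<in> hol_sections T (- {0})"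
    by (rule nabla_coords(1)[OF o h h]) (simp add: t1_def)
  show "t2 \<in> hol_sections T (- {0})"
    by (rule nabla_coords(1)[OF o h h]) (simp add: t2_def)
  show "t1 0 = 0" "t2 0 = 0" by (simp_all add: t1_def t2_def s1 s2)
  show "\<kappa> \<noteq> 0 \<Longrightarrow> \<alpha>1 + of_int m = \<alpha>2 + of_int n + of_nat k'"
    using deg k0 c3 by simp
  fix z :: complex assume z: "z \<noteq> 0"
  have "cdet (t1 z) (t2 z) = z powi m * z powi n * (x1 * y2 - y1 * x2) * cdet (s1 z) (s2 z)"
    unfolding t1_def t2_def by (simp add: cdet_def algebra_simps)
  thus "cdet (t1 z) (t2 z) \<noteq> 0" using indep[OF z] z d by simp
  have zU: "z \<in> - {0}" using z by simp
  have n1: "z *s nabla T t1 z = (of_int m * (x1 * z powi m) + \<alpha>1 * (x1 * z powi m)) *s s1 z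
     + (of_int m * (y1 * z powi m) + \<kappa> * (x1 * z powi m) + \<alpha>2 * (y1 * z powi m)) *s s2 z"
    using nabla_coords(2)[OF o h h _ zU, of t1 x1 m y1 m] unfolding deriv_powi[OF z]
    by (simp add: t1_def k0)
  have n2: "z *s nabla T t2 z = (of_int n * (x2 * z powi n) + \<alpha>1 * (x2 * z powi n)) *s s1 z
     + (of_int n * (y2 * z powi n) + \<kappa> * (x2 * z powi n) + \<alpha>2 * (y2 * z powi n)) *s s2 z"
    using nabla_coords(2)[OF o h h _ zU, of t2 x2 n y2 n] unfolding deriv_powi[OF z]
    by (simp add: t2_def k0)
  have e1: "\<kappa> * x2 = 0" "\<alpha>1 * x2 = \<alpha>2 * x2" "\<alpha>1 * y1 = \<alpha>2 * y1"
    using c1 c2 by auto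
  have e2: "\<kappa> * x1 * z powi m = \<kappa> * z ^ k' * (y2 * z powi n)"
    using c3 z by (cases "\<kappa> = 0") (auto simp: power_int_add)
  have e3: "\<kappa> * z ^ k' * (x2 * z powi n) = 0" using c1 by auto
  have A: "of_int m * (x1 * z powi m) + \<alpha>1 * (x1 * z powi m)
      = (\<alpha>1 + of_int m) * (x1 * z powi m) + \<kappa> * z ^ k' * (x2 * z powi n)"
    unfolding e3 by (simp add: algebra_simps)
  have B: "of_int m * (y1 * z powi m) + \<kappa> * (x1 * z powi m) + \<alpha>2 * (y1 * z powi m)
      = (\<alpha>1 + of_int m) * (y1 * z powi m) + \<kappa> * z ^ k' * (y2 * z powi n)"
    unfolding e2[symmetric] using arg_cong[OF e1(3), of "\<lambda>c. c * z powi m"] by (auto simp: algebra_simps)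
  show "z *s nabla T t1 z = (\<alpha>1 + of_int m) *s t1 z + (\<kappa> * z ^ k') *s t2 z"
    unfolding n1 A B by (simp add: t1_def t2_def vec_eq_iff algebra_simps)
  have A: "of_int n * (x2 * z powi n) + \<alpha>1 * (x2 * z powi n) = (\<alpha>2 + of_int n) * (x2 * z powi n)"
    using arg_cong[OF e1(2), of "\<lambda>c. c * z powi n"] by (simp add: algebra_simps)
  have B: "of_int n * (y2 * z powi n) + \<kappa> * (x2 * z powi n) + \<alpha>2 * (y2 * z powi n)
      = (\<alpha>2 + of_int n) * (y2 * z powi n)"
    using arg_cong[OF e1(1), of "\<lambda>c. c * z powi n"] by (simp add: algebra_simps)
  show "z *s nabla T t2 z = (\<alpha>2 + of_int n) *s t2 z"
    unfolding n2 A B by (simp add: t2_def vec_eq_iff algebra_simps)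
qed

text \<open>Coordinates transform by the inverse matrix, written through its adjugate, and by the
  opposite powers of \<open>z\<close>.\<close>

lemma reframe_crd:
  assumes "crd \<sigma> (F, G)"
  shows "te_frame.crd t1 t2 \<sigma>
     (fls_X_intpow (- m) * (fls_const y2 * F - fls_const x2 * G) / fls_const (x1 * y2 - y1 * x2),
      fls_X_intpow (- n) * (fls_const x1 * G - fls_const y1 * F) / fls_const (x1 * y2 - y1 * x2))"
proof -
  interpret t: te_frame T t1 t2 "\<alpha>1 + of_int m" "\<alpha>2 + of_int n" \<kappa> k' by (rule reframe_te)
  obtain f g where fg: "f has_laurent_expansion fst (F, G)" "g has_laurent_expansion snd (F, G)"
    "eventually (\<lambda>z. \<sigma> z = f z *s s1 z + g z *s s2 z) (at 0)" using assms by (rule crdE)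
  let ?d = "x1 * y2 - y1 * x2"
  let ?f = "\<lambda>z. z powi (- m) * (y2 * f z - x2 * g z) / ?d"
  let ?g = "\<lambda>z. z powi (- n) * (x1 * g z - y1 * f z) / ?d"
  show ?thesis
  proof (rule t.crdI[of ?f _ ?g])
    have e: "f has_laurent_expansion F" "g has_laurent_expansion G" using fg(1,2) by simp_all
    show "?f has_laurent_expansion fst (fls_X_intpow (- m) * (fls_const y2 * F - fls_const x2 * G) / fls_const ?d,
      fls_X_intpow (- n) * (fls_const x1 * G - fls_const y1 * F) / fls_const ?d)"
      unfolding fst_conv by (intro laurent_expansion_intros e)
    show "?g has_laurent_expansion snd (fls_X_intpow (- m) * (fls_const y2 * F - fls_const x2 * G) / fls_const ?d,
      fls_X_intpow (- n) * (fls_const x1 * G - fls_const y1 * F) / fls_const ?d)"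
      unfolding snd_conv by (intro laurent_expansion_intros e)
    show "eventually (\<lambda>z. \<sigma> z = ?f z *s t1 z + ?g z *s t2 z) (at 0)"
      using fg(3) eventually_nz
    proof eventually_elim
      case (elim z)
      have p: "(P * u / e) *s ((a * Q) *s v + (b * Q) *s w) = (u / e * a) *s v + (u / e * b) *s w"
        if "P * Q = 1" for P Q u e a b and v w :: "complex ^ 2"
      proof -
        have eq: "P * u / e * (c * Q) = (P * Q) * (u / e * c)" for c by simp
        show ?thesis unfolding vector_add_ldistrib vector_smult_assoc eq that by simp
      qed
      have pow: "z powi (- l) * z powi l = 1" for l using elim(2) by (simp add: power_int_minus)
      have E1: "?f z *s t1 z = ((y2 * f z - x2 * g z) / ?d * x1) *s s1 z + ((y2 * f z - x2 * g z) / ?d * y1) *s s2 z"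
        unfolding t1_def by (rule p[OF pow])
      have E2: "?g z *s t2 z = ((x1 * g z - y1 * f z) / ?d * x2) *s s1 z + ((x1 * g z - y1 * f z) / ?d * y2) *s s2 z"
        unfolding t2_def by (rule p[OF pow])
      have E3: "(y2 * f z - x2 * g z) / ?d * x1 + (x1 * g z - y1 * f z) / ?d * x2 = f z"
      proof -
        have "(y2 * f z - x2 * g z) / ?d * x1 + (x1 * g z - y1 * f z) / ?d * x2 =
            ((y2 * f z - x2 * g z) * x1 + (x1 * g z - y1 * f z) * x2) / ?d"
          by (simp add: add_divide_distrib)
        also have "(y2 * f z - x2 * g z) * x1 + (x1 * g z - y1 * f z) * x2 = ?d * f z"
          by (simp add: algebra_simps)
        finally show ?thesis using d by simp
      qed
      have E4: "(y2 * f z - x2 * g z) / ?d * y1 + (x1 * g z - y1 * f z) / ?d * y2 = g z"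
      proof -
        have "(y2 * f z - x2 * g z) / ?d * y1 + (x1 * g z - y1 * f z) / ?d * y2 =
            ((y2 * f z - x2 * g z) * y1 + (x1 * g z - y1 * f z) * y2) / ?d"
          by (simp add: add_divide_distrib)
        also have "(y2 * f z - x2 * g z) * y1 + (x1 * g z - y1 * f z) * y2 = ?d * g z"
          by (simp add: algebra_simps)
        finally show ?thesis using d by simp
      qed
      have E5: "(a *s s1 z + b *s s2 z) + (a' *s s1 z + b' *s s2 z) =
          (a + a') *s s1 z + (b + b') *s s2 z" for a b a' b'
        by (simp add: vec_eq_iff algebra_simps)
      show ?case unfolding elim(1) E1 E2 E5 E3 E4 ..
    qed
  qed
qed

lemma reframe: "mero_frame T t1 t2 (\<alpha>1 + of_int m) (\<alpha>2 + of_int n) \<kappa> k'"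
proof -
  interpret t: te_frame T t1 t2 "\<alpha>1 + of_int m" "\<alpha>2 + of_int n" \<kappa> k' by (rule reframe_te)
  show ?thesis
  proof
    fix \<sigma> assume "\<sigma> \<in> germs0 T"
    then obtain v where "crd \<sigma> v" using mero by blast
    thus "\<exists>v. t.crd \<sigma> v" using reframe_crd[of \<sigma> "fst v" "snd v"] by auto
  qed
qed

end

end

section \<open>Isomorphisms determined by frames\<close>

lemma matrix_from_images:
  assumes "cdet x y \<noteq> 0"
  obtains A :: "complex ^ 2 ^ 2" where "A *v x = x'" "A *v y = y'"
proof
  define d where "d = cdet x y"
  \<comment> \<open>The matrix with columns \<open>x', y'\<close> times the inverse of the one with
    columns \<open>x, y\<close>.\<close>
  let ?A = "\<chi> i j. if j = 1 then (x' $ i * y $ 2 - y' $ i * x $ 2) / d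
                   else (y' $ i * x $ 1 - x' $ i * y $ 1) / d"
  have "(x' $ i * y $ 2 - y' $ i * x $ 2) / d * x $ 1 + (y' $ i * x $ 1 - x' $ i * y $ 1) / d * x $ 2 = x' $ i"
    "(x' $ i * y $ 2 - y' $ i * x $ 2) / d * y $ 1 + (y' $ i * x $ 1 - x' $ i * y $ 1) / d * y $ 2 = y' $ i" for i
  proof -
    have "(x' $ i * y $ 2 - y' $ i * x $ 2) * x $ 1 + (y' $ i * x $ 1 - x' $ i * y $ 1) * x $ 2 = x' $ i * d"
         "(x' $ i * y $ 2 - y' $ i * x $ 2) * y $ 1 + (y' $ i * x $ 1 - x' $ i * y $ 1) * y $ 2 = y' $ i * d"
      by (simp_all add: d_def cdet_def algebra_simps)
    thus "(x' $ i * y $ 2 - y' $ i * x $ 2) / d * x $ 1 + (y' $ i * x $ 1 - x' $ i * y $ 1) / d * x $ 2 = x' $ i"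
      "(x' $ i * y $ 2 - y' $ i * x $ 2) / d * y $ 1 + (y' $ i * x $ 1 - x' $ i * y $ 1) / d * y $ 2 = y' $ i"
      using assms by (simp_all only: times_divide_eq_left add_divide_distrib[symmetric])
        (simp_all add: d_def)
  qed
  thus "?A *v x = x'" "?A *v y = y'"
    by (simp_all add: vec_eq_iff matrix_vector_mult_def sum_2)
qed

text \<open>A column of the matrix in trivialisations is the image of a vector of the frame
  belonging to \<open>g\<close>. Expanding this vector in \<open>c1, c2\<close> gives holomorphic
  coefficients, and the images of \<open>c1, c2\<close> are holomorphic by assumption.\<close>

lemma iso_holo:
  assumes T: "holo_bundle T" and U: "open U"
    and c: "c1 \<in> hol_sections T U" "c2 \<in> hol_sections T U"
    and nz: "\<And>z. z \<in> U \<Longrightarrow> cdet (c1 z) (c2 z) \<noteq> 0"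
    and c': "c1' \<in> hol_sections T' U" "c2' \<in> hol_sections T' U"
    and \<Phi>: "\<And>z. z \<in> U \<Longrightarrow> \<Phi> z *v c1 z = c1' z" "\<And>z. z \<in> U \<Longrightarrow> \<Phi> z *v c2 z = c2' z"
    and V: "(V, g) \<in> trivs T" and W: "(W, h) \<in> trivs T'"
  shows "(\<lambda>z. (h z ** \<Phi> z ** matrix_inv (g z)) $ i $ j) holomorphic_on U \<inter> (V \<inter> W)"
proof -
  have "open V" using T V unfolding holo_bundle_def by blast
  hence o: "open (U \<inter> V)" using U by blast
  let ?e = "\<lambda>z. matrix_inv (g z) *v axis j 1"
  let ?p = "\<lambda>z. cdet (?e z) (c2 z) / cdet (c1 z) (c2 z)"
  let ?q = "\<lambda>z. cdet (c1 z) (?e z) / cdet (c1 z) (c2 z)"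
  have s: "c1 \<in> hol_sections T (U \<inter> V)" "c2 \<in> hol_sections T (U \<inter> V)" "?e \<in> hol_sections T (U \<inter> V)"
    by (rule hs_mono[OF c(1)], blast) (rule hs_mono[OF c(2)], blast, rule hs_mono[OF triv_frame[OF T V]], blast)
  have nz': "cdet (c1 z) (c2 z) \<noteq> 0" if "z \<in> U \<inter> V" for z using nz that by blast
  have pq: "?p holomorphic_on U \<inter> V" "?q holomorphic_on U \<inter> V"
    by (rule hs_coords(1)[OF T o s], rule nz', assumption)
       (rule hs_coords(2)[OF T o s], rule nz', assumption)
  have "(\<lambda>z. ?p z * (h z *v c1' z) $ i + ?q z * (h z *v c2' z) $ i) holomorphic_on U \<inter> (V \<inter> W)"
    by (intro holomorphic_intros holomorphic_on_subset[OF pq(1)] holomorphic_on_subset[OF pq(2)]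
        holomorphic_on_subset[OF hs_triv[OF c'(1) W]] holomorphic_on_subset[OF hs_triv[OF c'(2) W]]) auto
  thus ?thesis
  proof (rule holomorphic_transform)
    fix z assume "z \<in> U \<inter> (V \<inter> W)"
    hence z: "z \<in> U" by blast
    have "(h z ** \<Phi> z ** matrix_inv (g z)) $ i $ j = (h z *v (\<Phi> z *v ?e z)) $ i"
      by (simp add: matrix_vector_mult_axis[symmetric] matrix_vector_mul_assoc matrix_mul_assoc)
    also have "\<Phi> z *v ?e z = ?p z *s c1' z + ?q z *s c2' z"
      by (subst vec_cramer[OF nz[OF z], of "?e z"])
         (simp only: matrix_vector_right_distrib vector_scalar_commute \<Phi>[OF z])
    finally show "?p z * (h z *v c1' z) $ i + ?q z * (h z *v c2' z) $ i =
        (h z ** \<Phi> z ** matrix_inv (g z)) $ i $ j"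
      by (simp add: matrix_vector_right_distrib vector_scalar_commute)
  qed
qed

text \<open>The values of \<open>a\<close> and \<open>b\<close> at 0 are arbitrary, so they are
  replaced by sections across 0. The point is that these are still independent in the fibre over
  0.\<close>

lemma germ_basis_sections:
  assumes T: "holo_bundle T" and basis: "germ_basis T a b"
  obtains A B where "eventually (\<lambda>r. A \<in> hol_sections T (ball 0 r) \<and> B \<in> hol_sections T (ball 0 r) \<and>
     (\<forall>z \<in> ball 0 r. cdet (A z) (B z) \<noteq> 0 \<and> (z \<noteq> 0 \<longrightarrow> A z = a z \<and> B z = b z))) (at_right (0 :: real))"
proof -
  obtain U1 A where A: "open U1" "0 \<in> U1" "A \<in> hol_sections T U1" "eventually (\<lambda>z. a z = A z) (at 0)"
    using germ_basis_mem(1)[OF basis] by (rule germs0E)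
  obtain U2 B where B: "open U2" "0 \<in> U2" "B \<in> hol_sections T U2" "eventually (\<lambda>z. b z = B z) (at 0)"
    using germ_basis_mem(2)[OF basis] by (rule germs0E)
  obtain e1 e2 where e: "e1 \<in> germs0 T" "e2 \<in> germs0 T"
    "eventually (\<lambda>z. cdet (e1 z) (e2 z) \<noteq> 0) (at 0)"
    using germs0_basis[OF T] by blast
  obtain V g where V: "(V, g) \<in> trivs T" "open V" "0 \<in> V" "\<And>w. w \<in> V \<Longrightarrow> invertible (g w)"
    using triv_cover[OF T, of 0] by blast
  define U where "U = U1 \<inter> U2 \<inter> V"
  have U: "open U" "0 \<in> U" using A B V by (auto simp: U_def)
  have AB: "A \<in> hol_sections T U" "B \<in> hol_sections T U"
    by (rule hs_mono[OF A(3)], simp add: U_def le_infI1) (rule hs_mono[OF B(3)], auto simp: U_def)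
  define d where "d = (\<lambda>z. cdet (g z *v A z) (g z *v B z))"
  have "U \<inter> V = U" by (auto simp: U_def)
  hence "d holomorphic_on U"
    using hs_triv[OF AB(1) V(1)] hs_triv[OF AB(2) V(1)] unfolding d_def cdet_def
    by (intro holomorphic_intros) simp_all
  hence dc: "isCont d 0"
    using U holomorphic_on_imp_continuous_on continuous_on_eq_continuous_at by blast
  have d: "d z = det (g z) * cdet (A z) (B z)" for z by (simp add: d_def cdet_mult)
  text \<open>A trivialising frame is expressed in \<open>A\<close> and \<open>B\<close> by analytic coefficients, so its determinant,
    which is 1, would tend to 0 if the determinant of \<open>A\<close> and \<open>B\<close> vanished at 0.\<close>
  have d0: "d 0 \<noteq> 0"
  proof
    assume "d 0 = 0"
    define e where "e j = (\<lambda>z. matrix_inv (g z) *v axis j 1)" for j :: 2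
    have eg: "e j \<in> germs0 T" for j
      by (rule germs0I[OF V(2,3) triv_frame[OF T V(1), of j]]) (simp add: e_def)
    obtain f1 h1 where 1: "f1 analytic_on {0}" "h1 analytic_on {0}"
      "eventually (\<lambda>z. e 1 z = f1 z *s a z + h1 z *s b z) (at 0)"
      using germ_basis_mem(3)[OF basis eg] by (rule germ_combE)
    obtain f2 h2 where 2: "f2 analytic_on {0}" "h2 analytic_on {0}"
      "eventually (\<lambda>z. e 2 z = f2 z *s a z + h2 z *s b z) (at 0)"
      using germ_basis_mem(3)[OF basis eg] by (rule germ_combE)
    have "eventually (\<lambda>z. z \<in> V) (at 0)" using V(2,3) by (rule eventually_at_in_open')
    hence "eventually (\<lambda>z. (f1 z * h2 z - h1 z * f2 z) * d z = 1) (at 0)"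
      using 1(3) 2(3) A(4) B(4)
    proof eventually_elim
      case (elim z)
      have "1 = cdet (g z *v e 1 z) (g z *v e 2 z)"
        using matrix_inv_cancel(1)[OF V(4)[OF elim(1)]] by (simp add: e_def cdet_def axis_def)
      also have "\<dots> = det (g z) * cdet (e 1 z) (e 2 z)" by (rule cdet_mult)
      also have "cdet (e 1 z) (e 2 z) = (f1 z * h2 z - h1 z * f2 z) * cdet (A z) (B z)"
        unfolding elim(2-5) by (simp add: cdet_def algebra_simps)
      finally show ?case by (simp add: d mult_ac)
    qed
    moreover have "((\<lambda>z. (f1 z * h2 z - h1 z * f2 z) * d z) \<longlongrightarrow> (f1 0 * h2 0 - h1 0 * f2 0) * d 0) (at 0)"
    proof -
      have cont: "(f \<longlongrightarrow> f 0) (at 0)" if "f analytic_on {0}" for f :: "complex \<Rightarrow> complex"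
        using analytic_at_imp_isCont[OF that] by (simp add: isCont_def)
      have "(d \<longlongrightarrow> d 0) (at 0)" using dc by (simp add: isCont_def)
      thus ?thesis by (intro tendsto_intros cont[OF 1(1)] cont[OF 1(2)] cont[OF 2(1)] cont[OF 2(2)])
    qed
    ultimately have "((\<lambda>z :: complex. 1) \<longlongrightarrow> (f1 0 * h2 0 - h1 0 * f2 0) * d 0) (at 0)"
      by (rule Lim_transform_eventually[rotated])
    hence "(f1 0 * h2 0 - h1 0 * f2 0) * d 0 = 1"
      by (intro tendsto_unique[OF _ _ tendsto_const]) auto
    thus False using \<open>d 0 = 0\<close> by simp
  qed
  have "eventually (\<lambda>z. d z \<noteq> 0) (at 0)"
    using dc d0 unfolding isCont_def by (rule tendsto_imp_eventually_ne)
  hence ev: "eventually (\<lambda>z. d z \<noteq> 0 \<and> a z = A z \<and> b z = B z) (at 0)"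
    using A(4) B(4) by eventually_elim simp
  obtain r0 where r0: "r0 > 0" "ball 0 r0 \<subseteq> U" using U openE by blast
  have ev2: "eventually (\<lambda>r :: real. r \<in> {0<..<r0}) (at_right 0)" by (rule eventually_at_right_real[OF r0(1)])
  have "eventually (\<lambda>r. A \<in> hol_sections T (ball 0 r) \<and> B \<in> hol_sections T (ball 0 r) \<and>
     (\<forall>z \<in> ball 0 r. cdet (A z) (B z) \<noteq> 0 \<and> (z \<noteq> 0 \<longrightarrow> A z = a z \<and> B z = b z))) (at_right 0)"
    using ev[unfolded eventually_at0_ball] ev2
  proof eventually_elim
    case (elim r)
    have sub: "ball 0 r \<subseteq> U" using elim(2) r0(2) by (meson greaterThanLessThan_iff less_eq_real_def order_trans subset_ball)
    have "cdet (A z) (B z) \<noteq> 0 \<and> (z \<noteq> 0 \<longrightarrow> A z = a z \<and> B z = b z)" if z: "z \<in> ball 0 r" for z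
    proof (cases "z = 0")
      case True
      thus ?thesis using d0 by (simp add: d)
    next
      case False
      hence "z \<in> ball 0 r - {0}" using z by blast
      from bspec[OF elim(1) this] show ?thesis by (simp add: d)
    qed
    thus ?case using hs_mono[OF AB(1) sub] hs_mono[OF AB(2) sub] by blast
  qed
  thus ?thesis by (rule that)
qed

text \<open>The map sending \<open>s1, s2\<close> to \<open>s1', s2'\<close> respects the
  connections away from 0, as both frames satisfy the same equations. It extends across 0 because
  the same combinations, with the same \<open>t\<close>, form holomorphic frames of both bundles
  near 0.\<close>

lemma frame_iso:
  assumes f: "mero_frame T s1 s2 \<alpha>1 \<alpha>2 \<kappa> k" "mero_frame T' s1' s2' \<alpha>1 \<alpha>2 \<kappa> k"
    and Lat: "te_frame.Lat T s1 s2 = lat (1, fls_const t) (0, fls_X)"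
      "te_frame.Lat T' s1' s2' = lat (1, fls_const t) (0, fls_X)"
  shows "te_isomorphic T T'"
proof -
  interpret f: mero_frame T s1 s2 \<alpha>1 \<alpha>2 \<kappa> k by fact
  interpret f': mero_frame T' s1' s2' \<alpha>1 \<alpha>2 \<kappa> k by fact
  let ?a = "\<lambda>z. s1 z + t *s s2 z" and ?b = "\<lambda>z. z *s s2 z"
  let ?a' = "\<lambda>z. s1' z + t *s s2' z" and ?b' = "\<lambda>z. z *s s2' z"
  have "f.crd ?a (1, fls_const t)" "f.crd ?b (0, fls_X)"
    by (rule f.crdI[of "\<lambda>_. 1" _ "\<lambda>_. t"], simp_all)
       (rule f.crdI[of "\<lambda>_. 0" _ "\<lambda>z. z"], simp_all add: has_laurent_expansion_fps_X)
  hence "germ_basis T ?a ?b" using f.germ_basis_iff Lat(1) by blast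
  then obtain A B where AB: "eventually (\<lambda>r. A \<in> hol_sections T (ball 0 r) \<and> B \<in> hol_sections T (ball 0 r) \<and>
     (\<forall>z \<in> ball 0 r. cdet (A z) (B z) \<noteq> 0 \<and> (z \<noteq> 0 \<longrightarrow> A z = ?a z \<and> B z = ?b z))) (at_right 0)"
    by (rule germ_basis_sections[OF f.holo_bundle])
  have "f'.crd ?a' (1, fls_const t)" "f'.crd ?b' (0, fls_X)"
    by (rule f'.crdI[of "\<lambda>_. 1" _ "\<lambda>_. t"], simp_all)
       (rule f'.crdI[of "\<lambda>_. 0" _ "\<lambda>z. z"], simp_all add: has_laurent_expansion_fps_X)
  hence "germ_basis T' ?a' ?b'" using f'.germ_basis_iff Lat(2) by blast
  then obtain A' B' where AB': "eventually (\<lambda>r. A' \<in> hol_sections T' (ball 0 r) \<and> B' \<in> hol_sections T' (ball 0 r) \<and>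
     (\<forall>z \<in> ball 0 r. cdet (A' z) (B' z) \<noteq> 0 \<and> (z \<noteq> 0 \<longrightarrow> A' z = ?a' z \<and> B' z = ?b' z))) (at_right 0)"
    by (rule germ_basis_sections[OF f'.holo_bundle])
  have "eventually (\<lambda>r :: real. r > 0) (at_right 0)" by (rule eventually_at_right_less)
  with AB AB' have ex: "\<exists>r > 0. (A \<in> hol_sections T (ball 0 r) \<and> B \<in> hol_sections T (ball 0 r) \<and>
     (\<forall>z \<in> ball 0 r. cdet (A z) (B z) \<noteq> 0 \<and> (z \<noteq> 0 \<longrightarrow> A z = ?a z \<and> B z = ?b z))) \<and>
     (A' \<in> hol_sections T' (ball 0 r) \<and> B' \<in> hol_sections T' (ball 0 r) \<and>
     (\<forall>z \<in> ball 0 r. cdet (A' z) (B' z) \<noteq> 0 \<and> (z \<noteq> 0 \<longrightarrow> A' z = ?a' z \<and> B' z = ?b' z)))"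
    using eventually_happens'[OF trivial_limit_at_right_real eventually_conj[OF _ eventually_conj[OF AB AB']]]
    by blast
  then obtain r where r: "r > 0"
    and hs: "A \<in> hol_sections T (ball 0 r)" "B \<in> hol_sections T (ball 0 r)"
      "A' \<in> hol_sections T' (ball 0 r)" "B' \<in> hol_sections T' (ball 0 r)"
    and nz: "\<And>z. z \<in> ball 0 r \<Longrightarrow> cdet (A z) (B z) \<noteq> 0" "\<And>z. z \<in> ball 0 r \<Longrightarrow> cdet (A' z) (B' z) \<noteq> 0"
    and eq: "\<And>z. z \<in> ball 0 r \<Longrightarrow> z \<noteq> 0 \<Longrightarrow> A z = ?a z" "\<And>z. z \<in> ball 0 r \<Longrightarrow> z \<noteq> 0 \<Longrightarrow> B z = ?b z"
      "\<And>z. z \<in> ball 0 r \<Longrightarrow> z \<noteq> 0 \<Longrightarrow> A' z = ?a' z" "\<And>z. z \<in> ball 0 r \<Longrightarrow> z \<noteq> 0 \<Longrightarrow> B' z = ?b' z"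
    by blast
  \<comment> \<open>In the fibre over 0 the elementary sections carry no information; the map is
    fixed there by the values of the extended frames \<open>A, B\<close> and
    \<open>A', B'\<close>.\<close>
  define x where "x z = (if z = 0 then A 0 else s1 z)" for z
  define y where "y z = (if z = 0 then B 0 else s2 z)" for z
  define x' where "x' z = (if z = 0 then A' 0 else s1' z)" for z
  define y' where "y' z = (if z = 0 then B' 0 else s2' z)" for z
  have xy: "cdet (x z) (y z) \<noteq> 0" "cdet (x' z) (y' z) \<noteq> 0" for z
    using nz[of 0] f.indep[of z] f'.indep[of z] r by (auto simp: x_def y_def x'_def y'_def)
  have "\<forall>z. \<exists>M. M *v x z = x' z \<and> M *v y z = y' z"
    using matrix_from_images[OF xy(1)] by metis
  then obtain \<Phi> where \<Phi>: "\<And>z. \<Phi> z *v x z = x' z" "\<And>z. \<Phi> z *v y z = y' z" by metis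
  have inv: "invertible (\<Phi> z)" for z
    using cdet_mult[of "\<Phi> z" "x z" "y z"] xy[of z] unfolding \<Phi> invertible_det_nz by auto
  have \<Phi>s: "\<Phi> z *v s1 z = s1' z" "\<Phi> z *v s2 z = s2' z" if "z \<noteq> 0" for z
    using \<Phi>[of z] that by (simp_all add: x_def y_def x'_def y'_def)
  have \<Phi>A: "\<Phi> z *v A z = A' z" if z: "z \<in> ball 0 r" for z
  proof (cases "z = 0")
    case True
    thus ?thesis using \<Phi>(1)[of 0] by (simp add: x_def x'_def)
  next
    case False
    show ?thesis unfolding eq(1,3)[OF z False]
      by (simp only: matrix_vector_right_distrib vector_scalar_commute \<Phi>s[OF False])
  qed
  have \<Phi>B: "\<Phi> z *v B z = B' z" if z: "z \<in> ball 0 r" for z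
  proof (cases "z = 0")
    case True
    thus ?thesis using \<Phi>(2)[of 0] by (simp add: y_def y'_def)
  next
    case False
    show ?thesis unfolding eq(2,4)[OF z False]
      by (simp only: vector_scalar_commute \<Phi>s[OF False])
  qed
  have holo: "(\<lambda>z. (h z ** \<Phi> z ** matrix_inv (g z)) $ i $ j) holomorphic_on (V \<inter> W)"
    if V: "(V, g) \<in> trivs T" and W: "(W, h) \<in> trivs T'" for V g W h i j
  proof -
    have VW: "open V" "open W"
      using f.holo_bundle V f'.holo_bundle W unfolding holo_bundle_def by blast+
    have o: "open (- {0 :: complex})" by auto
    have 1: "(\<lambda>z. (h z ** \<Phi> z ** matrix_inv (g z)) $ i $ j) holomorphic_on - {0} \<inter> (V \<inter> W)"
      by (rule iso_holo[OF f.holo_bundle o f.s1(1) f.s2(1) _ f'.s1(1) f'.s2(1) _ _ V W])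
         (auto simp: \<Phi>s f.indep)
    have 2: "(\<lambda>z. (h z ** \<Phi> z ** matrix_inv (g z)) $ i $ j) holomorphic_on ball 0 r \<inter> (V \<inter> W)"
      by (rule iso_holo[OF f.holo_bundle open_ball hs(1,2) nz(1) hs(3,4) \<Phi>A \<Phi>B V W])
    have "V \<inter> W = (- {0} \<inter> (V \<inter> W)) \<union> (ball 0 r \<inter> (V \<inter> W))" using r by auto
    moreover have "(\<lambda>z. (h z ** \<Phi> z ** matrix_inv (g z)) $ i $ j) holomorphic_on
        (- {0} \<inter> (V \<inter> W)) \<union> (ball 0 r \<inter> (V \<inter> W))"
      by (rule holomorphic_on_Un[OF 1 2]) (use VW in auto)
    ultimately show ?thesis by simp
  qed
  have conn: "nabla T' (\<lambda>w. \<Phi> w *v \<sigma> w) z = \<Phi> z *v nabla T \<sigma> z"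
    if U: "open U" "0 \<notin> U" and \<sigma>: "\<sigma> \<in> hol_sections T U" and z: "z \<in> U" for U \<sigma> z
  proof -
    obtain p q where pq: "p holomorphic_on U" "q holomorphic_on U"
      "\<And>z. z \<in> U \<Longrightarrow> \<sigma> z = p z *s s1 z + q z *s s2 z"
      using f.coords[OF U \<sigma>] that by blast
    have nz0: "w \<noteq> 0" if "w \<in> U" for w using that U by auto
    have eq': "\<Phi> w *v \<sigma> w = p w *s s1' w + q w *s s2' w" if "w \<in> U" for w
      unfolding pq(3)[OF that]
      by (simp only: matrix_vector_right_distrib vector_scalar_commute \<Phi>s[OF nz0[OF that]])
    have "z *s nabla T' (\<lambda>w. \<Phi> w *v \<sigma> w) z = (z * deriv p z + \<alpha>1 * p z) *s s1' z +
        (z * deriv q z + \<kappa> * z ^ k * p z + \<alpha>2 * q z) *s s2' z"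
      by (rule f'.nabla_coords(2)[OF U pq(1,2) eq' z])
    also have "\<dots> = \<Phi> z *v ((z * deriv p z + \<alpha>1 * p z) *s s1 z +
        (z * deriv q z + \<kappa> * z ^ k * p z + \<alpha>2 * q z) *s s2 z)"
      by (simp only: matrix_vector_right_distrib vector_scalar_commute \<Phi>s[OF nz0[OF z]])
    also have "(z * deriv p z + \<alpha>1 * p z) *s s1 z +
        (z * deriv q z + \<kappa> * z ^ k * p z + \<alpha>2 * q z) *s s2 z = z *s nabla T \<sigma> z"
      by (rule f.nabla_coords(2)[OF U pq z, symmetric])
    finally show ?thesis using nz0[OF z] by (simp add: vector_scalar_commute)
  qed
  show ?thesis
    unfolding te_isomorphic_def using inv holo conn by (intro exI[of _ \<Phi>]) blast
qed

section \<open>Flat multivalued sections\<close>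

text \<open>Differentiating a combination of \<open>y1\<close> and \<open>y2\<close> with
  holomorphic coefficients gives a combination of the same kind. So all derivatives vanish at
  \<open>z0\<close>, and the identity theorem applies.\<close>

lemma linear_ode_zero:
  assumes D: "open D" "connected D" "z0 \<in> D"
    and y: "y1 holomorphic_on D" "y2 holomorphic_on D" "y1 z0 = 0" "y2 z0 = 0"
    and coef: "a holomorphic_on D" "b holomorphic_on D" "c holomorphic_on D" "d holomorphic_on D"
    and ode: "\<And>z. z \<in> D \<Longrightarrow> deriv y1 z = a z * y1 z + b z * y2 z"
      "\<And>z. z \<in> D \<Longrightarrow> deriv y2 z = c z * y1 z + d z * y2 z"
    and z: "z \<in> D"
  shows "y1 z = 0" "y2 z = 0"
proof -
  have der: "(deriv ^^ n) (\<lambda>z. u z * y1 z + v z * y2 z) z0 = 0"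
    if "u holomorphic_on D" "v holomorphic_on D" for n u v
    using that
  proof (induction n arbitrary: u v)
    case 0
    thus ?case by (simp add: y)
  next
    case (Suc n)
    \<comment> \<open>The new coefficients after the derivatives of \<open>y1\<close> and
      \<open>y2\<close> have been replaced by means of the system.\<close>
    let ?u = "\<lambda>z. deriv u z + u z * a z + v z * c z" and ?v = "\<lambda>z. deriv v z + u z * b z + v z * d z"
    have h: "deriv u holomorphic_on D" "deriv v holomorphic_on D"
      using Suc.prems D(1) by (auto intro: holomorphic_deriv)
    have uv: "?u holomorphic_on D" "?v holomorphic_on D"
      by (intro holomorphic_intros h Suc.prems coef)+
    have eq: "deriv (\<lambda>z. u z * y1 z + v z * y2 z) w = ?u w * y1 w + ?v w * y2 w" if w: "w \<in> D" for w
    proof -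
      have "((\<lambda>z. u z * y1 z + v z * y2 z) has_field_derivative
          (u w * deriv y1 w + deriv u w * y1 w) + (v w * deriv y2 w + deriv v w * y2 w)) (at w)"
        by (intro DERIV_add DERIV_mult' holomorphic_derivI[OF Suc.prems(1) D(1) w]
            holomorphic_derivI[OF Suc.prems(2) D(1) w] holomorphic_derivI[OF y(1) D(1) w]
            holomorphic_derivI[OF y(2) D(1) w])
      thus ?thesis by (simp add: DERIV_imp_deriv ode[OF w] algebra_simps)
    qed
    have "(deriv ^^ Suc n) (\<lambda>z. u z * y1 z + v z * y2 z) z0 =
          (deriv ^^ n) (deriv (\<lambda>z. u z * y1 z + v z * y2 z)) z0"
      by (simp only: funpow_Suc_right o_apply)
    also have "\<dots> = (deriv ^^ n) (\<lambda>z. ?u z * y1 z + ?v z * y2 z) z0"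
    proof (rule higher_deriv_transform_within_open[OF _ _ D(1,3) eq])
      show "deriv (\<lambda>z. u z * y1 z + v z * y2 z) holomorphic_on D"
        by (intro holomorphic_deriv holomorphic_intros Suc.prems y D(1))
      show "(\<lambda>z. ?u z * y1 z + ?v z * y2 z) holomorphic_on D"
        by (intro holomorphic_intros h Suc.prems coef y)
    qed
    also have "\<dots> = 0" by (rule Suc.IH[OF uv])
    finally show ?case .
  qed
  have "(deriv ^^ n) y1 z0 = 0" "(deriv ^^ n) y2 z0 = 0" for n
    using der[OF holomorphic_on_const[of 1] holomorphic_on_const[of 0], of n]
      der[OF holomorphic_on_const[of 0] holomorphic_on_const[of 1], of n] by simp_all
  thus "y1 z = 0" "y2 z = 0"
    using holomorphic_fun_eq_0_on_connected[OF y(1) D(1,2) _ D(3) z]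
      holomorphic_fun_eq_0_on_connected[OF y(2) D(1,2) _ D(3) z] by blast+
qed

text \<open>In the frame of a trivialisation flatness is a linear system; its matrix
  \<open>A\<close> consists of the negated components of the derivatives of the frame.\<close>

lemma flat_zero_local:
  assumes T: "holo_bundle T" "holo_connection T" and V: "(V, g) \<in> trivs T"
    and D: "open D" "connected D" "0 \<notin> D" "D \<subseteq> V" "z0 \<in> D"
    and \<sigma>: "\<sigma> \<in> hol_sections T D" "\<And>z. z \<in> D \<Longrightarrow> nabla T \<sigma> z = 0" "\<sigma> z0 = 0"
    and z: "z \<in> D"
  shows "\<sigma> z = 0"
proof -
  define e where "e j = (\<lambda>z. matrix_inv (g z) *v axis j 1)" for j :: 2
  have inv: "invertible (g z)" if "z \<in> D" for z
    using det_triv[OF T(1) V, of z] D(4) that by (auto simp: invertible_det_nz)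
  have e: "e j \<in> hol_sections T D" for j
    unfolding e_def by (rule hs_mono[OF triv_frame[OF T(1) V] D(4)])
  define y where "y j = (\<lambda>z. (g z *v \<sigma> z) $ j)" for j
  define A where "A i j = (\<lambda>z. - (g z *v nabla T (e j) z) $ i)" for i j
  have DV: "D \<inter> V = D" using D(4) by blast
  have y: "y j holomorphic_on D" for j
    using hs_triv[OF \<sigma>(1) V, of j] unfolding DV y_def .
  have A: "A i j holomorphic_on D" for i j
    using hs_triv[OF nabla_hs[OF T(2) D(1,3) e[of j]] V, of i]
    unfolding DV A_def by (rule holomorphic_on_minus)
  have ge: "g w *v e j w = axis j 1" if "w \<in> D" for w j
    unfolding e_def by (rule matrix_inv_cancel(1)[OF inv[OF that]])
  have \<sigma>_eq: "\<sigma> w = y 1 w *s e 1 w + y 2 w *s e 2 w" if w: "w \<in> D" for w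
  proof -
    have "g w *v (y 1 w *s e 1 w + y 2 w *s e 2 w) = y 1 w *s axis 1 1 + y 2 w *s axis 2 1"
      by (simp only: matrix_vector_right_distrib vector_scalar_commute ge[OF w])
    also have "\<dots> = g w *v \<sigma> w" by (simp add: vec_eq_iff forall_2 axis_def y_def)
    finally show ?thesis by (metis matrix_inv_cancel(2)[OF inv[OF w]])
  qed
  have ode: "deriv (y i) w = A i 1 w * y 1 w + A i 2 w * y 2 w" if w: "w \<in> D" for w i
  proof -
    have "0 = nabla T \<sigma> w" using \<sigma>(2)[OF w] by simp
    also have "\<dots> = nabla T (\<lambda>w. y 1 w *s e 1 w + y 2 w *s e 2 w) w"
      by (rule nabla_cong[OF T(2) D(1,3) \<sigma>(1) \<sigma>_eq w])
    also have "\<dots> = deriv (y 1) w *s e 1 w + y 1 w *s nabla T (e 1) w +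
        (deriv (y 2) w *s e 2 w + y 2 w *s nabla T (e 2) w)"
      by (rule nabla_comb[OF T(2) D(1,3) e e y y w])
    finally have "g w *v 0 = g w *v (deriv (y 1) w *s e 1 w + y 1 w *s nabla T (e 1) w +
        (deriv (y 2) w *s e 2 w + y 2 w *s nabla T (e 2) w))" by simp
    hence "0 = deriv (y 1) w *s axis 1 1 + y 1 w *s (g w *v nabla T (e 1) w) +
        (deriv (y 2) w *s axis 2 1 + y 2 w *s (g w *v nabla T (e 2) w))"
      by (simp only: matrix_vector_right_distrib vector_scalar_commute ge[OF w] matrix_vector_mult_0_right)
    hence "0 = (deriv (y 1) w *s axis 1 1 + y 1 w *s (g w *v nabla T (e 1) w) +
        (deriv (y 2) w *s axis 2 1 + y 2 w *s (g w *v nabla T (e 2) w))) $ i" by simp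
    hence "0 = deriv (y i) w - A i 1 w * y 1 w - A i 2 w * y 2 w"
      using exhaust_2[of i] by (auto simp: axis_def A_def algebra_simps)
    thus ?thesis by (simp add: algebra_simps)
  qed
  have "y 1 z = 0" "y 2 z = 0"
    using linear_ode_zero[OF D(1,2,5) y[of 1] y[of 2] _ _ A[of 1 1] A[of 1 2] A[of 2 1] A[of 2 2] ode ode z] \<sigma>(3)
    by (simp_all add: y_def)
  thus ?thesis using \<sigma>_eq[OF z] by simp
qed

section \<open>Branches of the logarithm and monodromy of flat sections\<close>

lemma exp_branch:
  fixes W :: "complex set"
  assumes "open W" "inj_on exp W"
  shows "open (exp ` W)" "0 \<notin> exp ` W" "inv_into W exp holomorphic_on exp ` W"
    "\<And>z. z \<in> exp ` W \<Longrightarrow> deriv (inv_into W exp) z = 1 / z"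
proof -
  have h: "exp holomorphic_on W" by (intro holomorphic_intros)
  show op: "open (exp ` W)" by (rule open_mapping_thm3[OF h assms])
  show "0 \<notin> exp ` W" by auto
  obtain l where l: "l holomorphic_on exp ` W" "\<And>w. w \<in> W \<Longrightarrow> deriv exp w * deriv l (exp w) = 1"
    "\<And>w. w \<in> W \<Longrightarrow> l (exp w) = w"
    using holomorphic_has_inverse[OF h assms] by blast
  have eq: "l z = inv_into W exp z" if "z \<in> exp ` W" for z
    using that l(3) inv_into_f_f[OF assms(2)] by force
  show "inv_into W exp holomorphic_on exp ` W"
    by (rule holomorphic_transform[OF l(1) eq])
  show "deriv (inv_into W exp) z = 1 / z" if z: "z \<in> exp ` W" for z
  proof -
    have "deriv (inv_into W exp) z = deriv l z"
      by (rule complex_derivative_transform_within_open[OF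
            \<open>inv_into W exp holomorphic_on exp ` W\<close> l(1) op z])
         (simp add: eq)
    moreover obtain w where "w \<in> W" "z = exp w" using z by blast
    ultimately show ?thesis using l(2)[of w] DERIV_imp_deriv[OF DERIV_exp, of w] by (simp add: field_simps)
  qed
qed

lemma H_infty_branch:
  assumes "\<sigma> \<in> H_infty T" "open W" "inj_on exp W"
  shows "(\<lambda>z. \<sigma> (inv_into W exp z)) \<in> hol_sections T (exp ` W)"
    "\<And>z. z \<in> exp ` W \<Longrightarrow> nabla T (\<lambda>z. \<sigma> (inv_into W exp z)) z = 0"
  using assms unfolding H_infty_def Let_def by blast+

lemma inj_exp_ball: "r \<le> pi \<Longrightarrow> inj_on exp (ball (\<zeta> :: complex) r)"
  by (rule inj_on_subset[OF inj_on_exp_pi[of \<zeta>] subset_ball])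

text \<open>On small balls a flat section vanishes everywhere or nowhere, so its zero set is open
  and closed. Linearly independent flat sections are therefore independent at every point.\<close>

lemma flat_zero:
  assumes T: "holo_bundle T" "holo_connection T" and \<sigma>: "\<sigma> \<in> H_infty T" and z: "\<sigma> \<zeta>0 = 0"
  shows "\<sigma> = 0"
proof -
  have loc: "\<exists>r > 0. (\<exists>w \<in> ball \<zeta> r. \<sigma> w = 0) \<longrightarrow> (\<forall>w \<in> ball \<zeta> r. \<sigma> w = 0)" for \<zeta>
  proof -
    obtain V g where V: "(V, g) \<in> trivs T" "open V" "exp \<zeta> \<in> V"
      using triv_cover[OF T(1), of "exp \<zeta>"] by blast
    have "open (exp -` V)" by (intro open_vimage V(2) continuous_on_exp continuous_on_id)
    then obtain r0 where r0: "r0 > 0" "ball \<zeta> r0 \<subseteq> exp -` V" using V(3) openE by blast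
    \<comment> \<open>A radius of at most 1 is below \<open>pi\<close> and keeps \<open>exp\<close>
      injective on the ball.\<close>
    define r where "r = min r0 1"
    let ?W = "ball \<zeta> r"
    have r: "r > 0" "exp ` ?W \<subseteq> V" using r0 by (auto simp: r_def)
    have inj: "inj_on exp ?W" by (rule inj_exp_ball) (use pi_ge_two in \<open>simp add: r_def\<close>)
    note br = exp_branch[OF open_ball inj] H_infty_branch[OF \<sigma> open_ball inj]
    have con: "connected (exp ` ?W)" by (intro connected_continuous_image continuous_intros connected_ball)
    have "\<sigma> w = 0" if w0: "w0 \<in> ?W" "\<sigma> w0 = 0" and w: "w \<in> ?W" for w0 w
    proof -
      have "(\<lambda>z. \<sigma> (inv_into ?W exp z)) (exp w) = 0"
      proof (rule flat_zero_local[OF T V(1) br(1) con br(2) r(2) _ br(5,6)])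
        show "exp w0 \<in> exp ` ?W" "exp w \<in> exp ` ?W" using w0 w by auto
        show "\<sigma> (inv_into ?W exp (exp w0)) = 0" using inv_into_f_f[OF inj w0(1)] w0(2) by simp
      qed
      thus ?thesis using inv_into_f_f[OF inj w] by simp
    qed
    thus ?thesis using r(1) by blast
  qed
  define Z where "Z = {\<zeta>. \<sigma> \<zeta> = 0}"
  have "open Z" unfolding open_contains_ball
  proof
    fix \<zeta> assume "\<zeta> \<in> Z"
    obtain r where r: "r > 0" "(\<exists>w \<in> ball \<zeta> r. \<sigma> w = 0) \<longrightarrow> (\<forall>w \<in> ball \<zeta> r. \<sigma> w = 0)" using loc by blast
    hence "ball \<zeta> r \<subseteq> Z" using \<open>\<zeta> \<in> Z\<close> centre_in_ball[of \<zeta> r] by (auto simp: Z_def simp del: centre_in_ball)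
    thus "\<exists>e>0. ball \<zeta> e \<subseteq> Z" using r(1) by blast
  qed
  moreover have "open (- Z)" unfolding open_contains_ball
  proof
    fix \<zeta> assume "\<zeta> \<in> - Z"
    obtain r where r: "r > 0" "(\<exists>w \<in> ball \<zeta> r. \<sigma> w = 0) \<longrightarrow> (\<forall>w \<in> ball \<zeta> r. \<sigma> w = 0)" using loc by blast
    hence "ball \<zeta> r \<subseteq> - Z" using \<open>\<zeta> \<in> - Z\<close> centre_in_ball[of \<zeta> r] by (auto simp: Z_def simp del: centre_in_ball)
    thus "\<exists>e>0. ball \<zeta> e \<subseteq> - Z" using r(1) by blast
  qed
  hence "closed Z" by (simp add: closed_def)
  ultimately have "Z = {} \<or> Z = UNIV" using clopen by blast
  hence "Z = UNIV" using z by (auto simp: Z_def)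
  thus ?thesis by (auto simp: Z_def fun_eq_iff)
qed

text \<open>A branch of \<open>M_mon \<sigma>\<close> over \<open>W\<close> is a branch of
  \<open>\<sigma>\<close> over the translate of \<open>W\<close> by the period, which has the same
  image under \<open>exp\<close>.\<close>

lemma M_mon_H_infty:
  assumes T: "holo_connection T" and \<sigma>: "\<sigma> \<in> H_infty T"
  shows "M_mon \<sigma> \<in> H_infty T"
  unfolding H_infty_def Let_def
proof (intro CollectI allI impI, elim conjE)
  fix W :: "complex set" assume W: "open W" "inj_on exp W"
  define c where "c = 2 * of_real pi * \<i>"
  have ec: "exp (w + c) = exp w" for w by (simp add: c_def exp_add)
  let ?W = "(\<lambda>w. w + c) ` W"
  have W': "open ?W" "inj_on exp ?W" "exp ` ?W = exp ` W"
  proof -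
    show "open ?W" using open_translation[OF W(1), of c] by (simp add: add.commute)
    show "inj_on exp ?W" using W(2) by (auto simp: inj_on_def ec)
    show "exp ` ?W = exp ` W" by (simp add: image_image ec)
  qed
  have eq: "\<sigma> (inv_into ?W exp z) = M_mon \<sigma> (inv_into W exp z)" if zW: "z \<in> exp ` W" for z
  proof -
    obtain w where w: "w \<in> W" "z = exp w" using zW by blast
    have "inv_into ?W exp (exp (w + c)) = w + c" using w by (intro inv_into_f_f[OF W'(2)]) blast
    thus ?thesis using inv_into_f_f[OF W(2) w(1)]
      unfolding w(2) M_mon_def c_def[symmetric] by (simp add: ec)
  qed
  note br = exp_branch[OF W] H_infty_branch[OF \<sigma> W'(1,2), unfolded W'(3)]
  show "(\<lambda>z. M_mon \<sigma> (inv_into W exp z)) \<in> hol_sections T (exp ` W) \<and>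
      (\<forall>z\<in>exp ` W. nabla T (\<lambda>z. M_mon \<sigma> (inv_into W exp z)) z = 0)"
  proof
    show "(\<lambda>z. M_mon \<sigma> (inv_into W exp z)) \<in> hol_sections T (exp ` W)"
      by (rule hs_cong[OF br(5) eq])
    show "\<forall>z\<in>exp ` W. nabla T (\<lambda>z. M_mon \<sigma> (inv_into W exp z)) z = 0"
      using nabla_cong[OF T br(1,2,5) eq] br(6) by simp
  qed
qed

text \<open>A combination of flat sections that is periodic in \<open>\<zeta>\<close> defines a
  section on the punctured plane, and since \<open>b1\<close> and \<open>b2\<close> are flat, only
  the coefficients are differentiated. Although \<open>e\<close> is written with \<open>Ln\<close>,
  periodicity allows any branch, which gives holomorphy across the cut.\<close>

lemma descend:
  assumes T: "holo_bundle T" "holo_connection T"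
    and b: "b1 \<in> H_infty T" "b2 \<in> H_infty T"
    and pq: "\<And>\<zeta>. (p has_field_derivative p' \<zeta>) (at \<zeta>)" "\<And>\<zeta>. (q has_field_derivative q' \<zeta>) (at \<zeta>)"
    and m: "m = (\<lambda>\<zeta>. p \<zeta> *s b1 \<zeta> + q \<zeta> *s b2 \<zeta>)"
    and per: "\<And>\<zeta>. m (\<zeta> + 2 * of_real pi * \<i>) = m \<zeta>"
    and e: "e = (\<lambda>z. if z = 0 then 0 else m (Ln z))"
  shows "e \<in> hol_sections T (- {0})" "e (exp \<zeta>) = m \<zeta>"
    "exp \<zeta> *s nabla T e (exp \<zeta>) = p' \<zeta> *s b1 \<zeta> + q' \<zeta> *s b2 \<zeta>"
proof -
  have per_nat: "m (\<zeta> + of_nat n * (2 * of_real pi * \<i>)) = m \<zeta>" for \<zeta> n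
  proof (induction n)
    case (Suc n)
    have "\<zeta> + of_nat (Suc n) * (2 * of_real pi * \<i>) =
        (\<zeta> + of_nat n * (2 * of_real pi * \<i>)) + 2 * of_real pi * \<i>" by (simp add: algebra_simps)
    thus ?case using per Suc by metis
  qed simp
  have per_int: "m (\<zeta> + of_int n * (2 * of_real pi * \<i>)) = m \<zeta>" for \<zeta> n
  proof (cases "n \<ge> 0")
    case True
    thus ?thesis using per_nat[of \<zeta> "nat n"] by simp
  next
    case False
    thus ?thesis using per_nat[of "\<zeta> + of_int n * (2 * of_real pi * \<i>)" "nat (- n)"] by simp
  qed
  have m_exp: "m w = m \<zeta>" if "exp w = exp \<zeta>" for w \<zeta>
  proof -
    obtain n :: int where "w = \<zeta> + (of_int (2 * n) * pi) * \<i>" using \<open>exp w = exp \<zeta>\<close> exp_eq by blast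
    hence "w = \<zeta> + of_int n * (2 * of_real pi * \<i>)" by simp
    thus ?thesis using per_int by simp
  qed
  show e_exp: "e (exp \<zeta>) = m \<zeta>" for \<zeta>
    unfolding e using m_exp[of "Ln (exp \<zeta>)" \<zeta>] by simp
  have loc: "e \<in> hol_sections T (exp ` ball \<zeta> 1) \<and>
     exp \<zeta> *s nabla T e (exp \<zeta>) = p' \<zeta> *s b1 \<zeta> + q' \<zeta> *s b2 \<zeta>" for \<zeta>
  proof -
    let ?W = "ball \<zeta> (1 :: real)" and ?L = "inv_into (ball \<zeta> 1) exp"
    have inj: "inj_on exp ?W" by (rule inj_exp_ball) (use pi_ge_two in simp)
    note br = exp_branch[OF open_ball inj]
    note br1 = H_infty_branch[OF b(1) open_ball inj] and br2 = H_infty_branch[OF b(2) open_ball inj]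
    let ?f = "\<lambda>z. p (?L z)" and ?h = "\<lambda>z. q (?L z)"
    have z: "exp \<zeta> \<in> exp ` ?W" and L: "?L (exp \<zeta>) = \<zeta>" using inv_into_f_f[OF inj] by auto
    have holo: "(\<lambda>z. r (?L z)) holomorphic_on exp ` ?W"
      if "\<And>\<zeta>. (r has_field_derivative r' \<zeta>) (at \<zeta>)" for r r'
    proof -
      have "r holomorphic_on UNIV"
        unfolding holomorphic_on_open[OF open_UNIV] using that by blast
      from holomorphic_on_compose_gen[OF br(3) this] show ?thesis by (simp add: o_def)
    qed
    have der: "deriv (\<lambda>z. r (?L z)) (exp \<zeta>) = r' \<zeta> / exp \<zeta>"
      if "\<And>\<zeta>. (r has_field_derivative r' \<zeta>) (at \<zeta>)" for r r'
    proof -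
      have "(?L has_field_derivative 1 / exp \<zeta>) (at (exp \<zeta>))"
        using holomorphic_derivI[OF br(3,1) z] br(4)[OF z] by simp
      from DERIV_chain2[OF that this] show ?thesis by (simp add: DERIV_imp_deriv L)
    qed
    have eq: "?f z *s b1 (?L z) + ?h z *s b2 (?L z) = e z" if zW: "z \<in> exp ` ?W" for z
    proof -
      obtain w where w: "w \<in> ?W" "z = exp w" using zW by blast
      show ?thesis unfolding w(2) inv_into_f_f[OF inj w(1)] e_exp m ..
    qed
    have hs: "(\<lambda>z. ?f z *s b1 (?L z) + ?h z *s b2 (?L z)) \<in> hol_sections T (exp ` ?W)"
      by (rule hs_comb[OF br1(1) br2(1) holo[OF pq(1)] holo[OF pq(2)]])
    have "nabla T e (exp \<zeta>) = nabla T (\<lambda>z. ?f z *s b1 (?L z) + ?h z *s b2 (?L z)) (exp \<zeta>)"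
      by (rule nabla_cong[OF T(2) br(1,2) hs eq z, symmetric])
    also have "\<dots> = (p' \<zeta> / exp \<zeta>) *s b1 \<zeta> + (q' \<zeta> / exp \<zeta>) *s b2 \<zeta>"
      unfolding nabla_comb[OF T(2) br(1,2) br1(1) br2(1) holo[OF pq(1)] holo[OF pq(2)] z]
        br1(2)[OF z] br2(2)[OF z] der[OF pq(1)] der[OF pq(2)] L by simp
    finally have "exp \<zeta> *s nabla T e (exp \<zeta>) = p' \<zeta> *s b1 \<zeta> + q' \<zeta> *s b2 \<zeta>"
      by (simp add: vector_add_ldistrib)
    thus ?thesis using hs_cong[OF hs eq] by blast
  qed
  show "e \<in> hol_sections T (- {0})"
  proof (rule hs_local[OF T(1)])
    fix z :: complex assume z: "z \<in> - {0}"
    have "z \<in> exp ` ball (Ln z) 1" using z by (intro image_eqI[of _ _ "Ln z"]) auto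
    moreover have "open (exp ` ball (Ln z) (1 :: real))"
      by (rule exp_branch(1)[OF open_ball inj_exp_ball]) (use pi_ge_two in simp)
    ultimately show "\<exists>N. open N \<and> z \<in> N \<and> e \<in> hol_sections T N" using loc[of "Ln z"] by blast
  qed
  show "exp \<zeta> *s nabla T e (exp \<zeta>) = p' \<zeta> *s b1 \<zeta> + q' \<zeta> *s b2 \<zeta>" using loc by blast
qed

section \<open>Functions of polynomial growth\<close>

text \<open>No continuity is demanded, so that \<open>Ln\<close> and the arbitrary coefficient
  functions in \<open>moderate_growth\<close> are covered.\<close>

definition tempered :: "(complex \<Rightarrow> complex) \<Rightarrow> bool" where
  "tempered f \<longleftrightarrow> (\<exists>K M. eventually (\<lambda>z. norm (f z) \<le> K * norm z powr (- M)) (at 0))"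

lemma eventually_norm_less: "r > 0 \<Longrightarrow> eventually (\<lambda>z :: complex. z \<noteq> 0 \<and> norm z < r) (at 0)"
  unfolding eventually_at by (intro exI[of _ r]) (auto simp: dist_norm)

lemma tempered_nonneg:
  assumes "tempered f"
  obtains K M where "K \<ge> 0" "M \<ge> 0" "eventually (\<lambda>z. norm (f z) \<le> K * norm z powr (- M)) (at 0)"
proof -
  obtain K M where KM: "eventually (\<lambda>z. norm (f z) \<le> K * norm z powr (- M)) (at 0)"
    using assms unfolding tempered_def by blast
  show ?thesis
  proof (rule that[of "\<bar>K\<bar>" "\<bar>M\<bar>"])
    show "eventually (\<lambda>z. norm (f z) \<le> \<bar>K\<bar> * norm z powr (- \<bar>M\<bar>)) (at 0)"
      using KM eventually_norm_less[of 1, OF zero_less_one]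
    proof eventually_elim
      case (elim z)
      have "norm z powr (- M) \<le> norm z powr (- \<bar>M\<bar>)"
        using elim(2) by (intro powr_mono') auto
      hence "K * norm z powr (- M) \<le> \<bar>K\<bar> * norm z powr (- \<bar>M\<bar>)"
        by (intro mult_mono) auto
      thus ?case using elim(1) by linarith
    qed
  qed auto
qed

lemma tempered_mult:
  assumes "tempered f" "tempered g"
  shows "tempered (\<lambda>z. f z * g z)"
proof -
  obtain K M where f: "K \<ge> 0" "M \<ge> 0" "eventually (\<lambda>z. norm (f z) \<le> K * norm z powr (- M)) (at 0)"
    using assms(1) by (rule tempered_nonneg)
  obtain K' M' where g: "K' \<ge> 0" "M' \<ge> 0" "eventually (\<lambda>z. norm (g z) \<le> K' * norm z powr (- M')) (at 0)"
    using assms(2) by (rule tempered_nonneg)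
  have "eventually (\<lambda>z. norm (f z * g z) \<le> (K * K') * norm z powr (- (M + M'))) (at 0)"
    using f(3) g(3)
  proof eventually_elim
    case (elim z)
    have "norm (f z * g z) \<le> (K * norm z powr (- M)) * (K' * norm z powr (- M'))"
      unfolding norm_mult using elim f(1) by (intro mult_mono) auto
    also have "\<dots> = (K * K') * norm z powr (- (M + M'))"
      by (simp add: powr_add[symmetric])
    finally show ?case .
  qed
  thus ?thesis unfolding tempered_def by blast
qed

lemma tempered_add:
  assumes "tempered f" "tempered g"
  shows "tempered (\<lambda>z. f z + g z)"
proof -
  obtain K M where f: "K \<ge> 0" "M \<ge> 0" "eventually (\<lambda>z. norm (f z) \<le> K * norm z powr (- M)) (at 0)"
    using assms(1) by (rule tempered_nonneg)
  obtain K' M' where g: "K' \<ge> 0" "M' \<ge> 0" "eventually (\<lambda>z. norm (g z) \<le> K' * norm z powr (- M')) (at 0)"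
    using assms(2) by (rule tempered_nonneg)
  have "eventually (\<lambda>z. norm (f z + g z) \<le> (K + K') * norm z powr (- (M + M'))) (at 0)"
    using f(3) g(3) eventually_norm_less[of 1, OF zero_less_one]
  proof eventually_elim
    case (elim z)
    have p: "norm z powr (- M) \<le> norm z powr (- (M + M'))" "norm z powr (- M') \<le> norm z powr (- (M + M'))"
      using elim(3) f(2) g(2) by (auto intro!: powr_mono')
    have "norm (f z + g z) \<le> K * norm z powr (- M) + K' * norm z powr (- M')"
      using elim(1,2) norm_triangle_ineq[of "f z" "g z"] by linarith
    also have "\<dots> \<le> K * norm z powr (- (M + M')) + K' * norm z powr (- (M + M'))"
      using p f(1) g(1) by (intro add_mono mult_left_mono) auto
    finally show ?case by (simp add: algebra_simps)
  qed
  thus ?thesis unfolding tempered_def by blast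
qed

lemma tempered_const: "tempered (\<lambda>_. c)"
  unfolding tempered_def
proof (intro exI)
  show "eventually (\<lambda>z. norm c \<le> norm c * norm z powr (- 0)) (at (0 :: complex))"
    using eventually_norm_less[of 1, OF zero_less_one] by eventually_elim simp
qed

lemma tempered_cong:
  assumes "tempered f" "eventually (\<lambda>z. f z = g z) (at 0)"
  shows "tempered g"
proof -
  obtain K M where f: "eventually (\<lambda>z. norm (f z) \<le> K * norm z powr (- M)) (at 0)"
    using assms(1) unfolding tempered_def by blast
  have "eventually (\<lambda>z. norm (g z) \<le> K * norm z powr (- M)) (at 0)"
    using f assms(2) by eventually_elim simp
  thus ?thesis unfolding tempered_def by blast
qed

lemma tempered_Ln: "tempered Ln"
  unfolding tempered_def
proof (intro exI)
  show "eventually (\<lambda>z. norm (Ln z) \<le> (1 + pi) * norm z powr (- 1)) (at 0)"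
    using eventually_norm_less[of 1, OF zero_less_one]
  proof eventually_elim
    case (elim z)
    have "1 \<le> 1 / norm z" using elim by simp
    hence "ln (1 / norm z) \<le> 1 / norm z" "0 \<le> ln (1 / norm z)"
      using elim ln_bound[of "1 / norm z"] by auto
    hence "\<bar>Re (Ln z)\<bar> \<le> 1 / norm z" using elim by (simp add: ln_div)
    moreover have "\<bar>Im (Ln z)\<bar> \<le> pi" using mpi_less_Im_Ln[of z] Im_Ln_le_pi[of z] elim by linarith
    moreover have "norm (Ln z) \<le> \<bar>Re (Ln z)\<bar> + \<bar>Im (Ln z)\<bar>" by (rule cmod_le)
    moreover have "pi * 1 \<le> pi * (1 / norm z)" using \<open>1 \<le> 1 / norm z\<close> by (intro mult_left_mono) auto
    ultimately have "norm (Ln z) \<le> 1 / norm z + pi * (1 / norm z)" by linarith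
    thus ?case using elim by (simp add: powr_minus_divide algebra_simps add_divide_distrib)
  qed
qed

lemma tempered_exp_Ln: "tempered (\<lambda>z. exp (c * Ln z))"
  unfolding tempered_def
proof (intro exI)
  show "eventually (\<lambda>z. norm (exp (c * Ln z)) \<le> exp (\<bar>Im c\<bar> * pi) * norm z powr (- (- Re c))) (at 0)"
    using eventually_norm_less[of 1, OF zero_less_one]
  proof eventually_elim
    case (elim z)
    have "\<bar>Im (Ln z)\<bar> \<le> pi" using mpi_less_Im_Ln[of z] Im_Ln_le_pi[of z] elim by linarith
    hence "\<bar>Im c * Im (Ln z)\<bar> \<le> \<bar>Im c\<bar> * pi" unfolding abs_mult by (intro mult_left_mono) auto
    hence "Re (c * Ln z) \<le> \<bar>Im c\<bar> * pi + Re c * ln (norm z)" using elim by simp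
    hence "norm (exp (c * Ln z)) \<le> exp (\<bar>Im c\<bar> * pi + Re c * ln (norm z))" by (simp only: norm_exp_eq_Re exp_le_cancel_iff)
    also have "\<dots> = exp (\<bar>Im c\<bar> * pi) * norm z powr (- (- Re c))"
      using elim by (simp add: exp_add powr_def)
    finally show ?case .
  qed
qed

text \<open>A power \<open>z ^ n\<close> with \<open>n\<close> above the growth exponent makes the
  function tend to 0, so the singularity is at most a pole; dividing by the power gives the
  expansion.\<close>

lemma tempered_imp_expansion:
  assumes f: "f holomorphic_on ball 0 r - {0}" "r > 0" and temp: "tempered f"
  shows "\<exists>F. f has_laurent_expansion F"
proof -
  obtain K M where KM: "K \<ge> 0" "M \<ge> 0" "eventually (\<lambda>z. norm (f z) \<le> K * norm z powr (- M)) (at 0)"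
    using temp by (rule tempered_nonneg)
  obtain n where n: "real n > M" using reals_Archimedean2 by blast
  let ?h = "\<lambda>z. z ^ n * f z"
  have "(?h \<longlongrightarrow> 0) (at 0)"
  proof (rule Lim_null_comparison)
    show "eventually (\<lambda>z. norm (?h z) \<le> K * norm z powr (real n - M)) (at 0)"
      using KM(3) eventually_norm_less[of 1, OF zero_less_one]
    proof eventually_elim
      case (elim z)
      have "norm (?h z) \<le> norm z ^ n * (K * norm z powr (- M))"
        unfolding norm_mult norm_power using elim by (intro mult_left_mono) auto
      also have "\<dots> = K * (norm z powr real n * norm z powr (- M))"
        using elim by (simp add: powr_realpow)
      also have "\<dots> = K * norm z powr (real n - M)" by (simp add: powr_add[symmetric])
      finally show ?case .
    qed
    have "((\<lambda>z :: complex. norm z powr (real n - M)) \<longlongrightarrow> 0) (at 0)"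
      using n by (intro tendsto_zero_powrI[where b = "real n - M"] tendsto_norm_zero tendsto_ident_at tendsto_const) auto
    thus "((\<lambda>z :: complex. K * norm z powr (real n - M)) \<longlongrightarrow> 0) (at 0)"
      by (rule tendsto_mult_right_zero)
  qed
  hence ne: "not_essential ?h 0" unfolding not_essential_def by blast
  have hh: "?h holomorphic_on ball 0 r - {0}" by (intro holomorphic_intros f)
  have "open (ball (0 :: complex) r - {0})" by auto
  hence "?h analytic_on ball 0 r - {0}" using hh by (simp add: analytic_on_open)
  hence "isolated_singularity_at ?h 0" unfolding isolated_singularity_at_def using f(2) by blast
  from not_essential_has_laurent_expansion_0[OF this ne]
  have "(\<lambda>z. ?h z / z ^ n) has_laurent_expansion laurent_expansion ?h 0 / fls_X_intpow (int n)"
    by (intro laurent_expansion_intros)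
  note e = this
  have "eventually (\<lambda>z. ?h z / z ^ n = f z) (at 0)"
    using eventually_norm_less[of 1, OF zero_less_one] by eventually_elim simp
  from expansion_cong[OF this e] show ?thesis by blast
qed

section \<open>Monodromy\<close>

text \<open>An ordered pair with coordinates, in contrast to a basis as a set, where the two entries
  might coincide.\<close>

definition basis2 :: "('a \<Rightarrow> complex ^ 2) set \<Rightarrow> ('a \<Rightarrow> complex ^ 2) \<Rightarrow> ('a \<Rightarrow> complex ^ 2) \<Rightarrow> bool" where
  "basis2 V b1 b2 \<longleftrightarrow> (\<forall>u. u \<in> V \<longleftrightarrow> (\<exists>x y. u = fscale x b1 + fscale y b2)) \<and>
     (\<forall>x y. fscale x b1 + fscale y b2 = 0 \<longrightarrow> x = 0 \<and> y = 0)"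

lemma basis2E:
  assumes "basis2 V b1 b2" "u \<in> V"
  obtains x y where "u = fscale x b1 + fscale y b2"
  using assms unfolding basis2_def by blast

lemma basis2_mem: "basis2 V b1 b2 \<Longrightarrow> fscale x b1 + fscale y b2 \<in> V"
  unfolding basis2_def by blast

lemma basis2_indep: "basis2 V b1 b2 \<Longrightarrow> fscale x b1 + fscale y b2 = 0 \<Longrightarrow> x = 0 \<and> y = 0"
  unfolding basis2_def by blast

lemma fscale_simps [simp]: "fscale 0 u = 0" "fscale 1 u = u" "fscale c 0 = 0"
    "fscale a (fscale b u) = fscale (a * b) u" "fscale a u = 0 \<longleftrightarrow> a = 0 \<or> u = 0"
  by simp_all

lemma basis2_gens:
  assumes "basis2 V b1 b2"
  shows "b1 \<in> V" "b2 \<in> V" "0 \<in> V" "b1 \<noteq> 0" "b2 \<noteq> 0"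
  using basis2_mem[OF assms, of 1 0] basis2_mem[OF assms, of 0 1] basis2_mem[OF assms, of 0 0]
    basis2_indep[OF assms, of 1 0] basis2_indep[OF assms, of 0 1] by auto

lemma basis2_eq_iff:
  assumes "basis2 V b1 b2"
  shows "fscale x b1 + fscale y b2 = fscale x' b1 + fscale y' b2 \<longleftrightarrow> x = x' \<and> y = y'"
proof
  assume "fscale x b1 + fscale y b2 = fscale x' b1 + fscale y' b2"
  hence "fscale (x - x') b1 + fscale (y - y') b2 = 0"
    by (simp add: sec.scale_left_diff_distrib algebra_simps)
  from basis2_indep[OF assms this] show "x = x' \<and> y = y'" by simp
qed simp

lemma span2_iff: "u \<in> sec.span {b1, b2} \<longleftrightarrow> (\<exists>x y. u = fscale x b1 + fscale y b2)"
proof -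
  have "u \<in> sec.span {b1, b2} \<longleftrightarrow> (\<exists>x y. u - fscale x b1 = fscale y b2)"
    unfolding sec.span_insert[of b1 "{b2}"] sec.span_singleton by auto
  thus ?thesis by (simp add: algebra_simps)
qed

lemma basis2_span: "basis2 V b1 b2 \<Longrightarrow> V = sec.span {b1, b2}"
  unfolding basis2_def set_eq_iff span2_iff by blast

lemma independent_basis2:
  assumes "b1 \<noteq> b2" "sec.independent {b1, b2}"
  shows "basis2 (sec.span {b1, b2}) b1 b2"
  unfolding basis2_def
proof (intro conjI allI impI)
  fix u
  show "u \<in> sec.span {b1, b2} \<longleftrightarrow> (\<exists>x y. u = fscale x b1 + fscale y b2)" by (rule span2_iff)
next
  fix x y assume *: "fscale x b1 + fscale y b2 = 0"
  define c where "c = (\<lambda>v. if v = b1 then x else y)"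
  have c: "c b1 = x" "c b2 = y" using assms(1) by (auto simp: c_def)
  have "(\<Sum>v\<in>{b1, b2}. fscale (c v) v) = 0" using assms(1) * by (simp add: c)
  hence "c v = 0" if "v \<in> {b1, b2}" for v
    using sec.independentD[OF assms(2) _ subset_refl, of c v] that by simp
  from this[of b1] this[of b2] show "x = 0" "y = 0" by (simp_all add: c)
qed

lemma basis2_comb:
  assumes "basis2 V b1 b2" "u \<in> V" "w \<in> V"
  shows "fscale x u + fscale y w \<in> V"
proof -
  obtain a b where u: "u = fscale a b1 + fscale b b2" using assms(1,2) by (rule basis2E)
  obtain c d where w: "w = fscale c b1 + fscale d b2" using assms(1,3) by (rule basis2E)
  have "fscale x u + fscale y w = fscale (x * a + y * c) b1 + fscale (x * b + y * d) b2"
    unfolding u w by (simp add: sec.scale_right_distrib sec.scale_left_distrib)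
  thus ?thesis using basis2_mem[OF assms(1)] by simp
qed

lemma basis2_change:
  assumes V: "basis2 V b1 b2" and v: "v1 \<in> V" "v2 \<in> V"
    and ind: "\<And>x y. fscale x v1 + fscale y v2 = 0 \<Longrightarrow> x = 0 \<and> y = 0"
  shows "basis2 V v1 v2"
proof -
  obtain a b where v1: "v1 = fscale a b1 + fscale b b2" using V v(1) by (rule basis2E)
  obtain c d where v2: "v2 = fscale c b1 + fscale d b2" using V v(2) by (rule basis2E)
  define e where "e = a * d - b * c"
  have e: "e \<noteq> 0"
  proof
    assume e: "e = 0"
    \<comment> \<open>The rows of the adjugate give two relations; if the determinant were 0,
      independence would make all four entries, and hence \<open>v1\<close>, vanish.\<close>
    have "fscale d v1 + fscale (- b) v2 = fscale e b1" "fscale (- c) v1 + fscale a v2 = fscale e b2"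
      unfolding v1 v2 e_def by (simp_all add: fscale_def fun_eq_iff vec_eq_iff algebra_simps)
    hence "d = 0" "b = 0" "c = 0" "a = 0" using ind[of d "- b"] ind[of "- c" a] e by simp_all
    hence "fscale 1 v1 + fscale 0 v2 = 0" by (simp add: v1)
    thus False using ind[of 1 0] by simp
  qed
  have "\<exists>x y. u = fscale x v1 + fscale y v2" if u: "u \<in> V" for u
  proof -
    obtain x y where u: "u = fscale x b1 + fscale y b2" using V u by (rule basis2E)
    have "fscale e u = fscale (x * d - y * c) v1 + fscale (y * a - x * b) v2"
      unfolding u v1 v2 e_def by (simp add: fscale_def fun_eq_iff vec_eq_iff algebra_simps)
    from arg_cong[OF this, of "fscale (1 / e)"]
    have "u = fscale ((x * d - y * c) / e) v1 + fscale ((y * a - x * b) / e) v2"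
      using e by (simp add: sec.scale_right_distrib)
    thus ?thesis by blast
  qed
  thus ?thesis unfolding basis2_def using basis2_comb[OF V v] ind by blast
qed

text \<open>If \<open>U \<noteq> 1\<close>, then the kernel of the nilpotent map \<open>U - 1\<close> is a line, which \<open>S\<close> preserves. An eigenvector of
  \<open>S\<close> outside of this line is mapped onto it by \<open>U - 1\<close>, so both have the same eigenvalue.\<close>

lemma jordan_cases:
  assumes V: "basis2 V b1 b2" and JD: "jordan_decomposition V L S U"
  shows "(\<forall>\<sigma>\<in>V. U \<sigma> = \<sigma>) \<or> (\<exists>c. \<forall>\<sigma>\<in>V. S \<sigma> = fscale c \<sigma>)"
proof (rule disjCI)
  assume nsc: "\<not> (\<exists>c. \<forall>\<sigma>\<in>V. S \<sigma> = fscale c \<sigma>)"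
  have S: "lin_endo V S" and U: "lin_endo V U"
    and SU: "\<And>\<sigma>. \<sigma> \<in> V \<Longrightarrow> S (U \<sigma>) = U (S \<sigma>)"
    and sp: "sec.span {\<sigma>\<in>V. \<exists>c. S \<sigma> = fscale c \<sigma>} = V"
    using JD unfolding jordan_decomposition_def by auto
  obtain k where k: "\<And>\<sigma>. \<sigma> \<in> V \<Longrightarrow> ((\<lambda>\<tau>. U \<tau> - \<tau>) ^^ k) \<sigma> = 0"
    using JD unfolding jordan_decomposition_def by blast
  let ?n = "\<lambda>\<tau>. U \<tau> - \<tau>"
  have lin: "F (fscale x u + fscale y w) = fscale x (F u) + fscale y (F w)"
    if F: "lin_endo V F" and uw: "u \<in> V" "w \<in> V" for F x y u w
  proof -
    have "fscale x u \<in> V" "fscale y w \<in> V"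
      using basis2_comb[OF V uw, of x 0] basis2_comb[OF V uw, of 0 y] by simp_all
    thus ?thesis using F uw unfolding lin_endo_def by simp
  qed
  have memS: "S u \<in> V" and memU: "U u \<in> V" if "u \<in> V" for u
    using S U that unfolding lin_endo_def by auto
  have memn: "?n u \<in> V" if "u \<in> V" for u
    using basis2_comb[OF V memU[OF that] that, of 1 "-1"] by simp
  have linn: "?n (fscale x u + fscale y w) = fscale x (?n u) + fscale y (?n w)"
    if "u \<in> V" "w \<in> V" for x y u w
    unfolding lin[OF U that] by (simp add: sec.scale_right_diff_distrib)
  have n0: "?n 0 = 0" using linn[OF basis2_gens(3)[OF V] basis2_gens(3)[OF V], of 0 0] by simp
  show "\<forall>\<sigma>\<in>V. U \<sigma> = \<sigma>"
  proof (rule ccontr)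
    assume "\<not> ?thesis"
    then obtain v where v: "v \<in> V" "?n v \<noteq> 0" by auto
    define j where "j = (LEAST j. (?n ^^ j) v = 0)"
    have j: "(?n ^^ j) v = 0" unfolding j_def by (rule LeastI[of _ k]) (rule k[OF v(1)])
    have min: "(?n ^^ i) v \<noteq> 0" if "i < j" for i using not_less_Least[of i] that unfolding j_def by blast
    have "j \<noteq> 0"
    proof
      assume "j = 0"
      hence "v = 0" using j by simp
      thus False using v(2) n0 by simp
    qed
    moreover have "j \<noteq> 1" using j v(2) by auto
    ultimately obtain i where i: "j = Suc (Suc i)" by (metis One_nat_def not0_implies_Suc)
    \<comment> \<open>By minimality of \<open>j\<close>, the last two nonzero iterates form a Jordan
      chain: \<open>w\<close> is the image of \<open>u\<close> and lies in the kernel.\<close>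
    define u where "u = (?n ^^ i) v"
    define w where "w = ?n u"
    have memi: "(?n ^^ i) v \<in> V" for i
    proof (induction i)
      case (Suc i)
      show ?case unfolding funpow.simps o_apply by (rule memn[OF Suc])
    qed (use v(1) in simp)
    have u: "u \<in> V" using memi u_def by simp
    have w: "w \<in> V" "w \<noteq> 0" "?n w = 0"
      using memn[OF u] min[of "Suc i"] j unfolding w_def u_def i by simp_all
    have "basis2 V u w"
    proof (rule basis2_change[OF V u w(1)])
      fix x y assume *: "fscale x u + fscale y w = 0"
      have "?n (fscale x u + fscale y w) = fscale x w"
        unfolding linn[OF u w(1)] w(3) w_def[symmetric] by simp
      hence "x = 0" using * n0 w(2) by simp
      thus "x = 0 \<and> y = 0" using * w(2) by simp
    qed
    note V' = this
    have "\<exists>p \<in> {\<sigma>\<in>V. \<exists>c. S \<sigma> = fscale c \<sigma>}. p \<notin> sec.span {w}"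
    proof (rule ccontr)
      assume "\<not> ?thesis"
      hence "{\<sigma>\<in>V. \<exists>c. S \<sigma> = fscale c \<sigma>} \<subseteq> sec.span {w}" by blast
      hence "V \<subseteq> sec.span {w}" using sec.span_minimal[OF _ sec.subspace_span] sp by blast
      then obtain a where "u = fscale a w" using u sec.span_singleton by blast
      hence "fscale 1 u + fscale (- a) w = 0" by simp
      from basis2_indep[OF V' this] show False by simp
    qed
    then obtain p c where p: "p \<in> V" "S p = fscale c p" "p \<notin> sec.span {w}" by blast
    obtain x y where xy: "p = fscale x u + fscale y w" using V' p(1) by (rule basis2E)
    have "fscale y w \<in> sec.span {w}" by (intro sec.span_scale sec.span_base) simp
    hence x: "x \<noteq> 0" using p(3) xy by auto
    have np: "?n p = fscale x w"
      unfolding xy linn[OF u w(1)] w(3) w_def[symmetric] by simp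
    have "S (?n p) = fscale 1 (S (U p)) + fscale (-1) (S p)"
      using lin[OF S memU[OF p(1)] p(1), of 1 "-1"] by simp
    also have "\<dots> = U (fscale c p + fscale 0 p) - fscale c p" using SU[OF p(1)] p(2) by simp
    also have "\<dots> = fscale c (?n p)" unfolding lin[OF U p(1,1)] by (simp add: sec.scale_right_diff_distrib)
    finally have "S (fscale x w + fscale 0 w) = fscale c (fscale x w)" unfolding np by simp
    hence "fscale x (S w) = fscale x (fscale c w)" unfolding lin[OF S w(1,1)] by (simp add: mult.commute)
    hence Sw: "S w = fscale c w" using x by (metis sec.scale_left_imp_eq)
    have pw: "basis2 V p w"
    proof (rule basis2_change[OF V p(1) w(1)])
      fix a b assume "fscale a p + fscale b w = 0"
      hence "fscale (a * x) u + fscale (a * y + b) w = 0"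
        unfolding xy by (simp add: sec.scale_right_distrib sec.scale_left_distrib add.assoc)
      from basis2_indep[OF V' this] x show "a = 0 \<and> b = 0" by auto
    qed
    have "S \<sigma> = fscale c \<sigma>" if \<sigma>: "\<sigma> \<in> V" for \<sigma>
    proof -
      obtain a b where \<sigma>: "\<sigma> = fscale a p + fscale b w" using pw \<sigma> by (rule basis2E)
      show ?thesis unfolding \<sigma> lin[OF S p(1) w(1)] p(2) Sw by (simp add: sec.scale_right_distrib mult.commute)
    qed
    thus False using nsc by blast
  qed
qed

section \<open>The nilpotent part of the monodromy\<close>

lemma M_mon_lin: "M_mon (fscale x u + fscale y w) = fscale x (M_mon u) + fscale y (M_mon w)"
  by (simp add: M_mon_def fscale_def fun_eq_iff)

lemma M_mon_eq_0: "M_mon u = 0 \<Longrightarrow> u = 0"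
proof
  fix \<zeta> assume "M_mon u = 0"
  from fun_cong[OF this, of "\<zeta> - 2 * of_real pi * \<i>"] show "u \<zeta> = 0 \<zeta>" by (simp add: M_mon_def)
qed

text \<open>As \<open>N_mon\<close> is a definite description over all Jordan decompositions, each
  of them must be shown to give the same logarithm. By \<open>jordan_cases\<close> either
  \<open>U\<close> is the identity or \<open>S\<close> is scalar, and in both cases the action of
  the monodromy on \<open>v1, v2\<close> determines \<open>U\<close> on
  \<open>H_infty T\<close>.\<close>

lemma N_mon_zero_iff:
  assumes V: "basis2 (H_infty T) v1 v2"
    and M: "M_mon v1 = fscale l1 v1 + fscale c v2" "M_mon v2 = fscale l2 v2" "c \<noteq> 0 \<Longrightarrow> l1 = l2"
    and mem: "\<And>\<sigma>. \<sigma> \<in> H_infty T \<Longrightarrow> M_mon \<sigma> \<in> H_infty T"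
  shows "N_mon_zero T \<longleftrightarrow> c = 0"
proof -
  let ?V = "H_infty T" and ?JD = "jordan_decomposition (H_infty T) M_mon"
  note v = basis2_gens[OF V]
  have l2: "l2 \<noteq> 0" using M(2) M_mon_eq_0[of v2] v by auto
  have lin: "F (fscale x v1 + fscale y v2) = fscale x (F v1) + fscale y (F v2)"
    if F: "lin_endo ?V F" for F x y
  proof -
    have "fscale x v1 \<in> ?V" "fscale y v2 \<in> ?V"
      using basis2_mem[OF V, of x 0] basis2_mem[OF V, of 0 y] by simp_all
    thus ?thesis using F v unfolding lin_endo_def by simp
  qed
  \<comment> \<open>On an eigenvector with eigenvalue \<open>a\<close>, the powers of
    \<open>U - 1\<close> multiply by powers of \<open>a - 1\<close>; nilpotency forces
    \<open>a = 1\<close>.\<close>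
  have unip: "\<sigma> \<in> ?V \<Longrightarrow> \<sigma> \<noteq> 0 \<Longrightarrow> U \<sigma> = fscale a \<sigma> \<Longrightarrow> a = 1" if JD: "?JD S U" for S U \<sigma> a
  proof -
    assume \<sigma>: "\<sigma> \<in> ?V" "\<sigma> \<noteq> 0" "U \<sigma> = fscale a \<sigma>"
    obtain k where k: "((\<lambda>\<tau>. U \<tau> - \<tau>) ^^ k) \<sigma> = 0"
      using JD \<sigma>(1) unfolding jordan_decomposition_def by blast
    have "U (fscale b \<sigma>) = fscale b (U \<sigma>)" for b
      using JD \<sigma>(1) unfolding jordan_decomposition_def lin_endo_def by blast
    hence "((\<lambda>\<tau>. U \<tau> - \<tau>) ^^ k) \<sigma> = fscale ((a - 1) ^ k) \<sigma>"
      by (induction k) (simp_all add: \<sigma>(3) mult.commute left_diff_distrib flip: sec.scale_left_diff_distrib)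
    thus "a = 1" using k \<sigma>(2) by simp
  qed
  show ?thesis
  proof (cases "c = 0")
    case True
    have diag: "M_mon v1 = fscale l1 v1" using M(1) True by simp
    have l1: "l1 \<noteq> 0" using diag M_mon_eq_0[of v1] v by auto
    have U: "U \<sigma> = \<sigma>" if JD: "?JD S U" and \<sigma>: "\<sigma> \<in> ?V" for S U \<sigma>
      using jordan_cases[OF V JD]
    proof
      assume "\<forall>\<sigma>\<in>?V. U \<sigma> = \<sigma>"
      thus ?thesis using \<sigma> by blast
    next
      assume "\<exists>s. \<forall>\<sigma>\<in>?V. S \<sigma> = fscale s \<sigma>"
      then obtain s where s: "\<And>\<sigma>. \<sigma> \<in> ?V \<Longrightarrow> S \<sigma> = fscale s \<sigma>" by blast
      have e: "U u = u" if u: "u \<in> ?V" "u \<noteq> 0" and Mu: "M_mon u = fscale l u" "l \<noteq> 0" for u l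
      proof -
        have "U u \<in> ?V" "M_mon u = S (U u)"
          using JD u unfolding jordan_decomposition_def lin_endo_def by blast+
        hence *: "fscale l u = fscale s (U u)" using Mu s by simp
        hence "s \<noteq> 0" using Mu(2) u(2) by auto
        hence "U u = fscale (l / s) u" using arg_cong[OF *, of "fscale (1 / s)"] by simp
        from unip[OF JD u this] this show ?thesis by simp
      qed
      obtain x y where xy: "\<sigma> = fscale x v1 + fscale y v2" using V \<sigma> by (rule basis2E)
      have "lin_endo ?V U" using JD unfolding jordan_decomposition_def by blast
      from lin[OF this] show ?thesis
        unfolding xy using e[OF v(1,4) diag l1] e[OF v(2,5) M(2) l2] by simp
    qed
    have log: "unipotent_log U \<sigma> = 0" if JD: "?JD S U" and \<sigma>: "\<sigma> \<in> ?V" for S U \<sigma>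
    proof -
      have "((\<lambda>\<tau>. U \<tau> - \<tau>) ^^ k) \<sigma> = 0" if "1 \<le> k" for k
      proof -
        obtain m where m: "k = Suc m" using \<open>1 \<le> k\<close> by (cases k) auto
        have z: "((\<lambda>\<tau>. U \<tau> - \<tau>) ^^ i) 0 = 0" for i
        proof (induction i)
          case (Suc i)
          show ?case unfolding funpow.simps o_apply Suc U[OF JD v(3)] by simp
        qed simp
        show ?thesis unfolding m funpow_Suc_right o_apply U[OF JD \<sigma>] using z by simp
      qed
      hence "{k. 1 \<le> k \<and> ((\<lambda>\<tau>. U \<tau> - \<tau>) ^^ k) \<sigma> \<noteq> 0} = {}" by blast
      thus ?thesis unfolding unipotent_log_def by simp
    qed
    have JD: "?JD M_mon (\<lambda>\<sigma>. \<sigma>)"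
      unfolding jordan_decomposition_def
    proof (intro conjI)
      show "lin_endo ?V M_mon" unfolding lin_endo_def
        using mem M_mon_lin[of 1 _ 1] M_mon_lin[of _ _ 0] by simp
      show "lin_endo ?V (\<lambda>\<sigma>. \<sigma>)"
        using basis2_comb[OF V, of _ _ 1 1] basis2_comb[OF V, of _ _ _ 0] unfolding lin_endo_def by simp
      let ?E = "{\<sigma> \<in> ?V. \<exists>c. M_mon \<sigma> = fscale c \<sigma>}"
      have "sec.span ?E \<subseteq> ?V" using basis2_span[OF V] sec.span_minimal[OF _ sec.subspace_span, of ?E] by blast
      moreover have "{v1, v2} \<subseteq> ?E" using v diag M(2) by blast
      hence "?V \<subseteq> sec.span ?E" using basis2_span[OF V] sec.span_mono by blast
      ultimately show "sec.span ?E = ?V" by blast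
      show "\<exists>k. \<forall>\<sigma>\<in>?V. ((\<lambda>\<tau>. \<tau> - \<tau>) ^^ k) \<sigma> = 0" by (intro exI[of _ 1]) simp
    qed simp
    have "N_mon T \<sigma> = 0" if \<sigma>: "\<sigma> \<in> ?V" for \<sigma>
      unfolding N_mon_def by (rule the_equality) (use JD log \<sigma> in \<open>metis\<close>, use log \<sigma> in blast)
    thus ?thesis using True unfolding N_mon_zero_def by simp
  next
    case False
    define l where "l = l2"
    have M': "M_mon v1 = fscale l v1 + fscale c v2" "M_mon v2 = fscale l v2" "l \<noteq> 0"
      using M False l2 by (simp_all add: l_def)
    have Uv: "U v1 - v1 = fscale (c / l) v2 \<and> U v2 - v2 = 0" if JD: "?JD S U" for S U
      using jordan_cases[OF V JD]
    proof
      assume U: "\<forall>\<sigma>\<in>?V. U \<sigma> = \<sigma>"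
      \<comment> \<open>With \<open>U\<close> the identity, \<open>S\<close> agrees with the
        monodromy, whose eigenvectors all lie on the line of \<open>v2\<close> when
        \<open>c \<noteq> 0\<close>; this contradicts that eigenvectors of \<open>S\<close>
        span.\<close>
      have "p \<in> sec.span {v2}" if p: "p \<in> ?V" "S p = fscale a p" for p a
      proof -
        obtain x y where xy: "p = fscale x v1 + fscale y v2" using V p(1) by (rule basis2E)
        have "M_mon p = fscale a p"
          using JD U p unfolding jordan_decomposition_def by auto
        hence "fscale (x * l) v1 + fscale (x * c + y * l) v2 = fscale (a * x) v1 + fscale (a * y) v2"
          unfolding xy M_mon_lin M' by (simp add: sec.scale_right_distrib sec.scale_left_distrib add_ac)
        hence "x * l = a * x" "x * c + y * l = a * y" unfolding basis2_eq_iff[OF V] by auto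
        hence "x = 0" using False by (cases "x = 0") auto
        moreover have "fscale y v2 \<in> sec.span {v2}" by (intro sec.span_scale sec.span_base) simp
        ultimately show ?thesis using xy by simp
      qed
      hence "{\<sigma>\<in>?V. \<exists>c. S \<sigma> = fscale c \<sigma>} \<subseteq> sec.span {v2}" by blast
      moreover have "sec.span {\<sigma>\<in>?V. \<exists>c. S \<sigma> = fscale c \<sigma>} = ?V"
        using JD unfolding jordan_decomposition_def by blast
      ultimately have "?V \<subseteq> sec.span {v2}" using sec.span_minimal[OF _ sec.subspace_span] by blast
      then obtain a where "v1 = fscale a v2" using v sec.span_singleton by blast
      hence "fscale 1 v1 + fscale (- a) v2 = 0" by simp
      from basis2_indep[OF V this] show ?thesis by simp
    next
      assume "\<exists>s. \<forall>\<sigma>\<in>?V. S \<sigma> = fscale s \<sigma>"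
      then obtain s where s: "\<And>\<sigma>. \<sigma> \<in> ?V \<Longrightarrow> S \<sigma> = fscale s \<sigma>" by blast
      have SU: "M_mon u = fscale s (U u)" if u: "u \<in> ?V" for u
      proof -
        have "U u \<in> ?V" "M_mon u = S (U u)"
          using JD u unfolding jordan_decomposition_def lin_endo_def by blast+
        thus ?thesis using s by simp
      qed
      have *: "fscale l v2 = fscale s (U v2)" using SU[OF v(2)] M' by simp
      hence s0: "s \<noteq> 0" using M'(3) v(5) by auto
      hence U2: "U v2 = fscale (l / s) v2" using arg_cong[OF *, of "fscale (1 / s)"] by simp
      have "l / s = 1" by (rule unip[OF JD v(2,5) U2])
      hence sl: "s = l" using s0 by simp
      have "fscale l v1 + fscale c v2 = fscale l (U v1)" using SU[OF v(1)] M' sl by simp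
      from arg_cong[OF this, of "fscale (1 / l)"] have "U v1 = v1 + fscale (c / l) v2"
        using M'(3) by (simp add: sec.scale_right_distrib)
      thus ?thesis using U2 sl M'(3) by simp
    qed
    have log: "unipotent_log U v1 = fscale (c / l) v2" if JD: "?JD S U" for S U
    proof -
      let ?n = "\<lambda>\<tau>. U \<tau> - \<tau>"
      have le: "lin_endo ?V U" using JD unfolding jordan_decomposition_def by blast
      have U0: "U 0 = 0" using lin[OF le, of 0 0] by simp
      \<comment> \<open>The logarithm series therefore stops after its first term.\<close>
      have n2: "?n (?n v1) = 0"
        using lin[OF le, of 0 "c / l"] Uv[OF JD] by (simp flip: sec.scale_right_diff_distrib)
      have z: "(?n ^^ i) 0 = 0" for i
      proof (induction i)
        case (Suc i)
        show ?case unfolding funpow.simps o_apply Suc U0 by simp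
      qed simp
      have n3: "(?n ^^ Suc (Suc i)) v1 = 0" for i
        unfolding funpow_Suc_right o_apply n2 by (rule z)
      have n1: "(?n ^^ 1) v1 \<noteq> 0" using Uv[OF JD] False M'(3) v(5) by simp
      have "1 \<le> k \<and> (?n ^^ k) v1 \<noteq> 0 \<longleftrightarrow> k = 1" for k
      proof (cases "k = 0 \<or> k = 1")
        case True
        thus ?thesis using n1 by auto
      next
        case False
        then obtain i where "k = Suc (Suc i)" by (metis One_nat_def not0_implies_Suc)
        thus ?thesis using n3 by simp
      qed
      hence "{k. 1 \<le> k \<and> (?n ^^ k) v1 \<noteq> 0} = {1}" by simp
      thus ?thesis unfolding unipotent_log_def using Uv[OF JD] by simp
    qed
    \<comment> \<open>Both eigenvalues equal \<open>l\<close>, so the semisimple part is the scalar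
      \<open>l\<close> and the unipotent part is the quotient.\<close>
    have JD: "?JD (fscale l) (\<lambda>\<sigma>. fscale (1 / l) (M_mon \<sigma>))"
      unfolding jordan_decomposition_def
    proof (intro conjI)
      show "lin_endo ?V (fscale l)"
        unfolding lin_endo_def using basis2_comb[OF V, of _ _ l 0]
        by (simp add: sec.scale_right_distrib mult.commute)
      show "lin_endo ?V (\<lambda>\<sigma>. fscale (1 / l) (M_mon \<sigma>))"
        unfolding lin_endo_def using mem M_mon_lin[of 1 _ 1] M_mon_lin[of _ _ 0] basis2_comb[OF V, of _ _ "1 / l" 0]
        by (simp add: sec.scale_right_distrib mult.commute)
      show "\<forall>\<sigma>\<in>?V. M_mon \<sigma> = fscale l (fscale (1 / l) (M_mon \<sigma>)) \<and>
          M_mon \<sigma> = fscale (1 / l) (M_mon (fscale l \<sigma>))"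
        using M'(3) M_mon_lin[of l _ 0] by simp
      have "{\<sigma> \<in> ?V. \<exists>c. fscale l \<sigma> = fscale c \<sigma>} = ?V" by blast
      moreover have "sec.span ?V = ?V" using basis2_span[OF V] sec.span_span by metis
      ultimately show "sec.span {\<sigma> \<in> ?V. \<exists>c. fscale l \<sigma> = fscale c \<sigma>} = ?V" by simp
      have "((\<lambda>\<tau>. fscale (1 / l) (M_mon \<tau>) - \<tau>) ^^ 2) \<sigma> = 0" if \<sigma>: "\<sigma> \<in> ?V" for \<sigma>
      proof -
        obtain x y where xy: "\<sigma> = fscale x v1 + fscale y v2" using V \<sigma> by (rule basis2E)
        have "fscale (1 / l) (M_mon \<sigma>) - \<sigma> = fscale (x * c / l) v2"
          unfolding xy M_mon_lin M' using M'(3)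
          by (simp add: sec.scale_right_distrib)
        moreover have "fscale (1 / l) (M_mon (fscale b v2)) - fscale b v2 = 0" for b
          using M_mon_lin[of b v2 0] M' by simp
        ultimately show ?thesis by (simp add: numeral_2_eq_2)
      qed
      thus "\<exists>k. \<forall>\<sigma>\<in>?V. ((\<lambda>\<tau>. fscale (1 / l) (M_mon \<tau>) - \<tau>) ^^ k) \<sigma> = 0" by blast
    qed
    have "N_mon T v1 = fscale (c / l) v2"
      unfolding N_mon_def by (rule the_equality) (use JD log in \<open>metis\<close>, use log in blast)
    hence "N_mon T v1 \<noteq> 0" using False M'(3) v(5) by simp
    thus ?thesis using False v(1) unfolding N_mon_zero_def by blast
  qed
qed

text \<open>The set \<open>{l1, l2}\<close> does not record multiplicities. For distinct eigenvalues
  two eigenvectors form the basis; for equal ones an eigenvector is completed, and the diagonal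
  entry of the second vector must be the same eigenvalue.\<close>

lemma monodromy_basis:
  assumes V: "basis2 (H_infty T) b1 b2" and eig: "mon_eigenvalues T = {l1, l2}"
    and mem: "\<And>\<sigma>. \<sigma> \<in> H_infty T \<Longrightarrow> M_mon \<sigma> \<in> H_infty T"
  obtains v1 v2 c where "basis2 (H_infty T) v1 v2" "M_mon v1 = fscale l1 v1 + fscale c v2"
    "M_mon v2 = fscale l2 v2" "c \<noteq> 0 \<Longrightarrow> l1 = l2" "l1 \<noteq> 0" "l2 \<noteq> 0"
proof -
  have eigI: "l \<in> {l1, l2}" if "\<sigma> \<in> H_infty T" "\<sigma> \<noteq> 0" "M_mon \<sigma> = fscale l \<sigma>" for \<sigma> l
    unfolding eig[symmetric] mon_eigenvalues_def using that by blast
  have ex: "\<exists>\<sigma> \<in> H_infty T. \<sigma> \<noteq> 0 \<and> M_mon \<sigma> = fscale l \<sigma>" if "l \<in> {l1, l2}" for l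
    using that unfolding eig[symmetric] mon_eigenvalues_def by blast
  have nz: "l \<noteq> 0" if "l \<in> {l1, l2}" for l
    using ex[OF that] M_mon_eq_0 by force
  obtain v2 where v2: "v2 \<in> H_infty T" "v2 \<noteq> 0" "M_mon v2 = fscale l2 v2" using ex[of l2] by auto
  show ?thesis
  proof (cases "l1 = l2")
    case False
    obtain v1 where v1: "v1 \<in> H_infty T" "v1 \<noteq> 0" "M_mon v1 = fscale l1 v1" using ex[of l1] by auto
    have "basis2 (H_infty T) v1 v2"
    proof (rule basis2_change[OF V v1(1) v2(1)])
      fix x y assume *: "fscale x v1 + fscale y v2 = 0"
      have "M_mon 0 = 0" by (simp add: M_mon_def fun_eq_iff)
      hence "fscale x (fscale l1 v1) + fscale y (fscale l2 v2) = 0"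
        using M_mon_lin[of x v1 y v2] * v1(3) v2(3) by simp
      moreover have "fscale y v2 = - fscale x v1" using * by (simp add: eq_neg_iff_add_eq_0 add.commute)
      hence "fscale y (fscale l2 v2) = fscale (- (l2 * x)) v1"
        using arg_cong[of _ _ "fscale l2"] by (metis (no_types, lifting) fscale_simps(4) mult.commute sec.scale_minus_left sec.scale_minus_right)
      ultimately have "fscale (x * l1 - l2 * x) v1 = 0"
        by (simp add: sec.scale_left_diff_distrib)
      hence "x * (l1 - l2) = 0" using v1(2) by (simp add: algebra_simps)
      hence "x = 0" using False by simp
      thus "x = 0 \<and> y = 0" using * v2(2) by simp
    qed
    thus ?thesis using that[of v1 v2 0] v1(3) v2(3) nz by simp
  next
    case True
    have "\<exists>v1 \<in> H_infty T. \<forall>a. v1 \<noteq> fscale a v2"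
    proof (rule ccontr)
      assume "\<not> ?thesis"
      then obtain x y where "b1 = fscale x v2" "b2 = fscale y v2" using basis2_gens[OF V] by blast
      hence "fscale y b1 + fscale (- x) b2 = 0" by (simp add: mult.commute)
      from basis2_indep[OF V this] have "b1 = 0" using \<open>b1 = fscale x v2\<close> by simp
      thus False using basis2_gens(4)[OF V] by blast
    qed
    then obtain v1 where v1: "v1 \<in> H_infty T" "\<And>a. v1 \<noteq> fscale a v2" by blast
    have V': "basis2 (H_infty T) v1 v2"
    proof (rule basis2_change[OF V v1(1) v2(1)])
      fix x y assume *: "fscale x v1 + fscale y v2 = 0"
      have "x = 0"
      proof (rule ccontr)
        assume x: "x \<noteq> 0"
        have "fscale x v1 = fscale (- y) v2" using * by (simp add: eq_neg_iff_add_eq_0)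
        from arg_cong[OF this, of "fscale (1 / x)"] have "v1 = fscale (- y / x) v2" using x by simp
        thus False using v1(2) by blast
      qed
      thus "x = 0 \<and> y = 0" using * v2(2) by simp
    qed
    obtain x c where xc: "M_mon v1 = fscale x v1 + fscale c v2"
      using V' mem[OF v1(1)] by (rule basis2E)
    have "x = l2"
    proof (rule ccontr)
      assume neq: "x \<noteq> l2"
      \<comment> \<open>The coefficient solves the eigenvector equation for the eigenvalue
        \<open>x\<close>, which would lie outside \<open>{l1, l2}\<close>.\<close>
      define w where "w = fscale 1 v1 + fscale (c / (x - l2)) v2"
      have "w \<noteq> 0" using basis2_indep[OF V', of 1 "c / (x - l2)"] unfolding w_def by auto
      moreover have "w \<in> H_infty T" unfolding w_def by (rule basis2_mem[OF V'])
      moreover have "c + c / (x - l2) * l2 = x * (c / (x - l2))" using neq by (simp add: field_simps)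
      hence "M_mon w = fscale x w"
        unfolding w_def M_mon_lin xc v2(3)
        by (simp add: sec.scale_right_distrib add.assoc flip: sec.scale_left_distrib)
      ultimately show False using eigI[of w x] True neq by simp
    qed
    thus ?thesis using that[OF V', of c] xc v2(3) True nz by simp
  qed
qed

section \<open>Normal forms\<close>

text \<open>The imaginary part of \<open>Ln\<close> lies between \<open>- pi\<close> and
  \<open>pi\<close>, so the single sector with bounds -4 and 4 covers a full punctured
  neighbourhood.\<close>

lemma moderate_growth_coords:
  assumes "moderate_growth T \<sigma>"
  obtains b1 b2 c1 c2 where "basis2 (H_infty T) b1 b2" "tempered c1" "tempered c2"
    "eventually (\<lambda>z. \<sigma> z = c1 z *s b1 (Ln z) + c2 z *s b2 (Ln z)) (at 0)"
proof -
  obtain b1 b2 where b: "b1 \<noteq> b2" "sec.independent {b1, b2}" "sec.span {b1, b2} = H_infty T"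
    and bd: "\<forall>a b :: real. \<exists>c1 c2. \<exists>C N R :: real. \<forall>\<zeta>. Re \<zeta> < R \<and> a < Im \<zeta> \<and> Im \<zeta> < b \<longrightarrow>
        \<sigma> (exp \<zeta>) = c1 \<zeta> *s b1 \<zeta> + c2 \<zeta> *s b2 \<zeta> \<and>
        norm (c1 \<zeta> :: complex) \<le> C * norm (exp \<zeta>) powr (- N) \<and>
        norm (c2 \<zeta> :: complex) \<le> C * norm (exp \<zeta>) powr (- N)"
    using assms unfolding moderate_growth_def by blast
  from spec[OF spec[OF bd, of "-4"], of 4]
  obtain c1 c2 :: "complex \<Rightarrow> complex" and K N R :: real where c:
    "\<forall>\<zeta>. Re \<zeta> < R \<and> -4 < Im \<zeta> \<and> Im \<zeta> < 4 \<longrightarrow>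
        \<sigma> (exp \<zeta>) = c1 \<zeta> *s b1 \<zeta> + c2 \<zeta> *s b2 \<zeta> \<and>
        norm (c1 \<zeta>) \<le> K * norm (exp \<zeta>) powr (- N) \<and>
        norm (c2 \<zeta>) \<le> K * norm (exp \<zeta>) powr (- N)" by (elim exE) (rule that)
  have "eventually (\<lambda>z. \<sigma> z = c1 (Ln z) *s b1 (Ln z) + c2 (Ln z) *s b2 (Ln z) \<and>
        norm (c1 (Ln z)) \<le> K * norm z powr (- N) \<and> norm (c2 (Ln z)) \<le> K * norm z powr (- N)) (at 0)"
    using eventually_norm_less[of "exp R", OF exp_gt_zero]
  proof eventually_elim
    case (elim z)
    have "ln (norm z) < ln (exp R)" using elim by (subst ln_less_cancel_iff) auto
    hence "Re (Ln z) < R" using elim by simp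
    moreover have "-4 < Im (Ln z)" "Im (Ln z) < 4"
      using mpi_less_Im_Ln[of z] Im_Ln_le_pi[of z] elim pi_less_4 by linarith+
    ultimately show ?case using spec[OF c, of "Ln z"] elim by simp
  qed
  hence ev: "eventually (\<lambda>z. \<sigma> z = c1 (Ln z) *s b1 (Ln z) + c2 (Ln z) *s b2 (Ln z)) (at 0)"
    "eventually (\<lambda>z. norm (c1 (Ln z)) \<le> K * norm z powr (- N)) (at 0)"
    "eventually (\<lambda>z. norm (c2 (Ln z)) \<le> K * norm z powr (- N)) (at 0)"
    by (simp_all add: eventually_conj_iff)
  have "tempered (\<lambda>z. c1 (Ln z))" "tempered (\<lambda>z. c2 (Ln z))"
    unfolding tempered_def using ev(2,3) by blast+
  thus ?thesis using that[OF _ _ _ ev(1)] independent_basis2[OF b(1,2)] b(3) by simp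
qed

text \<open>Multiplication by \<open>exp (a * \<zeta>)\<close> cancels the eigenvalue
  \<open>l\<close> of a flat section and gives it exponent \<open>a\<close>. As \<open>a\<close> is
  a fixed function of \<open>l\<close>, equal eigenvalues yield equal exponents. Coordinates in this
  frame arise from flat coordinates by powers and at most one logarithm, all of polynomial growth,
  so moderate growth leaves only poles.\<close>

theorem base_frame:
  assumes te: "te_structure T" and rs: "regular_singular T" and eig: "mon_eigenvalues T = {l1, l2}"
  obtains e1 e2 a1 a2 \<kappa> where "mero_frame T e1 e2 a1 a2 \<kappa> 0"
    "exp (- 2 * of_real pi * \<i> * a1) = l1" "exp (- 2 * of_real pi * \<i> * a2) = l2"
    "l1 = l2 \<longrightarrow> a1 = a2" "\<kappa> = 0 \<or> \<kappa> = 1 \<and> l1 = l2" "N_mon_zero T \<longleftrightarrow> \<kappa> = 0"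
proof -
  have T: "holo_bundle T" "holo_connection T" using te by (auto simp: te_structure_def)
  have growth: "moderate_growth T \<sigma>" if "\<sigma> \<in> germs0 T" for \<sigma>
    using rs that unfolding regular_singular_def by blast
  \<comment> \<open>That \<open>H_infty T\<close> has dimension two is read off from the growth
    condition on any germ, which supplies a basis.\<close>
  obtain \<sigma>0 where "\<sigma>0 \<in> germs0 T" using germs0_basis[OF T(1)] by blast
  from moderate_growth_coords[OF growth[OF this]]
  obtain b1 b2 where b: "basis2 (H_infty T) b1 b2" by blast
  have mem: "M_mon \<sigma> \<in> H_infty T" if "\<sigma> \<in> H_infty T" for \<sigma> by (rule M_mon_H_infty[OF T(2) that])
  obtain v1 v2 c where V: "basis2 (H_infty T) v1 v2" and M: "M_mon v1 = fscale l1 v1 + fscale c v2"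
    "M_mon v2 = fscale l2 v2" "c \<noteq> 0 \<Longrightarrow> l1 = l2" and nz: "l1 \<noteq> 0" "l2 \<noteq> 0"
    using monodromy_basis[OF b eig mem] by blast
  have N: "N_mon_zero T \<longleftrightarrow> c = 0" by (rule N_mon_zero_iff[OF V M mem])
  have v: "v1 \<in> H_infty T" "v2 \<in> H_infty T" using basis2_gens[OF V] by auto
  have cdet: "cdet (v1 \<zeta>) (v2 \<zeta>) \<noteq> 0" for \<zeta>
  proof
    assume "cdet (v1 \<zeta>) (v2 \<zeta>) = 0"
    then obtain a b where ab: "a \<noteq> 0 \<or> b \<noteq> 0" "a *s v1 \<zeta> + b *s v2 \<zeta> = 0" by (rule cdet_eq_0_imp)
    have "fscale a v1 + fscale b v2 = 0"
      by (rule flat_zero[OF T basis2_mem[OF V], of _ _ \<zeta>]) (use ab(2) in \<open>simp add: fscale_def\<close>)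
    from basis2_indep[OF V this] ab(1) show False by simp
  qed
  define \<tau> where "\<tau> = 2 * of_real pi * \<i>"
  have \<tau>: "\<tau> \<noteq> 0" by (simp add: \<tau>_def)
  define ex where "ex l = - Ln l / \<tau>" for l
  have ex: "exp (- \<tau> * ex l) = l" "exp (\<tau> * ex l) = 1 / l" if "l \<noteq> 0" for l
    using that \<tau> by (simp_all add: ex_def exp_minus inverse_eq_divide)
  define a1 a2 where "a1 = ex l1" and "a2 = ex l2"
  \<comment> \<open>A translation by \<open>\<tau>\<close> adds \<open>C * \<tau>\<close> to the
    linear term, and this has to cancel the off-diagonal contribution \<open>c / l1\<close>. The
    factor \<open>d\<close> rescales the second section so that the nilpotent entry becomes
    1.\<close>
  define C where "C = - c / (\<tau> * l1)"
  define \<kappa> :: complex where "\<kappa> = (if c = 0 then 0 else 1)"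
  define d where "d = (if c = 0 then 1 else C)"
  have C: "C = \<kappa> * d" "C * a1 = C * a2" and d: "d \<noteq> 0"
    using M(3) nz \<tau> by (auto simp: \<kappa>_def d_def C_def a1_def a2_def)
  have v_per: "v1 (\<zeta> + \<tau>) = l1 *s v1 \<zeta> + c *s v2 \<zeta>" "v2 (\<zeta> + \<tau>) = l2 *s v2 \<zeta>" for \<zeta>
    using fun_cong[OF M(1), of \<zeta>] fun_cong[OF M(2), of \<zeta>] by (simp_all add: M_mon_def fscale_def \<tau>_def)
  have exp_per: "exp (a1 * (\<zeta> + \<tau>)) = exp (a1 * \<zeta>) / l1" "exp (a2 * (\<zeta> + \<tau>)) = exp (a2 * \<zeta>) / l2" for \<zeta>
    using ex(2)[OF nz(1)] ex(2)[OF nz(2)] by (simp_all add: a1_def a2_def distrib_left exp_add mult.commute)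
  text \<open>The term linear in \<open>\<zeta>\<close> compensates the unipotent part of the monodromy.\<close>
  define m1 where "m1 = (\<lambda>\<zeta>. exp (a1 * \<zeta>) *s v1 \<zeta> + (C * \<zeta> * exp (a2 * \<zeta>)) *s v2 \<zeta>)"
  define m2 where "m2 = (\<lambda>\<zeta>. 0 *s v1 \<zeta> + (d * exp (a2 * \<zeta>)) *s v2 \<zeta>)"
  define e1 where "e1 = (\<lambda>z. if z = 0 then 0 else m1 (Ln z))"
  define e2 where "e2 = (\<lambda>z. if z = 0 then 0 else m2 (Ln z))"
  have per1: "m1 (\<zeta> + 2 * of_real pi * \<i>) = m1 \<zeta>" for \<zeta>
  proof -
    have "exp (a1 * \<zeta>) / l1 * c + C * (\<zeta> + \<tau>) * (exp (a2 * \<zeta>) / l2) * l2 = C * \<zeta> * exp (a2 * \<zeta>)"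
      using nz \<tau> M(3) by (cases "c = 0") (auto simp: C_def a1_def a2_def field_simps)
    moreover have "m1 (\<zeta> + \<tau>) = (exp (a1 * \<zeta>) / l1 * l1) *s v1 \<zeta> +
        (exp (a1 * \<zeta>) / l1 * c + C * (\<zeta> + \<tau>) * (exp (a2 * \<zeta>) / l2) * l2) *s v2 \<zeta>"
      unfolding m1_def v_per exp_per by (simp add: vec_eq_iff algebra_simps)
    ultimately show ?thesis using nz by (simp add: m1_def \<tau>_def)
  qed
  have per2: "m2 (\<zeta> + 2 * of_real pi * \<i>) = m2 \<zeta>" for \<zeta>
  proof -
    have "m2 (\<zeta> + \<tau>) = m2 \<zeta>"
      unfolding m2_def v_per exp_per using nz by simp
    thus ?thesis by (simp add: \<tau>_def)
  qed
  have der: "((\<lambda>\<zeta>. exp (a1 * \<zeta>)) has_field_derivative a1 * exp (a1 * \<zeta>)) (at \<zeta>)"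
    "((\<lambda>\<zeta>. C * \<zeta> * exp (a2 * \<zeta>)) has_field_derivative C * exp (a2 * \<zeta>) + C * \<zeta> * (a2 * exp (a2 * \<zeta>))) (at \<zeta>)"
    "((\<lambda>\<zeta>. 0) has_field_derivative 0) (at \<zeta>)"
    "((\<lambda>\<zeta>. d * exp (a2 * \<zeta>)) has_field_derivative d * (a2 * exp (a2 * \<zeta>))) (at \<zeta>)" for \<zeta>
    by (auto intro!: derivative_eq_intros)
  note e1 = descend[OF T v der(1,2) m1_def per1 e1_def]
  note e2 = descend[OF T v der(3,4) m2_def per2 e2_def]
  have fr: "te_frame T e1 e2 a1 a2 \<kappa> 0"
  proof
    show "te_structure T" by (rule te)
    show "e1 \<in> hol_sections T (- {0})" "e2 \<in> hol_sections T (- {0})" using e1(1) e2(1) .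
    show "e1 0 = 0" "e2 0 = 0" by (simp_all add: e1_def e2_def)
    show "\<kappa> \<noteq> 0 \<Longrightarrow> a1 = a2 + of_nat 0"
      using M(3) by (auto simp: \<kappa>_def a1_def a2_def split: if_splits)
    fix z :: complex assume z: "z \<noteq> 0"
    define \<zeta> where "\<zeta> = Ln z"
    have z\<zeta>: "z = exp \<zeta>" using z by (simp add: \<zeta>_def)
    have "cdet (e1 z) (e2 z) = exp (a1 * \<zeta>) * (d * exp (a2 * \<zeta>)) * cdet (v1 \<zeta>) (v2 \<zeta>)"
      unfolding z\<zeta> e1(2) e2(2) m1_def m2_def by (simp add: cdet_def algebra_simps)
    thus "cdet (e1 z) (e2 z) \<noteq> 0" using cdet d by simp
    have ea: "C * \<zeta> * (a2 * exp (a2 * \<zeta>)) = a1 * (C * \<zeta> * exp (a2 * \<zeta>))"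
      using arg_cong[OF C(2), of "\<lambda>x. x * (\<zeta> * exp (a2 * \<zeta>))"] by (auto simp: mult_ac)
    show "z *s nabla T e1 z = a1 *s e1 z + (\<kappa> * z ^ 0) *s e2 z"
      unfolding z\<zeta> e1(2,3) e2(2) m1_def m2_def ea by (simp add: C(1) vec_eq_iff algebra_simps)
    show "z *s nabla T e2 z = a2 *s e2 z"
      unfolding z\<zeta> e2(2,3) m2_def by (simp add: vec_eq_iff mult_ac)
  qed
  interpret f: te_frame T e1 e2 a1 a2 \<kappa> 0 by (rule fr)
  have mero: "mero_frame T e1 e2 a1 a2 \<kappa> 0"
  proof
    fix \<sigma> assume \<sigma>: "\<sigma> \<in> germs0 T"
    obtain U \<rho> where U: "open U" "0 \<in> U" "\<rho> \<in> hol_sections T U" "eventually (\<lambda>z. \<sigma> z = \<rho> z) (at 0)"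
      using \<sigma> by (rule germs0E)
    obtain r where r: "r > 0" "ball 0 r \<subseteq> U" using U(1,2) openE by blast
    have o: "open (ball 0 r - {0 :: complex})" "0 \<notin> ball 0 r - {0 :: complex}" by auto
    have "\<rho> \<in> hol_sections T (ball 0 r - {0})" by (rule hs_mono[OF U(3)]) (use r in blast)
    from f.coords[OF o this] obtain p q where pq: "p holomorphic_on ball 0 r - {0}" "q holomorphic_on ball 0 r - {0}"
      "\<And>z. z \<in> ball 0 r - {0} \<Longrightarrow> \<rho> z = p z *s e1 z + q z *s e2 z" by blast
    have "eventually (\<lambda>z. z \<in> ball 0 r - {0}) (at (0 :: complex))"
      using eventually_norm_less[OF r(1)] by eventually_elim simp
    hence \<sigma>_eq: "eventually (\<lambda>z. \<sigma> z = p z *s e1 z + q z *s e2 z) (at 0)"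
      using U(4)
    proof eventually_elim
      case (elim z)
      show ?case unfolding elim(2) by (rule pq(3)[OF elim(1)])
    qed
    obtain B1 B2 c1 c2 where B: "basis2 (H_infty T) B1 B2" and c: "tempered c1" "tempered c2"
      and ev: "eventually (\<lambda>z. \<sigma> z = c1 z *s B1 (Ln z) + c2 z *s B2 (Ln z)) (at 0)"
      using growth[OF \<sigma>] by (rule moderate_growth_coords)
    \<comment> \<open>Each germ comes with a basis of its own; its coefficients are rewritten in the
      common basis \<open>v1, v2\<close>.\<close>
    have "B1 \<in> H_infty T" "B2 \<in> H_infty T" using basis2_gens[OF B] by auto
    then obtain x1 y1 x2 y2 where Bv: "B1 = fscale x1 v1 + fscale y1 v2" "B2 = fscale x2 v1 + fscale y2 v2"
      using basis2E[OF V] by metis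
    define P where "P = (\<lambda>z. c1 z * x1 + c2 z * x2)"
    define Q where "Q = (\<lambda>z. c1 z * y1 + c2 z * y2)"
    have PQ: "tempered P" "tempered Q"
      unfolding P_def Q_def by (intro tempered_add tempered_mult c tempered_const)+
    \<comment> \<open>The relation between the two frames is inverted, which expresses the frame
      coordinates \<open>p, q\<close> by \<open>P, Q\<close> and functions of polynomial
      growth.\<close>
    have "eventually (\<lambda>z. P z * exp (- a1 * Ln z) = p z \<and>
        Q z * exp (- a2 * Ln z) * (1 / d) + (- \<kappa>) * (Ln z * (P z * exp (- a1 * Ln z))) = q z) (at 0)"
      using ev \<sigma>_eq eventually_norm_less[of 1, OF zero_less_one]
    proof eventually_elim
      case (elim z)
      define \<zeta> where "\<zeta> = Ln z"
      have z\<zeta>: "z = exp \<zeta>" using elim(3) by (simp add: \<zeta>_def)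
      have "P z *s v1 \<zeta> + Q z *s v2 \<zeta> = c1 z *s B1 \<zeta> + c2 z *s B2 \<zeta>"
        unfolding P_def Q_def Bv \<zeta>_def by (simp add: fscale_def vec_eq_iff algebra_simps)
      also have "\<dots> = p z *s m1 \<zeta> + q z *s m2 \<zeta>"
        using elim(1,2) e1(2)[of \<zeta>] e2(2)[of \<zeta>] unfolding z\<zeta>[symmetric] \<zeta>_def[symmetric] by simp
      also have "\<dots> = (p z * exp (a1 * \<zeta>)) *s v1 \<zeta> +
          (p z * (C * \<zeta> * exp (a2 * \<zeta>)) + q z * (d * exp (a2 * \<zeta>))) *s v2 \<zeta>"
        unfolding m1_def m2_def by (simp add: vec_eq_iff algebra_simps)
      finally have PQz: "P z = p z * exp (a1 * \<zeta>)"
        "Q z = p z * (C * \<zeta> * exp (a2 * \<zeta>)) + q z * (d * exp (a2 * \<zeta>))"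
        unfolding vec_comb_eq_iff[OF cdet] by auto
      have ee: "exp (a * \<zeta>) * exp (- a * \<zeta>) = 1" for a by (simp flip: exp_add)
      have p: "P z * exp (- a1 * \<zeta>) = p z" unfolding PQz using ee[of a1] by (simp add: mult.assoc)
      have "Q z * exp (- a2 * \<zeta>) = (p z * C * \<zeta> + q z * d) * (exp (a2 * \<zeta>) * exp (- a2 * \<zeta>))"
        unfolding PQz by (simp add: algebra_simps)
      hence "Q z * exp (- a2 * \<zeta>) * (1 / d) = p z * \<kappa> * \<zeta> + q z"
        unfolding ee C(1) using d by (simp add: field_simps)
      thus ?case unfolding \<zeta>_def[symmetric] p by simp
    qed
    hence pe: "eventually (\<lambda>z. P z * exp (- a1 * Ln z) = p z) (at 0)"
      and qe: "eventually (\<lambda>z. Q z * exp (- a2 * Ln z) * (1 / d) +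
        (- \<kappa>) * (Ln z * (P z * exp (- a1 * Ln z))) = q z) (at 0)"
      by (simp_all add: eventually_conj_iff)
    have "tempered p"
      by (rule tempered_cong[OF _ pe]) (intro tempered_mult PQ tempered_exp_Ln)
    moreover have "tempered q"
      by (rule tempered_cong[OF _ qe])
        (intro tempered_add tempered_mult PQ tempered_const tempered_Ln tempered_exp_Ln)
    ultimately obtain F G where "p has_laurent_expansion F" "q has_laurent_expansion G"
      using tempered_imp_expansion[OF pq(1) r(1)] tempered_imp_expansion[OF pq(2) r(1)] by blast
    thus "\<exists>v. f.crd \<sigma> v" using f.crdI[of p "(F, G)" q \<sigma>] \<sigma>_eq by auto
  qed
  show ?thesis
  proof (rule that[OF mero])
    show "exp (- 2 * of_real pi * \<i> * a1) = l1" "exp (- 2 * of_real pi * \<i> * a2) = l2"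
      using ex(1)[OF nz(1)] ex(1)[OF nz(2)] by (simp_all add: a1_def a2_def \<tau>_def)
    show "l1 = l2 \<longrightarrow> a1 = a2" by (simp add: a1_def a2_def)
    show "\<kappa> = 0 \<or> \<kappa> = 1 \<and> l1 = l2" using M(3) by (auto simp: \<kappa>_def)
    show "N_mon_zero T \<longleftrightarrow> \<kappa> = 0" unfolding N by (simp add: \<kappa>_def)
  qed
qed

section \<open>Normalising the frame by a cyclic germ\<close>

lemma exp_shift_int:
  "exp (- 2 * of_real pi * \<i> * (x + of_int i)) = exp (- 2 * of_real pi * \<i> * x)"
proof -
  have "exp (2 * of_real pi * \<i> * of_int (- i)) = 1" unfolding exp_2pi_eq_1_iff by simp
  moreover have "- 2 * of_real pi * \<i> * (x + of_int i) =
      - 2 * of_real pi * \<i> * x + 2 * of_real pi * \<i> * of_int (- i)" by (simp add: algebra_simps)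
  ultimately show ?thesis by (simp only: exp_add mult_1_right)
qed

lemma shift_reg:
  assumes "cvg F" "ordge m F"
  shows "reg (fls_X_intpow (- m) * F)" "fls_nth (fls_X_intpow (- m) * F) 0 = fls_nth F m"
proof -
  have "fls_nth (fls_X_intpow (- m) * F) k = fls_nth F (k + m)" for k
    by (subst fls_X_intpow_times_conv_shift(1)) simp
  moreover have "cvg (fls_X_intpow (- m) * F)" by (rule cvg_mult[OF cvg_const(5) assms(1)])
  ultimately show "fls_nth (fls_X_intpow (- m) * F) 0 = fls_nth F m"
    "reg (fls_X_intpow (- m) * F)"
    using assms(2) unfolding reg_def fls_nonneg_iff ordge_def by simp_all
qed

context mero_frame
begin

text \<open>The leading exponents are read off from the orders of the two coordinates of a cyclic germ. If
  \<open>\<alpha>1 = \<alpha>2\<close>, every constant change of the frame is allowed and is used to make the two orders different.\<close>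

lemma normal_ss:
  assumes "\<not> logarithmic T" "\<kappa> = 0" "k = 0" and int: "\<alpha>1 - \<alpha>2 \<in> \<int> \<Longrightarrow> \<alpha>1 = \<alpha>2"
  shows "\<exists>t1 t2 m n. mero_frame T t1 t2 (\<alpha>1 + of_int m) (\<alpha>2 + of_int n) 0 0 \<and>
    \<alpha>1 + of_int m \<noteq> \<alpha>2 + of_int n \<and> te_frame.Lat T t1 t2 = lat (1, 1) (0, fls_X)"
proof -
  obtain \<sigma> where \<sigma>: "\<sigma> \<in> germs0 T" "germ_basis T \<sigma> (\<lambda>z. z\<^sup>2 *s nabla T \<sigma> z)"
    using assms(1) by (rule cyclic_germ)
  obtain F G where FG: "crd \<sigma> (F, G)" using mero[OF \<sigma>(1)] by auto
  have "pdet (F, G) (psmul fls_X (D (F, G))) \<noteq> 0"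
    using Lat_eq_imp_det germ_basis_iff[OF FG crd_z2_nabla[OF FG]] \<sigma>(2) by blast
  hence det: "F * (theta G + fls_const \<alpha>2 * G) - G * (theta F + fls_const \<alpha>1 * F) \<noteq> 0"
    by (simp add: pdet_def delta_def assms(2,3))
  have G: "G \<noteq> 0" and F: "F \<noteq> 0" using det by (auto simp: theta_def)
  define n where "n = fls_subdegree G"
  \<comment> \<open>Subtracting this multiple of \<open>G\<close> cancels the leading coefficient of
    \<open>F\<close>. In all cases with \<open>c = 0\<close> by default, the shifted exponents
    differ already.\<close>
  define c where "c = (if \<alpha>1 = \<alpha>2 \<and> fls_subdegree F = n then fls_nth F n / fls_nth G n else 0)"
  define F' where "F' = F - fls_const c * G"
  define m where "m = fls_subdegree F'"
  have gn: "fls_nth G n \<noteq> 0" using G by (simp add: n_def)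
  have c: "c = 0 \<or> \<alpha>1 = \<alpha>2" by (auto simp: c_def)
  have F': "F' \<noteq> 0"
  proof
    assume "F' = 0"
    hence eq: "F = fls_const c * G" by (simp add: F'_def)
    have "c \<noteq> 0" using F eq by auto
    hence "\<alpha>1 = \<alpha>2" using c by blast
    thus False using det unfolding eq theta_mult by (simp add: algebra_simps)
  qed
  hence fm: "fls_nth F' m \<noteq> 0" by (simp add: m_def)
  have neq: "\<alpha>1 + of_int m \<noteq> \<alpha>2 + of_int n"
  proof
    assume eq: "\<alpha>1 + of_int m = \<alpha>2 + of_int n"
    hence "\<alpha>1 - \<alpha>2 = of_int (n - m)" by (simp add: algebra_simps)
    hence a: "\<alpha>1 = \<alpha>2" using int by simp
    hence mn: "m = n" using eq by simp
    show False
    proof (cases "fls_subdegree F = n")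
      case True
      hence "fls_nth F' n = 0" using a gn by (simp add: F'_def c_def)
      thus False using fm mn by simp
    next
      case False
      hence "F' = F" by (simp add: F'_def c_def)
      thus False using False mn m_def by simp
    qed
  qed
  define f0 g0 where "f0 = fls_nth F' m" and "g0 = fls_nth G n"
  have fg0: "f0 \<noteq> 0" "g0 \<noteq> 0" using fm gn by (simp_all add: f0_def g0_def)
  have x: "f0 * g0 - 0 * (c * g0) \<noteq> 0" "c * g0 = 0 \<or> \<kappa> = 0 \<and> \<alpha>1 = \<alpha>2" "0 = (0 :: complex) \<or> \<alpha>1 = \<alpha>2"
    "\<kappa> \<noteq> 0 \<Longrightarrow> f0 = g0 \<and> m = n + int 0" using fg0 c assms(2) by auto
  \<comment> \<open>Since \<open>F s1 + G s2 = (F - c G) s1 + G (c s1 + s2)\<close>, the new frame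
    consists of \<open>s1\<close> and \<open>c s1 + s2\<close>, shifted by the orders and scaled by
    the leading coefficients. Both new coordinates then have the value 1 at 0.\<close>
  let ?t1 = "t1 m f0 0" and ?t2 = "t2 n (c * g0) g0"
  interpret t: mero_frame T ?t1 ?t2 "\<alpha>1 + of_int m" "\<alpha>2 + of_int n" \<kappa> 0
    by (rule reframe[OF assms(3) x])
  define p where "p = fls_const (1 / f0) * (fls_X_intpow (- m) * F')"
  define q where "q = fls_const (1 / g0) * (fls_X_intpow (- n) * G)"
  have cv: "cvg F" "cvg G" using crd_pcvg[OF FG] by (simp_all add: pcvg_def)
  hence cv': "cvg F'" unfolding F'_def by (intro cvg_diff cvg_mult cvg_const)
  have o: "ordge m F'" "ordge n G" by (simp_all add: ordge_iff m_def n_def)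
  have pq: "reg p" "reg q" "fls_nth p 0 = 1" "fls_nth q 0 = 1"
    using shift_reg[OF cv' o(1)] shift_reg[OF cv(2) o(2)] fg0
    by (auto simp: p_def q_def f0_def g0_def)
  have "t.crd \<sigma> (p, q)"
  proof -
    have inv: "fls_const (1 / f0) = inverse (fls_const f0)" "fls_const (1 / g0) = inverse (fls_const g0)"
      using fg0 by (auto intro!: inverse_unique[symmetric])
    have p: "fls_X_intpow (- m) * (fls_const g0 * F - fls_const (c * g0) * G) / fls_const (f0 * g0 - 0 * (c * g0)) = p"
      unfolding p_def F'_def inv using fg0
      by (simp add: field_simps flip: fls_const_mult_const)
    have q: "fls_X_intpow (- n) * (fls_const f0 * G - fls_const 0 * F) / fls_const (f0 * g0 - 0 * (c * g0)) = q"
      unfolding q_def inv using fg0 by (simp add: field_simps flip: fls_const_mult_const)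
    show ?thesis using reframe_crd[OF assms(3) x FG] unfolding p q .
  qed
  from t.normal_Lat[OF \<sigma>(2) this pq(1,2)] have "t.Lat = lat (1, 1) (0, fls_X)"
    using pq(3,4) neq assms(2) by simp
  thus ?thesis using t.mero_frame_axioms neq unfolding assms(2) by blast
qed

text \<open>With a nilpotent part, one may still add a multiple of \<open>s2\<close> to
  \<open>s1\<close>. If \<open>G\<close> has at least the order of \<open>F\<close>, this removes
  its coefficient at that order, so \<open>k'\<close> and \<open>t\<close> are 0. Otherwise the
  difference of the orders becomes \<open>k'\<close>, and the nonzero quotient of the leading
  coefficients becomes \<open>t\<close>.\<close>

lemma normal_nss:
  assumes "\<not> logarithmic T" "\<kappa> = 1" "k = 0"
  shows "\<exists>t1 t2 n k' t. mero_frame T t1 t2 (\<alpha>2 + of_int n + of_nat k') (\<alpha>2 + of_int n) 1 k' \<and>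
    te_frame.Lat T t1 t2 = lat (1, fls_const t) (0, fls_X) \<and> (t = 0 \<longleftrightarrow> k' = 0)"
proof -
  have a: "\<alpha>1 = \<alpha>2" using deg assms by simp
  obtain \<sigma> where \<sigma>: "\<sigma> \<in> germs0 T" "germ_basis T \<sigma> (\<lambda>z. z\<^sup>2 *s nabla T \<sigma> z)"
    using assms(1) by (rule cyclic_germ)
  obtain F G where FG: "crd \<sigma> (F, G)" using mero[OF \<sigma>(1)] by auto
  have "pdet (F, G) (psmul fls_X (D (F, G))) \<noteq> 0"
    using Lat_eq_imp_det germ_basis_iff[OF FG crd_z2_nabla[OF FG]] \<sigma>(2) by blast
  hence F: "F \<noteq> 0" by (auto simp: pdet_def delta_def theta_def)
  define m where "m = fls_subdegree F"
  have fm: "fls_nth F m \<noteq> 0" using F by (simp add: m_def)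
  have cv: "cvg F" "cvg G" using crd_pcvg[OF FG] by (simp_all add: pcvg_def)
  have oF: "ordge m F" by (simp add: ordge_iff m_def)
  show ?thesis
  proof (cases "ordge m G")
    case True
    define y where "y = fls_nth G m / fls_nth F m"
    have x: "1 * 1 - y * 0 \<noteq> (0 :: complex)" "0 = (0 :: complex) \<or> \<kappa> = 0 \<and> \<alpha>1 = \<alpha>2" "y = 0 \<or> \<alpha>1 = \<alpha>2"
      "\<kappa> \<noteq> 0 \<Longrightarrow> (1 :: complex) = 1 \<and> m = m + int 0" using a by auto
    interpret t: mero_frame T "t1 m 1 y" "t2 m 0 1" "\<alpha>1 + of_int m" "\<alpha>2 + of_int m" \<kappa> 0
      by (rule reframe[OF assms(3) x])
    define p q where "p = fls_X_intpow (- m) * F" and "q = fls_X_intpow (- m) * (G - fls_const y * F)"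
    have oG: "ordge m (G - fls_const y * F)" "cvg (G - fls_const y * F)"
      using True oF cv by (auto simp: ordge_def)
    have "reg p" "reg q" "fls_nth p 0 \<noteq> 0" "fls_nth q 0 = 0"
      using shift_reg[OF cv(1) oF] shift_reg[OF oG(2,1)] fm by (auto simp: p_def q_def y_def)
    moreover have "t.crd \<sigma> (p, q)"
      using reframe_crd[OF assms(3) x FG] by (simp add: p_def q_def)
    ultimately have "t.Lat = lat (1, fls_const 0) (0, fls_X)"
      using t.normal_Lat[OF \<sigma>(2), of p q] assms(2) by simp
    moreover have "mero_frame T (t1 m 1 y) (t2 m 0 1) (\<alpha>2 + of_int m + of_nat 0) (\<alpha>2 + of_int m) 1 0"
      using t.mero_frame_axioms a assms(2) by simp
    ultimately show ?thesis by blast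
  next
    case False
    hence G: "G \<noteq> 0" "fls_subdegree G < m" by (auto simp: ordge_iff)
    define n where "n = fls_subdegree G"
    define k' where "k' = nat (m - n)"
    have k': "m = n + int k'" "k' \<noteq> 0" using G by (auto simp: k'_def n_def)
    have x: "1 * 1 - 0 * 0 \<noteq> (0 :: complex)" "0 = (0 :: complex) \<or> \<kappa> = 0 \<and> \<alpha>1 = \<alpha>2"
      "0 = (0 :: complex) \<or> \<alpha>1 = \<alpha>2"
      "\<kappa> \<noteq> 0 \<Longrightarrow> (1 :: complex) = 1 \<and> m = n + int k'" using k' by auto
    interpret t: mero_frame T "t1 m 1 0" "t2 n 0 1" "\<alpha>1 + of_int m" "\<alpha>2 + of_int n" \<kappa> k'
      by (rule reframe[OF assms(3) x])
    define p q where "p = fls_X_intpow (- m) * F" and "q = fls_X_intpow (- n) * G"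
    have oG: "ordge n G" by (simp add: ordge_iff n_def)
    have pq: "reg p" "reg q" "fls_nth p 0 \<noteq> 0" "fls_nth q 0 \<noteq> 0"
      using shift_reg[OF cv(1) oF] shift_reg[OF cv(2) oG] fm G by (auto simp: p_def q_def n_def)
    moreover have "t.crd \<sigma> (p, q)"
      using reframe_crd[OF assms(3) x FG] by (simp add: p_def q_def)
    moreover have e: "\<alpha>1 + of_int m = \<alpha>2 + of_int n + of_nat k'" using a k' by simp
    ultimately have "t.Lat = lat (1, fls_const (fls_nth q 0 / fls_nth p 0)) (0, fls_X)"
      using t.normal_Lat[OF \<sigma>(2), of p q] k' by simp
    moreover have "mero_frame T (t1 m 1 0) (t2 n 0 1) (\<alpha>2 + of_int n + of_nat k') (\<alpha>2 + of_int n) 1 k'"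
      using t.mero_frame_axioms assms(2) unfolding e by simp
    moreover have "fls_nth q 0 / fls_nth p 0 = 0 \<longleftrightarrow> k' = 0" using pq k' by simp
    ultimately show ?thesis by blast
  qed
qed

end

section \<open>Uniqueness\<close>

lemma zpF_nth: "fls_nth (zpF c) j = (if c = of_int j then 1 else 0)"
  by (auto simp: zpF_def elim!: Ints_cases)

lemma zpF_of_int [simp]: "zpF (of_int n) = fls_X_intpow n"
  by (simp add: zpF_def)

lemma zpF_0 [simp]: "zpF 0 = 1"
  using zpF_of_int[of 0] by (simp del: zpF_of_int)

lemma zpF_of_nat [simp]: "zpF (of_nat n) = fls_X ^ n"
  using zpF_of_int[of "int n"] by (simp del: zpF_of_int add: fls_X_power_conv_shift_1)

lemma lat_eq_unit:
  assumes "lat v w = lat v' w'" "pdet v w \<noteq> 0"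
  obtains d d' where "reg d" "reg d'" "d * d' = 1" "pdet v' w' = d * pdet v w"
proof -
  have "v' \<in> lat v w" "w' \<in> lat v w" using lat_gens(1)[of v' w'] lat_gens(2)[of w' v'] assms(1) by auto
  then obtain d where d: "reg d" "pdet v' w' = d * pdet v w" by (rule lat_det)
  have "v \<in> lat v' w'" "w \<in> lat v' w'" using lat_gens(1)[of v w] lat_gens(2)[of w v] assms(1) by auto
  then obtain d' where d': "reg d'" "pdet v w = d' * pdet v' w'" by (rule lat_det)
  have "1 * pdet v w = (d * d') * pdet v w" using d(2) d'(2) by (simp add: mult_ac)
  hence "d * d' = 1" using assms(2) by (metis mult_right_cancel)
  thus ?thesis using that d d' by blast
qed

lemma unit_nth0: "reg d \<Longrightarrow> reg d' \<Longrightarrow> d * d' = 1 \<Longrightarrow> fls_nth d 0 \<noteq> 0"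
  using reg_nth0_mult[of d d'] by auto

lemma lat_1t_D:
  assumes "u \<in> lat (1, fls_const t) (0, fls_X)"
  shows "reg (fst u)" "reg (snd u)"
proof -
  obtain p q where pq: "reg p" "reg q" "u = psmul p (1, fls_const t) + psmul q (0, fls_X)"
    using assms by (rule latE)
  show "reg (fst u)" "reg (snd u)" unfolding pq(3) using pq(1,2) by (auto simp: psmul_def)
qed

text \<open>Multiples of the second generator change \<open>H\<close> by multiples of
  \<open>fls_X\<close>, so the lattice remembers only the value of \<open>H\<close> at 0 relative to
  \<open>c\<close>.\<close>

lemma lat_1t_eq_iff:
  assumes "c \<noteq> 0" "reg H"
  shows "lat (1, fls_const t) (0, fls_X) = lat (fls_const c, H) (0, fls_X * fls_const c) \<longleftrightarrow>
     fls_nth H 0 = t * c"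
proof
  assume "lat (1, fls_const t) (0, fls_X) = lat (fls_const c, H) (0, fls_X * fls_const c)"
  hence "(fls_const c, H) \<in> lat (1, fls_const t) (0, fls_X)"
    using lat_gens(1)[of "(fls_const c, H)" "(0, fls_X * fls_const c)"] by simp
  then obtain p q where pq: "reg p" "reg q"
    "(fls_const c, H) = psmul p (1, fls_const t) + psmul q (0, fls_X)" by (rule latE)
  have "p = fls_const c" "H = p * fls_const t + q * fls_X"
    using pq(3) by (simp_all add: psmul_def)
  hence H: "H = fls_const (c * t) + q * fls_X" by simp
  have "fls_nth (q * fls_X) 0 = 0" using reg_nth0_mult[OF pq(2), of fls_X] by simp
  thus "fls_nth H 0 = t * c" unfolding H by (simp add: mult.commute)
next
  assume H0: "fls_nth H 0 = t * c"
  have "reg (H - fls_const (c * t))" "fls_nth (H - fls_const (c * t)) 0 = 0"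
    using assms(2) H0 by auto
  then obtain r where r: "reg r" "H - fls_const (c * t) = fls_X * r" by (rule reg_X_factor)
  have H: "H = fls_const (c * t) + fls_X * r" using r(2) by (simp add: algebra_simps)
  have "lat (fls_const c, H) (0, fls_X * fls_const c) = lat (1, fls_const t) (0, fls_X)"
  proof (rule lat_eqI)
    show "(fls_const c, H) \<in> lat (1, fls_const t) (0, fls_X)"
      by (rule latI[of "fls_const c" r]) (use r(1) H in \<open>auto simp: psmul_def mult.commute\<close>)
    show "(0, fls_X * fls_const c) \<in> lat (1, fls_const t) (0, fls_X)"
      by (rule latI[of 0 "fls_const c"]) (auto simp: psmul_def mult.commute)
    show "pdet (1, fls_const t) (0, fls_X) \<noteq> 0" by (simp add: pdet_def)
    show "pdet (fls_const c, H) (0, fls_X * fls_const c) = fls_const (c * c) * pdet (1, fls_const t) (0, fls_X)"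
      by (simp add: pdet_def mult_ac flip: fls_const_mult_const)
  qed (use assms(1) in auto)
  thus "lat (1, fls_const t) (0, fls_X) = lat (fls_const c, H) (0, fls_X * fls_const c)" ..
qed

lemma intpow_mult: "fls_X_intpow i * fls_X_intpow j = (fls_X_intpow (i + j) :: complex fls)"
  by (simp add: fls_X_intpow_times_fls_X_intpow)

lemma intpow_unit:
  assumes "reg d" "reg d'" "d * d' = 1" "d = fls_const c * fls_X_intpow i" 
  shows "i = 0"
proof -
  have "fls_nth d 0 \<noteq> 0" by (rule unit_nth0[OF assms(1-3)])
  hence "fls_nth (fls_X_intpow i :: complex fls) 0 \<noteq> 0" unfolding assms(4) by auto
  thus ?thesis by (simp split: if_splits)
qed

section \<open>Semisimple monodromy\<close>

lemma leading_exponents_ss_swap: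
  "leading_exponents_ss T l l a b \<Longrightarrow> leading_exponents_ss T l l b a"
  unfolding leading_exponents_ss_def
  by (metis inverse_inverse_eq nonzero_imp_inverse_nonzero)

context mero_frame
begin

lemma frame_el: "s1 = el \<alpha>1 1 0" "s2 = el \<alpha>2 0 1"
  by (simp_all add: el_def)

lemma crd_s1: "crd s1 (1, 0)" and crd_s2: "crd s2 (0, 1)"
  using crd_el[of \<alpha>1 1 0] crd_el[of \<alpha>2 0 1] by (simp_all flip: frame_el)

lemma frame_swap:
  assumes "\<kappa> = 0"
  shows "mero_frame T s2 s1 \<alpha>2 \<alpha>1 \<kappa> k"
proof -
  interpret t: te_frame T s2 s1 \<alpha>2 \<alpha>1 \<kappa> k
  proof
    show "te_structure T" by (rule te)
    show "s2 \<in> hol_sections T (- {0})" "s2 0 = 0" by (rule s2)+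
    show "s1 \<in> hol_sections T (- {0})" "s1 0 = 0" by (rule s1)+
    show "\<kappa> \<noteq> 0 \<Longrightarrow> \<alpha>2 = \<alpha>1 + of_nat k" using assms by simp
    fix z :: complex assume z: "z \<noteq> 0"
    show "cdet (s2 z) (s1 z) \<noteq> 0" using indep[OF z] by (simp add: cdet_def algebra_simps)
    show "z *s nabla T s2 z = \<alpha>2 *s s2 z + (\<kappa> * z ^ k) *s s1 z" using nab2[OF z] assms by simp
    show "z *s nabla T s1 z = \<alpha>1 *s s1 z" using nab1[OF z] assms by simp
  qed
  show ?thesis
  proof
    fix \<sigma> assume "\<sigma> \<in> germs0 T"
    then obtain v where "crd \<sigma> v" using mero by blast
    then obtain f g where fg: "f has_laurent_expansion fst v" "g has_laurent_expansion snd v"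
      "eventually (\<lambda>z. \<sigma> z = f z *s s1 z + g z *s s2 z) (at 0)" by (rule crdE)
    have "t.crd \<sigma> (snd v, fst v)"
      by (rule t.crdI[of g _ f]) (use fg in \<open>simp_all add: add.commute\<close>)
    thus "\<exists>v. t.crd \<sigma> v" by blast
  qed
qed

text \<open>The lattice is symmetric in \<open>s1\<close> and \<open>s2\<close>: \<open>z\<close>
  times \<open>s1\<close> is \<open>z\<close> times the sum minus \<open>z\<close> times
  \<open>s2\<close>.\<close>

lemma ss_basis:
  assumes "Lat = lat (1, 1) (0, fls_X)"
  shows "germ_basis T (s1 + s2) (zpow_mult 1 s2)" "germ_basis T (s2 + s1) (zpow_mult 1 s1)"
proof -
  have c: "crd (s1 + s2) (1, 1)" "crd (s2 + s1) (1, 1)" "crd (zpow_mult 1 s2) (0, fls_X)"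
    "crd (zpow_mult 1 s1) (fls_X, 0)"
    using crd_add[OF crd_s1 crd_s2] crd_add[OF crd_s2 crd_s1] crd_zpow[OF crd_s2, of 1] crd_zpow[OF crd_s1, of 1]
    by (simp_all add: psmul_def)
  show "germ_basis T (s1 + s2) (zpow_mult 1 s2)" using germ_basis_iff[OF c(1,3)] assms by simp
  have "lat (1, 1) (fls_X, 0) = lat (1, 1) (0, fls_X)"
  proof (rule lat_eqI)
    show "(fls_X, 0) \<in> lat (1, 1) (0, fls_X)"
      by (rule latI[of fls_X "-1"]) (auto simp: psmul_def)
    show "pdet (1, 1) (fls_X, 0) = (- 1) * pdet (1, 1) (0, fls_X)" by (simp add: pdet_def)
  qed (auto simp: pdet_def lat_gens)
  thus "germ_basis T (s2 + s1) (zpow_mult 1 s1)" using germ_basis_iff[OF c(2,4)] assms by simp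
qed

lemma swap_Lat:
  assumes "\<kappa> = 0" "Lat = lat (1, 1) (0, fls_X)"
  shows "te_frame.Lat T s2 s1 = lat (1, 1) (0, fls_X)"
proof -
  interpret t: mero_frame T s2 s1 \<alpha>2 \<alpha>1 \<kappa> k by (rule frame_swap[OF assms(1)])
  have "t.crd (s2 + s1) (1, 1)" "t.crd (zpow_mult 1 s1) (0, fls_X)"
    using t.crd_add[OF t.crd_s1 t.crd_s2] t.crd_zpow[OF t.crd_s2, of 1] by (simp_all add: psmul_def)
  thus ?thesis using t.germ_basis_iff ss_basis(2)[OF assms(2)] by blast
qed

lemma ss_leading:
  assumes "Lat = lat (1, 1) (0, fls_X)" "\<alpha>1 \<noteq> \<alpha>2"
    "exp (- 2 * of_real pi * \<i> * \<alpha>1) = l1" "exp (- 2 * of_real pi * \<i> * \<alpha>2) = l2"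
  shows "leading_exponents_ss T l1 l2 \<alpha>1 \<alpha>2"
proof -
  have nz: "s1 \<noteq> 0" "s2 \<noteq> 0" using indep[of 1] by (auto simp: cdet_def)
  have mem: "s1 \<in> elementary T \<alpha>1" "s2 \<in> elementary T \<alpha>2"
    unfolding elementary_eq using frame_el by blast+
  have "germ_basis T (s1 + fscale 1 s2) (zpow_mult 1 s2)"
    "germ_basis T (s2 + fscale (inverse 1) s1) (zpow_mult 1 s1)"
    using ss_basis[OF assms(1)] by simp_all
  thus ?thesis unfolding leading_exponents_ss_def
    using assms nz mem by (intro conjI bexI[of _ s1] bexI[of _ s2] exI[of _ 1]) auto
qed

text \<open>Both pairs of exponents have the same sum by comparison of determinants, and all exponent differences that
  occur in the change of frame are nonnegative integers.\<close>

lemma ss_unique: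
  assumes Lat: "Lat = lat (1, 1) (0, fls_X)" and lead: "leading_exponents_ss T l1' l2' \<beta>1 \<beta>2"
  shows "(\<beta>1, \<beta>2) = (\<alpha>1, \<alpha>2) \<or> (\<beta>1, \<beta>2) = (\<alpha>2, \<alpha>1)"
proof -
  have neq: "\<beta>1 \<noteq> \<beta>2" using lead unfolding leading_exponents_ss_def by blast
  obtain \<sigma>1 \<sigma>2 t where s: "\<sigma>1 \<in> elementary T \<beta>1" "\<sigma>2 \<in> elementary T \<beta>2" "t \<noteq> 0"
    "germ_basis T (\<sigma>1 + fscale t \<sigma>2) (zpow_mult 1 \<sigma>2)"
    using lead unfolding leading_exponents_ss_def by blast
  obtain A B where AB: "\<sigma>1 = el \<beta>1 A B" using s(1) unfolding elementary_eq by blast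
  obtain A' B' where AB': "\<sigma>2 = el \<beta>2 A' B'" using s(2) unfolding elementary_eq by blast
  define v where "v = (fls_const A * zpF (\<beta>1 - \<alpha>1) + fls_const (t * A') * zpF (\<beta>2 - \<alpha>1),
                      fls_const B * zpF (\<beta>1 - \<alpha>2) + fls_const (t * B') * zpF (\<beta>2 - \<alpha>2))"
  define w where "w = (fls_X * (fls_const A' * zpF (\<beta>2 - \<alpha>1)), fls_X * (fls_const B' * zpF (\<beta>2 - \<alpha>2)))"
  have v: "crd (\<sigma>1 + fscale t \<sigma>2) v"
    using crd_add[OF crd_el[of \<beta>1 A B] crd_fscale[OF crd_el[of \<beta>2 A' B'], of t]]
    by (simp add: AB AB' v_def psmul_def mult.assoc flip: fls_const_mult_const)
  have w: "crd (zpow_mult 1 \<sigma>2) w"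
    using crd_zpow[OF crd_el[of \<beta>2 A' B'], of 1] by (simp add: AB' w_def psmul_def)
  have eq: "lat (1, 1) (0, fls_X) = lat v w" using germ_basis_iff[OF v w] s(4) Lat by simp
  have "v \<in> lat (1, fls_const 1) (0, fls_X)" using eq lat_gens(1)[of v w] by simp
  from lat_1t_D[OF this] have regv: "reg (fst v)" "reg (snd v)" .
  \<comment> \<open>As \<open>\<beta>1 \<noteq> \<beta>2\<close>, only one of the two monomials has
    exponent \<open>j\<close>, so its nonzero coefficient cannot cancel; regularity excludes
    \<open>j < 0\<close>.\<close>
  have nonneg: "0 \<le> j"
    if j: "\<beta> - \<alpha> = of_int j" and \<beta>: "\<beta> = \<beta>1 \<and> c \<noteq> 0 \<or> \<beta> = \<beta>2 \<and> c' \<noteq> 0"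
      and r: "reg (fls_const c * zpF (\<beta>1 - \<alpha>) + fls_const (t * c') * zpF (\<beta>2 - \<alpha>))"
    for \<alpha> \<beta> c c' j
  proof (rule ccontr)
    assume "\<not> 0 \<le> j"
    hence "fls_nth (fls_const c * zpF (\<beta>1 - \<alpha>) + fls_const (t * c') * zpF (\<beta>2 - \<alpha>)) j = 0"
      using r unfolding reg_def fls_nonneg_iff by simp
    hence z: "c * (if \<beta>1 - \<alpha> = of_int j then 1 else 0) + t * c' * (if \<beta>2 - \<alpha> = of_int j then 1 else 0) = 0"
      by (simp add: zpF_nth mult.assoc flip: fls_const_mult_const)
    show False using \<beta>
    proof
      assume b: "\<beta> = \<beta>1 \<and> c \<noteq> 0"
      hence "\<beta>2 - \<alpha> \<noteq> of_int j" using j neq by (metis diff_add_cancel)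
      thus False using z j b by simp
    next
      assume b: "\<beta> = \<beta>2 \<and> c' \<noteq> 0"
      hence "\<beta>1 - \<alpha> \<noteq> of_int j" using j neq by (metis diff_add_cancel)
      thus False using z j b s(3) by simp
    qed
  qed
  \<comment> \<open>Up to the common factor \<open>fls_X\<close> this is the determinant of the new
    generators. It is a unit, so one of its two monomials has exponent 0; these correspond to the
    two orderings of the exponents.\<close>
  define e where "e = fls_const (A * B') * (zpF (\<beta>1 - \<alpha>1) * zpF (\<beta>2 - \<alpha>2)) -
      fls_const (A' * B) * (zpF (\<beta>2 - \<alpha>1) * zpF (\<beta>1 - \<alpha>2))"
  have "pdet (1, 1) (0, fls_X) \<noteq> 0" by (simp add: pdet_def)
  with eq obtain d d' where d: "reg d" "reg d'" "d * d' = 1" "pdet v w = d * pdet (1, 1) (0, fls_X)"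
    by (rule lat_eq_unit)
  have "pdet v w = fls_X * e"
    unfolding v_def w_def e_def by (simp add: pdet_def algebra_simps flip: fls_const_mult_const)
  hence "d = e" using d(4) by (simp add: pdet_def)
  hence e0: "fls_nth e 0 \<noteq> 0" using unit_nth0[OF d(1-3)] by simp
  have key: "\<exists>i. a = of_int i \<and> b = of_int (- i)" if nz: "fls_nth (zpF a * zpF b) 0 \<noteq> 0" for a b
  proof -
    have "a \<in> \<int>" "b \<in> \<int>" using nz by (auto simp: zpF_def split: if_splits)
    then obtain i j where ij: "a = of_int i" "b = of_int j" by (elim Ints_cases)
    have "fls_nth (fls_X_intpow (i + j) :: complex fls) 0 \<noteq> 0"
      using nz unfolding ij zpF_of_int intpow_mult .
    hence "i + j = 0" by (simp split: if_splits)
    hence "j = - i" by simp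
    thus ?thesis using ij by blast
  qed
  have "fls_nth (fls_const (A * B') * (zpF (\<beta>1 - \<alpha>1) * zpF (\<beta>2 - \<alpha>2))) 0 \<noteq> 0 \<or>
      fls_nth (fls_const (A' * B) * (zpF (\<beta>2 - \<alpha>1) * zpF (\<beta>1 - \<alpha>2))) 0 \<noteq> 0"
    using e0 unfolding e_def by auto
  thus ?thesis
  proof
    assume h: "fls_nth (fls_const (A * B') * (zpF (\<beta>1 - \<alpha>1) * zpF (\<beta>2 - \<alpha>2))) 0 \<noteq> 0"
    hence nz: "A \<noteq> 0" "B' \<noteq> 0" and "fls_nth (zpF (\<beta>1 - \<alpha>1) * zpF (\<beta>2 - \<alpha>2)) 0 \<noteq> 0" by auto
    then obtain i where i: "\<beta>1 - \<alpha>1 = of_int i" "\<beta>2 - \<alpha>2 = of_int (- i)" using key by blast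
    have "0 \<le> i" using nonneg[OF i(1), of A A'] nz regv(1) by (simp add: v_def)
    moreover have "0 \<le> - i" using nonneg[OF i(2), of B B'] nz regv(2) by (simp add: v_def)
    ultimately have "i = 0" by simp
    thus ?thesis using i by simp
  next
    assume h: "fls_nth (fls_const (A' * B) * (zpF (\<beta>2 - \<alpha>1) * zpF (\<beta>1 - \<alpha>2))) 0 \<noteq> 0"
    hence nz: "A' \<noteq> 0" "B \<noteq> 0" and "fls_nth (zpF (\<beta>2 - \<alpha>1) * zpF (\<beta>1 - \<alpha>2)) 0 \<noteq> 0" by auto
    then obtain i where i: "\<beta>2 - \<alpha>1 = of_int i" "\<beta>1 - \<alpha>2 = of_int (- i)" using key by blast
    have "0 \<le> i" using nonneg[OF i(1), of A A'] nz regv(1) by (simp add: v_def)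
    moreover have "0 \<le> - i" using nonneg[OF i(2), of B B'] nz regv(2) by (simp add: v_def)
    ultimately have "i = 0" by simp
    thus ?thesis using i by simp
  qed
qed

end

section \<open>Non-semisimple monodromy\<close>

text \<open>The last assumption records the normalisation: for equal exponents \<open>t\<close> has
  been absorbed into \<open>s1\<close>, for different ones it is a nonzero invariant.\<close>

locale nss_frame = mero_frame T s1 s2 \<alpha>1 \<alpha>2 1 k for T s1 s2 \<alpha>1 \<alpha>2 k +
  fixes t :: complex
  assumes Lat_t: "Lat = lat (1, fls_const t) (0, fls_X)" and t0: "t = 0 \<longleftrightarrow> k = 0"
begin

lemma \<alpha>12: "\<alpha>1 = \<alpha>2 + of_nat k" using deg by simp

lemma nonker_eq: "elementary T \<alpha>1 - elementary_ker T \<alpha>1 = {el \<alpha>1 A B | A B. A \<noteq> 0}"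
proof (intro set_eqI iffI)
  have int: "\<alpha>1 - \<alpha>2 \<in> \<int>" by (simp add: \<alpha>12)
  fix \<sigma>
  {
    assume s: "\<sigma> \<in> elementary T \<alpha>1 - elementary_ker T \<alpha>1"
    then obtain A B where AB: "\<sigma> = el \<alpha>1 A B" unfolding elementary_eq by blast
    have "A \<noteq> 0" using s unfolding AB elementary_ker_eq by auto
    thus "\<sigma> \<in> {el \<alpha>1 A B | A B. A \<noteq> 0}" using AB by blast
  next
    assume "\<sigma> \<in> {el \<alpha>1 A B | A B. A \<noteq> 0}"
    then obtain A B where AB: "\<sigma> = el \<alpha>1 A B" "A \<noteq> 0" by blast
    have "\<sigma> \<notin> elementary_ker T \<alpha>1"
      unfolding elementary_ker_eq AB(1) using AB(2) int el_eq_iff[of \<alpha>1 A B] by auto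
    thus "\<sigma> \<in> elementary T \<alpha>1 - elementary_ker T \<alpha>1" using AB(1) unfolding elementary_eq by blast
  }
qed

text \<open>Applying \<open>zdz_minus\<close> removes the \<open>s2\<close> part, so only
  \<open>A\<close> survives. The factor \<open>z ^ k\<close> can be cancelled away from 0, and at 0
  elementary sections vanish by convention.\<close>

lemma companion_iff: "companion T \<alpha>1 \<alpha>2 (el \<alpha>1 A B) \<sigma> \<longleftrightarrow> \<sigma> = el \<alpha>2 0 A"
proof -
  have n: "\<alpha>1 - \<alpha>2 = of_nat n \<longleftrightarrow> n = k" for n by (auto simp: \<alpha>12)
  have zd: "zdz_minus T \<alpha>1 (el \<alpha>1 A B) = zpow_mult k (el \<alpha>2 0 A)"
  proof
    fix z
    show "zdz_minus T \<alpha>1 (el \<alpha>1 A B) z = zpow_mult k (el \<alpha>2 0 A) z"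
    proof (cases "z = 0")
      case True
      thus ?thesis unfolding zdz_el by (simp add: el_hs zpow_mult_def)
    next
      case False
      have "zp (\<alpha>1 - \<alpha>2) z = z ^ k" using zp_add_nat[OF False, of 0 k] by (simp add: \<alpha>12)
      thus ?thesis unfolding zdz_el by (simp add: el_def zpow_mult_def mult.commute)
    qed
  qed
  show ?thesis
  proof
    assume "companion T \<alpha>1 \<alpha>2 (el \<alpha>1 A B) \<sigma>"
    hence \<sigma>: "\<sigma> \<in> elementary T \<alpha>2" and eq: "zpow_mult k (el \<alpha>2 0 A) = zpow_mult k \<sigma>"
      unfolding companion_def zd by (auto simp: n)
    show "\<sigma> = el \<alpha>2 0 A"
    proof
      fix z
      show "\<sigma> z = el \<alpha>2 0 A z"
      proof (cases "z = 0")
        case True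
        have "\<sigma> 0 = 0" using \<sigma> unfolding elementary_def by blast
        thus ?thesis using True by (simp add: el_hs)
      next
        case False
        thus ?thesis using fun_cong[OF eq, of z] by (simp add: zpow_mult_def)
      qed
    qed
  next
    assume \<sigma>: "\<sigma> = el \<alpha>2 0 A"
    show "companion T \<alpha>1 \<alpha>2 (el \<alpha>1 A B) \<sigma>"
      unfolding companion_def \<sigma> zd elementary_eq using n[of k] by blast
  qed
qed

text \<open>Relative to \<open>s2\<close> the coefficient \<open>B\<close> comes with
  \<open>z ^ k\<close>, so it affects the value at 0 only for \<open>k = 0\<close>. For
  \<open>k > 0\<close> the condition becomes \<open>x = t\<close> whatever \<open>A\<close> and
  \<open>B\<close> are: rescaling the first section rescales its companion alike.\<close>

lemma nss_basis_iff:
  assumes "A \<noteq> 0"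
  shows "germ_basis T (el \<alpha>1 A B + fscale x (el \<alpha>2 0 A)) (zpow_mult 1 (el \<alpha>2 0 A)) \<longleftrightarrow>
     (if k = 0 then B else 0) + x * A = t * A"
proof -
  define H where "H = fls_const B * fls_X ^ k + fls_const (x * A)"
  have "crd (el \<alpha>1 A B + fscale x (el \<alpha>2 0 A)) (fls_const A, H)"
    using crd_add[OF crd_el[of \<alpha>1 A B] crd_fscale[OF crd_el[of \<alpha>2 0 A], of x]]
    by (simp add: psmul_def H_def \<alpha>12)
  moreover have "crd (zpow_mult 1 (el \<alpha>2 0 A)) (0, fls_X * fls_const A)"
    using crd_zpow[OF crd_el[of \<alpha>2 0 A], of 1] by (simp add: psmul_def)
  ultimately have "germ_basis T (el \<alpha>1 A B + fscale x (el \<alpha>2 0 A)) (zpow_mult 1 (el \<alpha>2 0 A)) \<longleftrightarrow>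
     lat (1, fls_const t) (0, fls_X) = lat (fls_const A, H) (0, fls_X * fls_const A)"
    unfolding Lat_t[symmetric] by (rule germ_basis_iff)
  also have "\<dots> \<longleftrightarrow> fls_nth H 0 = t * A"
    by (rule lat_1t_eq_iff[OF assms]) (auto simp: H_def)
  also have "fls_nth H 0 = (if k = 0 then B else 0) + x * A"
    using reg_nth0_mult[OF reg_const(1) reg_power[OF reg_const(4)], of B k] by (simp add: H_def)
  finally show ?thesis .
qed

lemma parameter_iff:
  assumes "A \<noteq> 0"
  shows "parameter_nss T \<alpha>1 \<alpha>2 (el \<alpha>1 A B) x \<longleftrightarrow> (if k = 0 then B else 0) + x * A = t * A"
  unfolding parameter_nss_def companion_iff using nss_basis_iff[OF assms] by simp

lemma nss_leading:
  assumes "exp (- 2 * of_real pi * \<i> * \<alpha>1) = l" "exp (- 2 * of_real pi * \<i> * \<alpha>2) = l"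
  shows "leading_exponents_nss T l \<alpha>1 \<alpha>2"
  unfolding leading_exponents_nss_def
proof (intro conjI ballI assms)
  show "\<alpha>1 - \<alpha>2 \<in> \<nat>" by (simp add: \<alpha>12)
  fix \<sigma> assume "\<sigma> \<in> elementary T \<alpha>1 - elementary_ker T \<alpha>1"
  then obtain A B where AB: "\<sigma> = el \<alpha>1 A B" "A \<noteq> 0" unfolding nonker_eq by blast
  show "\<exists>!s2. companion T \<alpha>1 \<alpha>2 \<sigma> s2" unfolding AB(1) companion_iff by blast
  have nz: "el \<alpha>2 0 A \<noteq> 0" using el_eq_iff[of \<alpha>2 0 A 0 0] AB(2) by (simp add: el_0)
  have "elementary_ker T \<alpha>2 = sec.span {el \<alpha>2 0 A}"
  proof (intro set_eqI iffI)
    fix \<rho> assume "\<rho> \<in> elementary_ker T \<alpha>2"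
    then obtain B' where "\<rho> = el \<alpha>2 0 B'" unfolding elementary_ker_eq by auto
    hence "\<rho> = fscale (B' / A) (el \<alpha>2 0 A)" using AB(2) by (simp add: el_def fscale_def fun_eq_iff)
    thus "\<rho> \<in> sec.span {el \<alpha>2 0 A}" by (simp add: sec.span_scale sec.span_base)
  next
    fix \<rho> assume "\<rho> \<in> sec.span {el \<alpha>2 0 A}"
    then obtain b where "\<rho> = fscale b (el \<alpha>2 0 A)" unfolding sec.span_singleton by blast
    hence "\<rho> = el \<alpha>2 0 (b * A)" by (simp add: el_def fscale_def fun_eq_iff)
    thus "\<rho> \<in> elementary_ker T \<alpha>2" unfolding elementary_ker_eq by auto
  qed
  moreover have "\<exists>x. germ_basis T (el \<alpha>1 A B + fscale x (el \<alpha>2 0 A)) (zpow_mult 1 (el \<alpha>2 0 A))"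
    unfolding nss_basis_iff[OF AB(2)]
    by (intro exI[of _ "t - (if k = 0 then B else 0) / A"]) (use AB(2) in \<open>simp add: algebra_simps\<close>)
  ultimately show "\<forall>s2. companion T \<alpha>1 \<alpha>2 \<sigma> s2 \<longrightarrow> s2 \<noteq> 0 \<and> elementary_ker T \<alpha>2 = sec.span {s2} \<and>
           (\<exists>t2. germ_basis T (\<sigma> + fscale t2 s2) (zpow_mult 1 s2))"
    unfolding AB(1) companion_iff using nz by simp
qed

text \<open>The first generator has the coordinate \<open>z\<close> to the power \<open>i\<close>
  along \<open>s1\<close>, the second has none there, so mutual inclusion of the lattices gives
  \<open>0 \<le> i\<close> and \<open>i \<le> 0\<close>. The determinants then give
  \<open>i + j = 0\<close>.\<close>

lemma nss_unique:
  assumes l: "exp (- 2 * of_real pi * \<i> * \<alpha>1) = l" "exp (- 2 * of_real pi * \<i> * \<alpha>2) = l"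
    and lead: "leading_exponents_nss T l \<beta>1 \<beta>2"
  shows "\<beta>1 = \<alpha>1 \<and> \<beta>2 = \<alpha>2"
proof -
  have ints: "\<beta> - \<alpha> \<in> \<int>" if "exp (- 2 * of_real pi * \<i> * \<alpha>) = l" "exp (- 2 * of_real pi * \<i> * \<beta>) = l" for \<alpha> \<beta>
  proof -
    have "exp (2 * of_real pi * \<i> * (\<beta> - \<alpha>)) = exp (- 2 * of_real pi * \<i> * \<alpha>) / exp (- 2 * of_real pi * \<i> * \<beta>)"
      by (simp add: algebra_simps flip: exp_diff)
    also have "\<dots> = 1" using that exp_not_eq_zero[of "- 2 * of_real pi * \<i> * \<beta>"] by simp
    finally show ?thesis unfolding exp_2pi_eq_1_iff .
  qed
  have b: "exp (- 2 * of_real pi * \<i> * \<beta>1) = l" "exp (- 2 * of_real pi * \<i> * \<beta>2) = l"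
    and all: "\<And>s1. s1 \<in> elementary T \<beta>1 - elementary_ker T \<beta>1 \<Longrightarrow> (\<exists>!s2. companion T \<beta>1 \<beta>2 s1 s2) \<and>
        (\<forall>s2. companion T \<beta>1 \<beta>2 s1 s2 \<longrightarrow> s2 \<noteq> 0 \<and> elementary_ker T \<beta>2 = sec.span {s2} \<and>
           (\<exists>t2. germ_basis T (s1 + fscale t2 s2) (zpow_mult 1 s2)))"
    using lead unfolding leading_exponents_nss_def by blast+
  obtain i where i: "\<beta>1 - \<alpha>1 = of_int i" using ints[OF l(1) b(1)] by (elim Ints_cases)
  obtain j where j: "\<beta>2 - \<alpha>2 = of_int j" using ints[OF l(2) b(2)] by (elim Ints_cases)
  have ik: "\<beta>1 - \<alpha>2 = of_int (i + int k)" using i by (simp add: \<alpha>12 algebra_simps)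
  \<comment> \<open>The new exponents differ from those of the frame by integers, because all belong
    to the eigenvalue \<open>l\<close>. So this section is outside the kernel, and the defining
    property of \<open>\<beta>1, \<beta>2\<close> applies to it.\<close>
  define \<sigma> where "\<sigma> = el \<beta>1 1 0"
  have "\<sigma> \<notin> elementary_ker T \<beta>1"
    unfolding elementary_ker_eq \<sigma>_def using el_eq_iff[of \<beta>1 1 0] i ik by auto
  hence "\<sigma> \<in> elementary T \<beta>1 - elementary_ker T \<beta>1" unfolding elementary_eq \<sigma>_def by blast
  from all[OF this] obtain \<rho> x where \<rho>: "companion T \<beta>1 \<beta>2 \<sigma> \<rho>"
    and basis: "germ_basis T (\<sigma> + fscale x \<rho>) (zpow_mult 1 \<rho>)" by blast
  obtain n where n: "\<beta>1 - \<beta>2 = of_nat n" "zdz_minus T \<beta>1 \<sigma> = zpow_mult n \<rho>"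
    using \<rho> unfolding companion_def by blast
  obtain A B where AB: "\<rho> = el \<beta>2 A B" using \<rho> unfolding companion_def elementary_eq by blast
  have c\<rho>: "crd \<rho> (fls_const A * zpF (\<beta>2 - \<alpha>1), fls_const B * zpF (\<beta>2 - \<alpha>2))"
    unfolding AB by (rule crd_el)
  have "crd (zdz_minus T \<beta>1 \<sigma>) (0, zpF (\<beta>1 - \<alpha>2))"
    using crd_el[of \<beta>1 0 1] by (simp add: \<sigma>_def zdz_el)
  \<comment> \<open>Comparison of coordinates shows that the companion has no component along
    \<open>s1\<close>.\<close>
  from crd_unique[OF this crd_zpow[OF c\<rho>, of n, folded n(2)]]
  have A: "fls_const A * zpF (\<beta>2 - \<alpha>1) = 0" by (simp add: psmul_def)
  define W where "W = fls_const B * zpF (\<beta>2 - \<alpha>2)"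
  have W: "W = fls_const B * fls_X_intpow j" by (simp add: W_def j)
  have v: "crd (\<sigma> + fscale x \<rho>) (fls_X_intpow i, fls_const x * W)"
    using crd_add[OF crd_el[of \<beta>1 1 0] crd_fscale[OF c\<rho>[unfolded A], of x]]
    by (simp add: \<sigma>_def psmul_def i W_def)
  have w: "crd (zpow_mult 1 \<rho>) (0, fls_X * W)"
    using crd_zpow[OF c\<rho>[unfolded A], of 1] by (simp add: psmul_def W_def)
  have eq: "lat (1, fls_const t) (0, fls_X) = lat (fls_X_intpow i, fls_const x * W) (0, fls_X * W)"
    using germ_basis_iff[OF v w] basis Lat_t by simp
  have "pdet (1, fls_const t) (0, fls_X) \<noteq> 0" by (simp add: pdet_def)
  with eq obtain d d' where d: "reg d" "reg d'" "d * d' = 1"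
    "pdet (fls_X_intpow i, fls_const x * W) (0, fls_X * W) = d * pdet (1, fls_const t) (0, fls_X)"
    by (rule lat_eq_unit)
  have "fls_X * (fls_const B * (fls_X_intpow i * fls_X_intpow j)) = fls_X * d"
    using d(4) unfolding W by (simp add: pdet_def mult_ac)
  hence "d = fls_const B * fls_X_intpow (i + j)" unfolding intpow_mult by simp
  from intpow_unit[OF d(1-3) this] have ij: "i + j = 0" .
  have "(fls_X_intpow i, fls_const x * W) \<in> lat (1, fls_const t) (0, fls_X)"
    unfolding eq by (rule lat_gens)
  from lat_1t_D(1)[OF this] have "0 \<le> i" by (simp add: reg_X_intpow_iff)
  moreover have "i \<le> 0"
  proof -
    have "(1, fls_const t) \<in> lat (fls_X_intpow i, fls_const x * W) (0, fls_X * W)"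
      unfolding eq[symmetric] by (rule lat_gens)
    then obtain p q where pq: "reg p" "reg q"
      "(1, fls_const t) = psmul p (fls_X_intpow i, fls_const x * W) + psmul q (0, fls_X * W)" by (rule latE)
    hence p: "p * fls_X_intpow i = 1" by (simp add: psmul_def)
    hence "p \<noteq> 0" by auto
    hence "fls_subdegree p + i = 0"
      using arg_cong[OF p, of fls_subdegree] by simp
    thus ?thesis using pq(1) by (simp add: reg_def)
  qed
  ultimately have i0: "i = 0" "j = 0" using ij by simp_all
  have "\<beta>1 - \<alpha>1 = 0" "\<beta>2 - \<alpha>2 = 0" unfolding i j i0 by simp_all
  thus ?thesis by simp
qed

end

section \<open>Normal forms of a given structure and classification\<close>

lemma ss_normal_form:
  assumes "te_structure T" "regular_singular T" "\<not> logarithmic T" "mon_eigenvalues T = {l1, l2}"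
    and "N_mon_zero T"
  obtains s1 s2 \<alpha>1 \<alpha>2 where "mero_frame T s1 s2 \<alpha>1 \<alpha>2 0 0" "\<alpha>1 \<noteq> \<alpha>2"
    "te_frame.Lat T s1 s2 = lat (1, 1) (0, fls_X)"
    "exp (- 2 * of_real pi * \<i> * \<alpha>1) = l1" "exp (- 2 * of_real pi * \<i> * \<alpha>2) = l2"
proof -
  obtain e1 e2 a1 a2 \<kappa> where f: "mero_frame T e1 e2 a1 a2 \<kappa> 0"
    and l: "exp (- 2 * of_real pi * \<i> * a1) = l1" "exp (- 2 * of_real pi * \<i> * a2) = l2"
    and a: "l1 = l2 \<longrightarrow> a1 = a2" and "\<kappa> = 0 \<or> \<kappa> = 1 \<and> l1 = l2"
    and \<kappa>: "N_mon_zero T \<longleftrightarrow> \<kappa> = 0"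
    by (rule base_frame[OF assms(1,2,4)])
  interpret f: mero_frame T e1 e2 a1 a2 \<kappa> 0 by (rule f)
  \<comment> \<open>Exponents with integral difference belong to the same eigenvalue, and
    \<open>base_frame\<close> assigns equal exponents to equal eigenvalues.\<close>
  have int: "a1 - a2 \<in> \<int> \<Longrightarrow> a1 = a2"
  proof -
    assume "a1 - a2 \<in> \<int>"
    then obtain i where "a1 - a2 = of_int i" by (elim Ints_cases)
    hence "a1 = a2 + of_int i" by (simp add: algebra_simps)
    hence "l1 = l2" using l exp_shift_int[of a2 i] by (simp only:)
    thus "a1 = a2" using a by simp
  qed
  from f.normal_ss[OF assms(3) _ refl int] \<kappa> assms(5)
  obtain t1 t2 m n where t: "mero_frame T t1 t2 (a1 + of_int m) (a2 + of_int n) 0 0"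
    "a1 + of_int m \<noteq> a2 + of_int n" "te_frame.Lat T t1 t2 = lat (1, 1) (0, fls_X)" by auto
  show ?thesis by (rule that[OF t]) (simp_all only: exp_shift_int l)
qed

lemma nss_normal_form:
  assumes "te_structure T" "regular_singular T" "\<not> logarithmic T" "mon_eigenvalues T = {l1, l2}"
    and "\<not> N_mon_zero T"
  obtains s1 s2 \<alpha>1 \<alpha>2 k t where "nss_frame T s1 s2 \<alpha>1 \<alpha>2 k t" "l1 = l2"
    "exp (- 2 * of_real pi * \<i> * \<alpha>1) = l1" "exp (- 2 * of_real pi * \<i> * \<alpha>2) = l1"
proof -
  obtain e1 e2 a1 a2 \<kappa> where f: "mero_frame T e1 e2 a1 a2 \<kappa> 0"
    and l: "exp (- 2 * of_real pi * \<i> * a1) = l1" "exp (- 2 * of_real pi * \<i> * a2) = l2"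
    and "l1 = l2 \<longrightarrow> a1 = a2"
    and \<kappa>: "\<kappa> = 0 \<or> \<kappa> = 1 \<and> l1 = l2" "N_mon_zero T \<longleftrightarrow> \<kappa> = 0"
    by (rule base_frame[OF assms(1,2,4)])
  interpret f: mero_frame T e1 e2 a1 a2 \<kappa> 0 by (rule f)
  have \<kappa>1: "\<kappa> = 1" "l1 = l2" using \<kappa> assms(5) by auto
  from f.normal_nss[OF assms(3) \<kappa>1(1) refl]
  obtain t1 t2 n k' t where t: "mero_frame T t1 t2 (a2 + of_int n + of_nat k') (a2 + of_int n) 1 k'"
    "te_frame.Lat T t1 t2 = lat (1, fls_const t) (0, fls_X)" "t = 0 \<longleftrightarrow> k' = 0" by blast
  have "nss_frame T t1 t2 (a2 + of_int n + of_nat k') (a2 + of_int n) k' t"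
    unfolding nss_frame_def nss_frame_axioms_def using t by simp
  moreover have "exp (- 2 * of_real pi * \<i> * (a2 + of_int n + of_nat k')) = l1"
  proof -
    have "a2 + of_int n + of_nat k' = a2 + of_int (n + int k')" by simp
    thus ?thesis by (simp only: exp_shift_int l \<kappa>1)
  qed
  moreover have "exp (- 2 * of_real pi * \<i> * (a2 + of_int n)) = l1"
    by (simp only: exp_shift_int l \<kappa>1)
  ultimately show ?thesis using that \<kappa>1(2) by blast
qed

theorem theorem4p17:
  fixes T :: te and l1 l2 :: complex
  assumes "te_structure T" and "regular_singular T" and "\<not> logarithmic T"
    and "mon_eigenvalues T = {l1, l2}"
  shows
    "(N_mon_zero T \<longrightarrow>
       (\<exists>\<alpha>1 \<alpha>2.
          leading_exponents_ss T l1 l2 \<alpha>1 \<alpha>2 \<and>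
          (\<forall>\<beta>1 \<beta>2. leading_exponents_ss T l1 l2 \<beta>1 \<beta>2 \<longleftrightarrow>
             (\<beta>1, \<beta>2) = (\<alpha>1, \<alpha>2) \<or> l1 = l2 \<and> (\<beta>1, \<beta>2) = (\<alpha>2, \<alpha>1)) \<and>
          (\<forall>T' l1' l2' \<beta>1 \<beta>2.
             te_structure T' \<and> regular_singular T' \<and> \<not> logarithmic T' \<and>
             mon_eigenvalues T' = {l1', l2'} \<and> N_mon_zero T' \<and>
             leading_exponents_ss T' l1' l2' \<beta>1 \<beta>2 \<and> {\<beta>1, \<beta>2} = {\<alpha>1, \<alpha>2} \<longrightarrow>
             te_isomorphic T T'))) \<and>
     (\<not> N_mon_zero T \<longrightarrow>
       l1 = l2 \<and>
       (\<exists>\<alpha>1 \<alpha>2.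
          leading_exponents_nss T l1 \<alpha>1 \<alpha>2 \<and>
          (\<forall>\<beta>1 \<beta>2. leading_exponents_nss T l1 \<beta>1 \<beta>2 \<longrightarrow> \<beta>1 = \<alpha>1 \<and> \<beta>2 = \<alpha>2) \<and>
          elementary T \<alpha>1 - elementary_ker T \<alpha>1 \<noteq> {} \<and>
          (\<alpha>1 \<noteq> \<alpha>2 \<longrightarrow>
             (\<exists>t2. t2 \<noteq> 0 \<and>
                (\<forall>s1 \<in> elementary T \<alpha>1 - elementary_ker T \<alpha>1. \<forall>t.
                   parameter_nss T \<alpha>1 \<alpha>2 s1 t \<longleftrightarrow> t = t2))) \<and>
          (\<alpha>1 = \<alpha>2 \<longrightarrow>
             (\<forall>s1 \<in> elementary T \<alpha>1 - elementary_ker T \<alpha>1. \<forall>s2 t2.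
                companion T \<alpha>1 \<alpha>2 s1 s2 \<and>
                germ_basis T (s1 + fscale t2 s2) (zpow_mult 1 s2) \<longrightarrow>
                s1 + fscale t2 s2 \<in> elementary T \<alpha>1 - elementary_ker T \<alpha>1 \<and>
                companion T \<alpha>1 \<alpha>2 (s1 + fscale t2 s2) s2 \<and>
                (\<forall>t. parameter_nss T \<alpha>1 \<alpha>2 (s1 + fscale t2 s2) t \<longleftrightarrow> t = 0))) \<and>
          (\<forall>T' l1' l2'.
             te_structure T' \<and> regular_singular T' \<and> \<not> logarithmic T' \<and>
             mon_eigenvalues T' = {l1', l2'} \<and> \<not> N_mon_zero T' \<and>
             leading_exponents_nss T' l1' \<alpha>1 \<alpha>2 \<and>
             (\<alpha>1 \<noteq> \<alpha>2 \<longrightarrow>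
                (\<exists>t2. (\<exists>s1 \<in> elementary T \<alpha>1 - elementary_ker T \<alpha>1.
                          parameter_nss T \<alpha>1 \<alpha>2 s1 t2) \<and>
                      (\<exists>s1 \<in> elementary T' \<alpha>1 - elementary_ker T' \<alpha>1.
                          parameter_nss T' \<alpha>1 \<alpha>2 s1 t2))) \<longrightarrow>
             te_isomorphic T T')))"
proof (intro conjI impI, goal_cases)
  case N: 1
  obtain s1 s2 \<alpha>1 \<alpha>2 where f: "mero_frame T s1 s2 \<alpha>1 \<alpha>2 0 0" and neq: "\<alpha>1 \<noteq> \<alpha>2"
    and Lat: "te_frame.Lat T s1 s2 = lat (1, 1) (0, fls_X)"
    and l: "exp (- 2 * of_real pi * \<i> * \<alpha>1) = l1" "exp (- 2 * of_real pi * \<i> * \<alpha>2) = l2"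
    by (rule ss_normal_form[OF assms N])
  interpret f: mero_frame T s1 s2 \<alpha>1 \<alpha>2 0 0 by (rule f)
  have lead: "leading_exponents_ss T l1 l2 \<alpha>1 \<alpha>2" by (rule f.ss_leading[OF Lat neq l])
  have unique: "leading_exponents_ss T l1 l2 \<beta>1 \<beta>2 \<longleftrightarrow>
      (\<beta>1, \<beta>2) = (\<alpha>1, \<alpha>2) \<or> l1 = l2 \<and> (\<beta>1, \<beta>2) = (\<alpha>2, \<alpha>1)" for \<beta>1 \<beta>2
  proof
    assume \<beta>: "leading_exponents_ss T l1 l2 \<beta>1 \<beta>2"
    hence "exp (- 2 * of_real pi * \<i> * \<beta>1) = l1" unfolding leading_exponents_ss_def by blast
    \<comment> \<open>If the pair is swapped, then \<open>\<beta>1 = \<alpha>2\<close> belongs to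
      both eigenvalues, so they are equal.\<close>
    thus "(\<beta>1, \<beta>2) = (\<alpha>1, \<alpha>2) \<or> l1 = l2 \<and> (\<beta>1, \<beta>2) = (\<alpha>2, \<alpha>1)"
      using f.ss_unique[OF Lat \<beta>] l(2) by auto
  next
    assume "(\<beta>1, \<beta>2) = (\<alpha>1, \<alpha>2) \<or> l1 = l2 \<and> (\<beta>1, \<beta>2) = (\<alpha>2, \<alpha>1)"
    thus "leading_exponents_ss T l1 l2 \<beta>1 \<beta>2"
      using lead leading_exponents_ss_swap by auto
  qed
  have iso: "te_isomorphic T T'"
    if T': "te_structure T'" "regular_singular T'" "\<not> logarithmic T'" "mon_eigenvalues T' = {l1', l2'}"
      "N_mon_zero T'" and \<beta>: "leading_exponents_ss T' l1' l2' \<beta>1 \<beta>2" "{\<beta>1, \<beta>2} = {\<alpha>1, \<alpha>2}"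
    for T' l1' l2' \<beta>1 \<beta>2
  proof -
    obtain s1' s2' \<alpha>1' \<alpha>2' where f': "mero_frame T' s1' s2' \<alpha>1' \<alpha>2' 0 0" and "\<alpha>1' \<noteq> \<alpha>2'"
      and Lat': "te_frame.Lat T' s1' s2' = lat (1, 1) (0, fls_X)"
      and "exp (- 2 * of_real pi * \<i> * \<alpha>1') = l1'" "exp (- 2 * of_real pi * \<i> * \<alpha>2') = l2'"
      by (rule ss_normal_form[OF T'])
    interpret f': mero_frame T' s1' s2' \<alpha>1' \<alpha>2' 0 0 by (rule f')
    \<comment> \<open>Uniqueness, applied to the normal form of \<open>T'\<close>, identifies its
      exponents with the given set, possibly in the other order; in that case its frame is
      swapped.\<close>
    have "\<alpha>1' = \<alpha>1 \<and> \<alpha>2' = \<alpha>2 \<or> \<alpha>1' = \<alpha>2 \<and> \<alpha>2' = \<alpha>1"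
      using f'.ss_unique[OF Lat' \<beta>(1)] \<beta>(2) by (auto simp: doubleton_eq_iff)
    thus ?thesis
    proof
      assume "\<alpha>1' = \<alpha>1 \<and> \<alpha>2' = \<alpha>2"
      thus ?thesis using frame_iso[OF f, of T' s1' s2' 1] f' Lat Lat' by simp
    next
      assume "\<alpha>1' = \<alpha>2 \<and> \<alpha>2' = \<alpha>1"
      thus ?thesis
        using frame_iso[OF f, of T' s2' s1' 1] f'.frame_swap[OF refl] f'.swap_Lat[OF refl Lat'] Lat by simp
    qed
  qed
  show ?case
    by (rule exI[of _ \<alpha>1], rule exI[of _ \<alpha>2], intro conjI allI impI lead unique, elim conjE, rule iso)
next
  case N: 2
  show ?case by (rule nss_normal_form[OF assms N])
next
  case N: 3
  obtain s1 s2 \<alpha>1 \<alpha>2 k t where f: "nss_frame T s1 s2 \<alpha>1 \<alpha>2 k t" and "l1 = l2"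
    and l: "exp (- 2 * of_real pi * \<i> * \<alpha>1) = l1" "exp (- 2 * of_real pi * \<i> * \<alpha>2) = l1"
    by (rule nss_normal_form[OF assms N])
  interpret f: nss_frame T s1 s2 \<alpha>1 \<alpha>2 k t by (rule f)
  have k: "\<alpha>1 = \<alpha>2 \<longleftrightarrow> k = 0" using f.\<alpha>12 by simp
  have lead: "leading_exponents_nss T l1 \<alpha>1 \<alpha>2" by (rule f.nss_leading[OF l])
  have unique: "\<beta>1 = \<alpha>1 \<and> \<beta>2 = \<alpha>2" if "leading_exponents_nss T l1 \<beta>1 \<beta>2" for \<beta>1 \<beta>2
    by (rule f.nss_unique[OF l that])
  have "f.el \<alpha>1 1 0 \<in> elementary T \<alpha>1 - elementary_ker T \<alpha>1" unfolding f.nonker_eq by force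
  hence ne: "elementary T \<alpha>1 - elementary_ker T \<alpha>1 \<noteq> {}" by blast
  have par: "\<exists>t2. t2 \<noteq> 0 \<and> (\<forall>s1 \<in> elementary T \<alpha>1 - elementary_ker T \<alpha>1. \<forall>t.
      parameter_nss T \<alpha>1 \<alpha>2 s1 t \<longleftrightarrow> t = t2)" if "\<alpha>1 \<noteq> \<alpha>2"
    using that f.t0 unfolding k f.nonker_eq
    by (intro exI[of _ t]) (auto simp: f.parameter_iff)
  have normalize: "\<sigma> + fscale x \<rho> \<in> elementary T \<alpha>1 - elementary_ker T \<alpha>1 \<and>
      companion T \<alpha>1 \<alpha>2 (\<sigma> + fscale x \<rho>) \<rho> \<and>
      (\<forall>t. parameter_nss T \<alpha>1 \<alpha>2 (\<sigma> + fscale x \<rho>) t \<longleftrightarrow> t = 0)"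
    if eq: "\<alpha>1 = \<alpha>2" and \<sigma>: "\<sigma> \<in> elementary T \<alpha>1 - elementary_ker T \<alpha>1"
      and \<rho>: "companion T \<alpha>1 \<alpha>2 \<sigma> \<rho>" "germ_basis T (\<sigma> + fscale x \<rho>) (zpow_mult 1 \<rho>)" for \<sigma> \<rho> x
  proof -
    have k0: "k = 0" "t = 0" using eq k f.t0 by auto
    obtain A B where AB: "\<sigma> = f.el \<alpha>1 A B" "A \<noteq> 0" using \<sigma> unfolding f.nonker_eq by blast
    have \<rho>_eq: "\<rho> = f.el \<alpha>2 0 A" using \<rho>(1) unfolding AB(1) f.companion_iff .
    \<comment> \<open>With \<open>k\<close> and \<open>t\<close> equal to 0, the basis condition
      says that the \<open>s2\<close> component of the new first section vanishes.\<close>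
    have "B + x * A = 0" using \<rho>(2) unfolding AB(1) \<rho>_eq f.nss_basis_iff[OF AB(2)] using k0 by simp
    moreover have "\<sigma> + fscale x \<rho> = f.el \<alpha>1 A (B + x * A)"
      unfolding AB(1) \<rho>_eq f.el_def using eq
      by (simp add: fun_eq_iff fscale_def vec_eq_iff algebra_simps)
    ultimately have new: "\<sigma> + fscale x \<rho> = f.el \<alpha>1 A 0" by simp
    show ?thesis unfolding new unfolding \<rho>_eq f.companion_iff f.parameter_iff[OF AB(2)] f.nonker_eq
      using AB(2) k0 by auto
  qed
  have iso: "te_isomorphic T T'"
    if T': "te_structure T'" "regular_singular T'" "\<not> logarithmic T'" "mon_eigenvalues T' = {l1', l2'}"
      "\<not> N_mon_zero T'" and \<beta>: "leading_exponents_nss T' l1' \<alpha>1 \<alpha>2"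
      and p: "\<alpha>1 \<noteq> \<alpha>2 \<longrightarrow>
                (\<exists>t2. (\<exists>s1 \<in> elementary T \<alpha>1 - elementary_ker T \<alpha>1.
                          parameter_nss T \<alpha>1 \<alpha>2 s1 t2) \<and>
                      (\<exists>s1 \<in> elementary T' \<alpha>1 - elementary_ker T' \<alpha>1.
                          parameter_nss T' \<alpha>1 \<alpha>2 s1 t2))"
    for T' l1' l2'
  proof -
    obtain s1' s2' \<alpha>1' \<alpha>2' k' t' where f': "nss_frame T' s1' s2' \<alpha>1' \<alpha>2' k' t'" and "l1' = l2'"
      and l': "exp (- 2 * of_real pi * \<i> * \<alpha>1') = l1'" "exp (- 2 * of_real pi * \<i> * \<alpha>2') = l1'"
      by (rule nss_normal_form[OF T'])
    interpret f': nss_frame T' s1' s2' \<alpha>1' \<alpha>2' k' t' by (rule f')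
    have \<alpha>': "\<alpha>1' = \<alpha>1" "\<alpha>2' = \<alpha>2" using f'.nss_unique[OF l' \<beta>] by auto
    have k': "k' = k" using f.\<alpha>12 f'.\<alpha>12 unfolding \<alpha>' by simp
    have t': "t' = t"
    proof (cases "k = 0")
      case True
      thus ?thesis using f.t0 f'.t0 k' by simp
    next
      case False
      then obtain x \<sigma> \<sigma>' where x: "\<sigma> \<in> elementary T \<alpha>1 - elementary_ker T \<alpha>1" "parameter_nss T \<alpha>1 \<alpha>2 \<sigma> x"
        "\<sigma>' \<in> elementary T' \<alpha>1 - elementary_ker T' \<alpha>1" "parameter_nss T' \<alpha>1 \<alpha>2 \<sigma>' x"
        using p k by blast
      \<comment> \<open>For different exponents the parameter does not depend on the section chosen,
        so one common value identifies \<open>t\<close> and \<open>t'\<close>.\<close>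
      have "x = t" using x(1,2) False unfolding f.nonker_eq by (auto simp: f.parameter_iff)
      moreover have "x = t'"
        using x(3,4) False k' f'.nonker_eq f'.parameter_iff unfolding \<alpha>' by auto
      ultimately show ?thesis by simp
    qed
    show ?thesis
      by (rule frame_iso[OF f.mero_frame_axioms f'.mero_frame_axioms[unfolded \<alpha>' k'] f.Lat_t f'.Lat_t[unfolded t']])
  qed
  show ?case
  proof (rule exI[of _ \<alpha>1], rule exI[of _ \<alpha>2], intro conjI, goal_cases)
    case 1
    show ?case by (rule lead)
  next
    case 2
    show ?case by (intro allI impI unique)
  next
    case 3
    show ?case by (rule ne)
  next
    case 4
    show ?case by (rule impI) (rule par)
  next
    case 5
    show ?case by (intro impI ballI allI, elim conjE) (rule normalize)
  next
    case 6
    show ?case by (intro allI impI, elim conjE) (rule iso)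
  qed
qed

end
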